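(* Let $\mathcal M$ be a finite-dimensional von Neumann algebra with faithful trace $\tau$, and let $\mathcal N\subset\mathcal M$ be a von Neumann subalgebra. Then for all faithful states $\rho,\sigma$, all $s\in(-1,0)\cup(0,1)$ and all $t\in\mathbb R$, with $Q_s(\rho\|\sigma)=\tau(\rho^{1-s}\sigma^s)$ and $Q_{x^2}(\rho\|\sigma)=\tau(\rho^{-1}\sigma^2)$, \begin{align*} |Q_s(\rho\|\sigma)-Q_s(\rho_{\mathcal N}\|\sigma_{\mathcal N})| &\ge K(s,Q_{x^2}(\rho\|\sigma))\left(\frac{\pi}{4+2|s|}\|\sigma-R_\rho(\sigma_{\mathcal N})\|_1\right)^{4+2|s|},\\ |Q_s(\rho\|\sigma)-Q_s(\rho_{\mathcal N}\|\sigma_{\mathcal N})| &\ge K(s,Q_{x^2}(\rho\|\sigma))\left(\frac{\pi}{(4+2|s|)\cosh(\pi t)}\|\sigma-R^t_\rho(\sigma_{\mathcal N})\|_1\right)^{4+2|s|},\\ |Q_s(\rho\|\sigma)-Q_s(\rho_{\mathcal N}\|\sigma_{\mathcal N})| &\ge K(s,Q_{x^2}(\rho\|\sigma))\left(\frac{1}{2+|s|}\|\sigma-R^u_\rho(\sigma_{\mathcal N})\|_1\right)^{4+2|s|}, \end{align*} where for $q>0$, $K(s,q)=\frac{\sin(\pi|s|)}{\pi}\left(\frac{(|s|+1)^2}{16q}\right)^{|s|+1}$ if $-1<s<0$, and $K(s,q)=\frac{\sin(\pi s)}{\pi q}\frac{s^{2s}}{16^{s+1}}$ if $0<s<1$.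
   Context: $\mathcal M$ is a finite-dimensional von Neumann algebra with faithful trace $\tau$; $\mathcal N\subset\mathcal M$ is a von Neumann subalgebra containing the identity, and $E:\mathcal M\to\mathcal N$ is the trace-preserving conditional expectation ($\tau(xy)=\tau(xE(y))$ for $x\in\mathcal N$, $y\in\mathcal M$). A state is a density operator $\rho\ge0$ with $\tau(\rho)=1$; faithful means invertible. $\rho_{\mathcal N}:=E(\rho)$, $\sigma_{\mathcal N}:=E(\sigma)$. $\|x\|_1=\tau(|x|)$. For faithful $\rho$ and $t\in\mathbb R$, $R^t_\rho(x)=\rho^{\frac12-it}\rho_{\mathcal N}^{-\frac12+it}\,x\,\rho_{\mathcal N}^{-\frac12-it}\rho^{\frac12+it}$ for $x\in\mathcal N$; $R_\rho:=R^0_\rho$; $R^u_\rho(x)=\int_{\mathbb R}R_\rho^{t/2}(x)\,d\beta(t)$ with $d\beta(t)=\frac{\pi}{2}(\cosh(\pi t)+1)^{-1}dt$. *)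

theory Defs
  imports "HOL-Analysis.Analysis"
begin

type_synonym 'n cmat = "complex ^'n ^'n"

definition cadj :: "'n::finite cmat \<Rightarrow> 'n cmat" where
  "cadj A = (\<chi> i j. cnj (A $ j $ i))"

definition smul :: "complex \<Rightarrow> 'n::finite cmat \<Rightarrow> 'n cmat" where
  "smul c A = (\<chi> i j. c * A $ i $ j)"

definition cdiag :: "('n::finite \<Rightarrow> complex) \<Rightarrow> 'n cmat" where
  "cdiag d = (\<chi> i j. if i = j then d i else 0)"

definition unitary_mat :: "'n::finite cmat \<Rightarrow> bool" where
  "unitary_mat U \<longleftrightarrow> cadj U ** U = mat 1 \<and> U ** cadj U = mat 1"

definition hermitian_mat :: "'n::finite cmat \<Rightarrow> bool" where
  "hermitian_mat A \<longleftrightarrow> cadj A = A"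

definition psd :: "'n::finite cmat \<Rightarrow> bool" where
  "psd A \<longleftrightarrow> (\<forall>v::complex^'n. Im (\<Sum>i\<in>UNIV. cnj (v $ i) * (A *v v) $ i) = 0
                               \<and> 0 \<le> Re (\<Sum>i\<in>UNIV. cnj (v $ i) * (A *v v) $ i))"

definition matfun :: "(real \<Rightarrow> complex) \<Rightarrow> 'n::finite cmat \<Rightarrow> 'n cmat" where
  "matfun f A = (SOME B. \<exists>U d. unitary_mat U \<and>
       A = U ** cdiag (\<lambda>i. complex_of_real (d i)) ** cadj U \<and>
       B = U ** cdiag (\<lambda>i. f (d i)) ** cadj U)"

definition mpow :: "'n::finite cmat \<Rightarrow> complex \<Rightarrow> 'n cmat" where
  "mpow A z = matfun (\<lambda>x. complex_of_real x powr z) A"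

definition mabs :: "'n::finite cmat \<Rightarrow> 'n cmat" where
  "mabs x = matfun (\<lambda>y. complex_of_real (sqrt y)) (cadj x ** x)"

text \<open>Unital *-subalgebra of M_n(C) (= finite-dimensional von Neumann algebra).\<close>
definition star_subalg :: "'n::finite cmat set \<Rightarrow> bool" where
  "star_subalg M \<longleftrightarrow> mat 1 \<in> M \<and>
     (\<forall>x\<in>M. \<forall>y\<in>M. x + y \<in> M \<and> x ** y \<in> M) \<and>
     (\<forall>c. \<forall>x\<in>M. smul c x \<in> M) \<and> (\<forall>x\<in>M. cadj x \<in> M)"

definition faithful_trace :: "'n::finite cmat set \<Rightarrow> ('n cmat \<Rightarrow> complex) \<Rightarrow> bool" where
  "faithful_trace M \<tau> \<longleftrightarrow>
     (\<forall>x\<in>M. \<forall>y\<in>M. \<tau> (x + y) = \<tau> x + \<tau> y \<and> \<tau> (x ** y) = \<tau> (y ** x)) \<and>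
     (\<forall>c. \<forall>x\<in>M. \<tau> (smul c x) = c * \<tau> x) \<and>
     (\<forall>x\<in>M. x \<noteq> 0 \<longrightarrow> Im (\<tau> (cadj x ** x)) = 0 \<and> 0 < Re (\<tau> (cadj x ** x)))"

definition cond_exp :: "'n::finite cmat set \<Rightarrow> 'n cmat set \<Rightarrow> ('n cmat \<Rightarrow> complex)
                        \<Rightarrow> ('n cmat \<Rightarrow> 'n cmat) \<Rightarrow> bool" where
  "cond_exp M N \<tau> E \<longleftrightarrow> (\<forall>y\<in>M. E y \<in> N) \<and>
     (\<forall>x\<in>N. \<forall>y\<in>M. \<tau> (x ** y) = \<tau> (x ** E y))"

definition faithful_state :: "'n::finite cmat set \<Rightarrow> ('n cmat \<Rightarrow> complex) \<Rightarrow> 'n cmat \<Rightarrow> bool" where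
  "faithful_state M \<tau> \<rho> \<longleftrightarrow> \<rho> \<in> M \<and> psd \<rho> \<and> \<tau> \<rho> = 1 \<and> invertible \<rho>"

definition norm1 :: "('n::finite cmat \<Rightarrow> complex) \<Rightarrow> 'n cmat \<Rightarrow> real" where
  "norm1 \<tau> x = Re (\<tau> (mabs x))"

definition Rt :: "('n::finite cmat \<Rightarrow> 'n cmat) \<Rightarrow> 'n cmat \<Rightarrow> real \<Rightarrow> 'n cmat \<Rightarrow> 'n cmat" where
  "Rt E \<rho> t x = mpow \<rho> (1/2 - \<i> * of_real t) ** mpow (E \<rho>) (-1/2 + \<i> * of_real t) ** x
                  ** mpow (E \<rho>) (-1/2 - \<i> * of_real t) ** mpow \<rho> (1/2 + \<i> * of_real t)"

definition beta_dens :: "real \<Rightarrow> real" where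
  "beta_dens t = (pi / 2) / (cosh (pi * t) + 1)"

definition Ru :: "('n::finite cmat \<Rightarrow> 'n cmat) \<Rightarrow> 'n cmat \<Rightarrow> 'n cmat \<Rightarrow> 'n cmat" where
  "Ru E \<rho> x = integral\<^sup>L lborel (\<lambda>t. beta_dens t *\<^sub>R Rt E \<rho> (t / 2) x)"

definition Qs :: "('n::finite cmat \<Rightarrow> complex) \<Rightarrow> real \<Rightarrow> 'n cmat \<Rightarrow> 'n cmat \<Rightarrow> complex" where
  "Qs \<tau> s \<rho> \<sigma> = \<tau> (mpow \<rho> (of_real (1 - s)) ** mpow \<sigma> (of_real s))"

definition Qx2 :: "('n::finite cmat \<Rightarrow> complex) \<Rightarrow> 'n cmat \<Rightarrow> 'n cmat \<Rightarrow> complex" where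
  "Qx2 \<tau> \<rho> \<sigma> = \<tau> (matrix_inv \<rho> ** (\<sigma> ** \<sigma>))"

definition Kconst :: "real \<Rightarrow> real \<Rightarrow> real" where
  "Kconst s q = (if s < 0 then sin (pi * \<bar>s\<bar>) / pi * ((\<bar>s\<bar> + 1)^2 / (16 * q)) powr (\<bar>s\<bar> + 1)
                 else sin (pi * s) / (pi * q) * (s powr (2 * s) / 16 powr (s + 1)))"

end

theory Submission
  imports Defs
begin

text \<open>Write \<open>\<langle>x, y\<rangle> = \<tau> (x\<^sup>* y)\<close> and let \<open>\<Delta> x = \<sigma> x \<rho>\<^sup>-\<^sup>1\<close> be the relative modular operator. The map
  \<open>V x = x \<rho>\<^sub>N\<^sup>-\<^sup>1\<^sup>/\<^sup>2 \<rho>\<^sup>1\<^sup>/\<^sup>2\<close> is an isometry from the subalgebra that compresses \<open>\<Delta>\<close> to \<open>\<Delta>\<^sub>N\<close> and sends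
  \<open>\<rho>\<^sub>N\<^sup>1\<^sup>/\<^sup>2\<close> to \<open>\<rho>\<^sup>1\<^sup>/\<^sup>2\<close> (Petz). With
  \<open>w\<^sub>l = (l + \<Delta>)\<^sup>-\<^sup>1 \<rho>\<^sup>1\<^sup>/\<^sup>2 - V (l + \<Delta>\<^sub>N)\<^sup>-\<^sup>1 \<rho>\<^sub>N\<^sup>1\<^sup>/\<^sup>2\<close>, the Stieltjes representation of the power
  function writes the defect of \<open>Q\<^sub>s\<close> as an integral whose integrand dominates \<open>l\<^sup>1\<^sup>+\<^sup>s \<parallel>w\<^sub>l\<parallel>\<^sup>2\<close>, while the
  complex power \<open>1/2 + it\<close> writes the difference of \<open>\<sigma>\<^sup>1\<^sup>/\<^sup>2\<^sup>+\<^sup>i\<^sup>t\<close> and a square root of \<open>R\<^sup>t\<close> (up to a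
  unitary) as \<open>cosh (\<pi> t) / \<pi>\<close> times an integral of norm at most \<open>\<integral> l\<^sup>1\<^sup>/\<^sup>2 \<parallel>w\<^sub>l\<parallel> dl\<close>. The a priori bounds
  \<open>\<parallel>w\<^sub>l\<parallel> \<le> 2/l\<close> and \<open>\<parallel>w\<^sub>l\<parallel> \<le> 2 q\<^sup>1\<^sup>/\<^sup>2/l\<^sup>2\<close> control the latter integral near \<open>0\<close> and \<open>\<infinity>\<close>; optimizing
  the two cut-offs gives the constant \<open>K\<close>. The bound for \<open>R\<^sup>u\<close> is the average of the one for \<open>R\<^sup>t\<^sup>/\<^sup>2\<close>, because
  \<open>\<integral> cosh (\<pi> t/2) d\<beta>(t) = \<pi>/2\<close>.\<close>

section \<open>Stieltjes representation of powers\<close>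

lemma cpowr_pos: "x > 0 \<Longrightarrow> complex_of_real x powr z = exp (z * of_real (ln x))"
  by (simp add: powr_def Ln_of_real)

lemma norm_cpowr_pos: "x > 0 \<Longrightarrow> norm (complex_of_real x powr z) = x powr Re z"
  by (simp add: cpowr_pos powr_def)

text \<open>Euler's integral restated as a Bochner integral over the whole line, the form in which
  Fubini's theorem applies; the exponential form of the power makes measurability immediate.\<close>

lemma Gamma_integral_lborel:
  assumes "Re z > 0"
  shows "has_bochner_integral lborel
    (\<lambda>t. indicator {0<..} t *\<^sub>R (exp ((z - 1) * of_real (ln t)) * of_real (exp (- t)))) (Gamma z)"
    (is "has_bochner_integral _ ?g _")
proof -
  let ?f = "\<lambda>t. complex_of_real t powr (z - 1) / of_real (exp t)"
  have eq: "indicator {0<..} t *\<^sub>R ?f t = ?g t" for t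
    by (cases "t > 0") (auto simp: cpowr_pos exp_minus field_simps exp_of_real)
  have "integrable lebesgue ?g"
    using absolutely_integrable_Gamma_integral'[OF assms] unfolding set_integrable_def eq .
  moreover have meas: "?g \<in> borel_measurable lborel" by measurable
  ultimately have int: "integrable lborel ?g"
    using integrable_completion[OF meas] by simp
  have "(?g has_integral (integral\<^sup>L lborel ?g)) UNIV"
    using has_integral_integral_lborel[OF int] .
  moreover have "(?g has_integral Gamma z) UNIV"
  proof -
    have "((\<lambda>t. if t \<in> {0<..} then ?f t else 0) has_integral Gamma z) UNIV"
      using Gamma_integral_complex'[OF assms] by (subst has_integral_restrict_UNIV)
    thus ?thesis
    proof (rule has_integral_eq[rotated])
      show "(if t \<in> {0<..} then ?f t else 0) = ?g t" for t
        using eq[of t] by (cases "t > 0") auto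
    qed
  qed
  ultimately have "integral\<^sup>L lborel ?g = Gamma z"
    by (rule has_integral_unique)
  with int show ?thesis
    by (simp add: has_bochner_integral_iff)
qed

text \<open>Substituting \<open>y * t\<close> for \<open>t\<close> gives the Laplace transform of a
  power; both orders of integration in the Stieltjes formula reduce to it.\<close>

lemma Gamma_integral_scaled:
  assumes "Re z > 0" "y > 0"
  shows "has_bochner_integral lborel
    (\<lambda>t. indicator {0<..} t *\<^sub>R (exp ((z - 1) * of_real (ln t)) * of_real (exp (- (y * t)))))
    (Gamma z * of_real y powr (- z))"
proof -
  have "has_bochner_integral lborel
    (\<lambda>t. indicator {0<..} (0 + y * t) *\<^sub>R (exp ((z - 1) * of_real (ln (0 + y * t))) * of_real (exp (- (0 + y * t)))))
    (Gamma z /\<^sub>R \<bar>y\<bar>)"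
    using Gamma_integral_lborel[OF assms(1)] assms
    by (subst (asm) lborel_has_bochner_integral_real_affine_iff[where c = y and t = 0]) auto
  \<comment> \<open>The factor \<open>y\<close> to the power \<open>1 - z\<close> removes the power
    of \<open>y\<close> that the substitution attaches to the integrand.\<close>
  hence "has_bochner_integral lborel
    (\<lambda>t. exp ((1 - z) * of_real (ln y)) * (indicator {0<..} (0 + y * t) *\<^sub>R (exp ((z - 1) * of_real (ln (0 + y * t))) * of_real (exp (- (0 + y * t))))))
    (exp ((1 - z) * of_real (ln y)) * (Gamma z /\<^sub>R \<bar>y\<bar>))"
    by (rule has_bochner_integral_mult_right)
  moreover have "exp ((1 - z) * of_real (ln y)) * (indicator {0<..} (0 + y * t) *\<^sub>R (exp ((z - 1) * of_real (ln (0 + y * t))) * of_real (exp (- (0 + y * t)))))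
     = indicator {0<..} t *\<^sub>R (exp ((z - 1) * of_real (ln t)) * of_real (exp (- (y * t))))" for t
  proof (cases "t > 0")
    case True
    have "exp ((1 - z) * of_real (ln y)) * exp ((z - 1) * of_real (ln (y * t))) = exp ((z - 1) * of_real (ln t))"
      using True assms by (simp add: ln_mult algebra_simps flip: exp_add)
    then show ?thesis using True assms by simp
  next
    case False
    then show ?thesis using assms by (simp add: zero_less_mult_iff)
  qed
  moreover have "exp ((1 - z) * of_real (ln y)) * (Gamma z /\<^sub>R \<bar>y\<bar>) = Gamma z * of_real y powr (- z)"
  proof -
    have "(1 - z) * complex_of_real (ln y) = of_real (ln y) + - z * of_real (ln y)"
      by (simp add: algebra_simps)
    hence "exp ((1 - z) * of_real (ln y)) = of_real y * exp (- z * of_real (ln y))"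
      using assms by (simp only: exp_add exp_of_real exp_ln)
    thus ?thesis using assms by (simp add: cpowr_pos scaleR_conv_of_real)
  qed
  ultimately show ?thesis by simp
qed

text \<open>The Gamma integral and Fubini's theorem reduce this to the reflection formula.\<close>

lemma Stieltjes_integral:
  assumes "0 < Re z" "Re z < 1" "x > 0"
  shows "((\<lambda>l. of_real l powr (z - 1) / of_real (l + x)) has_integral
     (of_real pi / sin (of_real pi * z) * of_real x powr (z - 1))) {0<..}"
proof -
  \<comment> \<open>Since \<open>1 / (l + x)\<close> is the integral of
    \<open>exp (- (l + x) * y)\<close> over positive \<open>y\<close>, integrating \<open>F\<close>
    over \<open>y\<close> first gives the Stieltjes integrand, while integrating over
    \<open>l\<close> first leaves \<open>Gamma z * Gamma (1 - z)\<close> times a power of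
    \<open>x\<close>.\<close>
  define F where "F = (\<lambda>(y::real, l::real). (indicator {0<..} y * indicator {0<..} l) *\<^sub>R
     (exp ((z - 1) * of_real (ln l)) * of_real (exp (- (y * l))) * complex_of_real (exp (- (x * y)))))"
  have F_meas: "F \<in> borel_measurable (lborel \<Otimes>\<^sub>M lborel)"
    unfolding F_def case_prod_unfold by measurable
  have inner_l: "has_bochner_integral lborel (\<lambda>l. F (y, l))
     (indicator {0<..} y *\<^sub>R (Gamma z * of_real y powr (- z) * of_real (exp (- (x * y)))))" for y
  proof (cases "y > 0")
    case True
    have "(\<lambda>l. F (y, l)) = (\<lambda>l. indicator {0<..} l *\<^sub>R (exp ((z - 1) * of_real (ln l)) * of_real (exp (- (y * l)))) * of_real (exp (- (x * y))))"
      using True by (simp add: F_def mult_ac)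
    thus ?thesis
      using has_bochner_integral_mult_left[OF Gamma_integral_scaled[OF assms(1) True], of "of_real (exp (- (x * y)))"] True by simp
  qed (simp add: F_def has_bochner_integral_zero)
  \<comment> \<open>The modulus of \<open>F\<close> is \<open>F\<close> at the real exponent
    \<open>Re z\<close>, so absolute integrability is the same Gamma computation.\<close>
  have inner_norm: "has_bochner_integral lborel (\<lambda>l. norm (F (y, l)))
     (norm (indicator {0<..} y *\<^sub>R (Gamma (Re z) * y powr (- Re z) * (exp (- (x * y))))))" for y
  proof (cases "y > 0")
    case True
    let ?r = "complex_of_real (Re z)"
    have r: "Re ?r > 0" using assms by simp
    have n': "Re (indicator {0<..} l *\<^sub>R (exp ((?r - 1) * of_real (ln l)) * of_real (exp (- (y * l)))) * complex_of_real (exp (- (x * y)))) = norm (F (y, l))" for l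
    proof -
      have "indicator {0<..} l *\<^sub>R (exp ((?r - 1) * of_real (ln l)) * of_real (exp (- (y * l)))) * complex_of_real (exp (- (x * y))) =
        of_real (indicator {0<..} l * (exp ((Re z - 1) * ln l) * exp (- (y * l)) * exp (- (x * y))))"
        by (simp add: scaleR_conv_of_real flip: exp_of_real)
      thus ?thesis using True unfolding F_def by (simp add: norm_mult)
    qed
    have "has_bochner_integral lborel (\<lambda>l. Re (indicator {0<..} l *\<^sub>R (exp ((?r - 1) * of_real (ln l)) * of_real (exp (- (y * l)))) * of_real (exp (- (x * y)))))
       (Re (Gamma ?r * of_real y powr (- ?r) * of_real (exp (- (x * y)))))"
      by (intro has_bochner_integral_bounded_linear[OF bounded_linear_Re] has_bochner_integral_mult_left[OF Gamma_integral_scaled[OF r True]])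
    moreover have "Re (Gamma ?r * of_real y powr (- ?r) * of_real (exp (- (x * y)))) = Gamma (Re z) * y powr (- Re z) * (exp (- (x * y)))"
      using True by (simp add: Gamma_complex_of_real powr_of_real flip: of_real_minus of_real_mult)
    moreover have "Gamma (Re z) > 0" using assms by (simp add: Gamma_real_pos)
    ultimately show ?thesis using True by (simp only: n') (simp add: abs_mult)
  qed (simp add: F_def has_bochner_integral_zero)
  have r': "Re (1 - complex_of_real (Re z)) > 0" using assms by simp
  have outer_norm: "integrable lborel (\<lambda>y. norm (indicator {0<..} y *\<^sub>R (Gamma (Re z) * y powr (- Re z) * (exp (- (x * y))))))"
  proof -
    have "integrable lborel (\<lambda>y. Gamma (Re z) * norm (indicator {0<..} y *\<^sub>R (exp (((1 - complex_of_real (Re z)) - 1) * of_real (ln y)) * of_real (exp (- (x * y))))))"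
      using Gamma_integral_scaled[OF r' assms(3)] by (intro integrable_mult_right integrable_norm) (auto simp: has_bochner_integral_iff)
    moreover have "Gamma (Re z) * norm (indicator {0<..} y *\<^sub>R (exp (((1 - complex_of_real (Re z)) - 1) * of_real (ln y)) * of_real (exp (- (x * y)))))
       = norm (indicator {0<..} y *\<^sub>R (Gamma (Re z) * y powr (- Re z) * (exp (- (x * y)))))" for y
    proof -
      have "Gamma (Re z) > 0" using assms by (simp add: Gamma_real_pos)
      thus ?thesis by (cases "y > 0") (simp_all add: norm_mult powr_def abs_mult)
    qed
    ultimately show ?thesis by (simp only:)
  qed
  have F_int: "integrable (lborel \<Otimes>\<^sub>M lborel) F"
  proof (rule lborel_pair.Fubini_integrable[OF F_meas])
    show "integrable lborel (\<lambda>y. \<integral>l. norm (F (y, l)) \<partial>lborel)"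
      using outer_norm inner_norm by (simp add: has_bochner_integral_iff)
    show "AE y in lborel. integrable lborel (\<lambda>l. F (y, l))"
      using inner_l by (simp add: has_bochner_integral_iff)
  qed
  have z': "Re (1 - z) > 0" using assms by simp
  have "(\<integral>y. (\<integral>l. F (y, l) \<partial>lborel) \<partial>lborel) = (\<integral>y. Gamma z * (indicator {0<..} y *\<^sub>R (exp (((1 - z) - 1) * of_real (ln y)) * of_real (exp (- (x * y))))) \<partial>lborel)"
  proof (rule Bochner_Integration.integral_cong[OF refl])
    fix y :: real
    have "(\<integral>l. F (y, l) \<partial>lborel) = (indicator {0<..} y *\<^sub>R (Gamma z * of_real y powr (- z) * of_real (exp (- (x * y)))))"
      using inner_l by (simp add: has_bochner_integral_iff)
    thus "(\<integral>l. F (y, l) \<partial>lborel) = Gamma z * (indicator {0<..} y *\<^sub>R (exp (((1 - z) - 1) * of_real (ln y)) * of_real (exp (- (x * y)))))"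
      by (cases "y > 0") (simp_all add: cpowr_pos)
  qed
  also have "\<dots> = Gamma z * (Gamma (1 - z) * of_real x powr (- (1 - z)))"
    using has_bochner_integral_integral_eq[OF has_bochner_integral_mult_right[OF Gamma_integral_scaled[OF z' assms(3)], of "Gamma z"]] by blast
  also have "\<dots> = of_real pi / sin (of_real pi * z) * of_real x powr (z - 1)"
    using Gamma_reflection_complex[of z] by (simp add: mult.assoc[symmetric])
  finally have val: "(\<integral>y. (\<integral>l. F (y, l) \<partial>lborel) \<partial>lborel) = of_real pi / sin (of_real pi * z) * of_real x powr (z - 1)" .
  have inner_y: "(\<integral>y. F (y, l) \<partial>lborel) = indicator {0<..} l *\<^sub>R (of_real l powr (z - 1) / of_real (l + x))" for l
  proof (cases "l > 0")
    case True
    \<comment> \<open>The trivial factor with exponent \<open>1 - 1\<close> exhibits the inner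
      integral as the scaled Gamma integral at \<open>z = 1\<close>.\<close>
    have F: "(\<lambda>y. F (y, l)) = (\<lambda>y. exp ((z - 1) * of_real (ln l)) * (indicator {0<..} y *\<^sub>R (exp ((1 - 1) * of_real (ln y)) * of_real (exp (- ((l + x) * y))))))"
    proof
      fix y :: real
      have "exp (- (y * l)) * exp (- (x * y)) = exp (- ((l + x) * y))"
        by (simp add: algebra_simps flip: exp_add)
      hence "complex_of_real (exp (- (y * l))) * of_real (exp (- (x * y))) = of_real (exp (- ((l + x) * y)))"
        by (simp only: of_real_mult[symmetric])
      thus "F (y, l) = exp ((z - 1) * of_real (ln l)) * (indicator {0<..} y *\<^sub>R (exp ((1 - 1) * of_real (ln y)) * of_real (exp (- ((l + x) * y)))))"
        using True by (simp add: F_def mult.assoc)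
    qed
    have "has_bochner_integral lborel (\<lambda>y. F (y, l)) (exp ((z - 1) * of_real (ln l)) * (Gamma 1 * of_real (l + x) powr (- 1)))"
      unfolding F using True assms by (intro has_bochner_integral_mult_right Gamma_integral_scaled) auto
    moreover have "complex_of_real (l + x) powr (-1) = 1 / of_real (l + x)"
      using True assms powr_minus_divide[of "complex_of_real (l+x)" 1] by auto
    ultimately show ?thesis using True by (simp add: has_bochner_integral_iff cpowr_pos)
  qed (simp add: F_def)
  have "(\<integral>l. (\<integral>y. F (y, l) \<partial>lborel) \<partial>lborel) = (\<integral>y. (\<integral>l. F (y, l) \<partial>lborel) \<partial>lborel)"
    using lborel_pair.Fubini_integral[of "\<lambda>y l. F (y, l)"] F_int by (simp add: case_prod_eta)
  hence eq: "(\<integral>l. indicator {0<..} l *\<^sub>R (of_real l powr (z - 1) / of_real (l + x)) \<partial>lborel)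
      = of_real pi / sin (of_real pi * z) * of_real x powr (z - 1)"
    by (simp only: val inner_y)
  have "integrable lborel (\<lambda>l. (\<integral>y. F (y, l) \<partial>lborel))"
    using lborel_pair.integrable_snd[of "\<lambda>y l. F (y, l)"] F_int by (simp add: case_prod_eta)
  hence int: "integrable lborel (\<lambda>l. indicator {0<..} l *\<^sub>R (of_real l powr (z - 1) / of_real (l + x)))"
    by (simp only: inner_y)
  have "((\<lambda>l. indicator {0<..} l *\<^sub>R (of_real l powr (z - 1) / of_real (l + x))) has_integral
      (of_real pi / sin (of_real pi * z) * of_real x powr (z - 1))) UNIV"
    using has_integral_integral_lborel[OF int] unfolding eq .
  hence "((\<lambda>l. if l \<in> {0<..} then of_real l powr (z - 1) / of_real (l + x) else 0) has_integral
      (of_real pi / sin (of_real pi * z) * of_real x powr (z - 1))) UNIV"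
    by (rule has_integral_eq[rotated]) auto
  thus ?thesis by (subst (asm) has_integral_restrict_UNIV)
qed

text \<open>One formula covers both ranges of the exponent: for \<open>Re z > 0\<close> the integral converges only after subtracting \<open>1/l\<close>.\<close>

lemma Stieltjes_powr:
  assumes "-1 < Re z" "Re z < 1" "Re z \<noteq> 0" "x > 0"
  shows "((\<lambda>l. of_real l powr z * (1 / of_real (l + x) - (if Re z > 0 then 1 / of_real l else 0)))
     has_integral (- of_real pi / sin (of_real pi * z) * of_real x powr z)) {0<..}"
proof (cases "Re z > 0")
  case True
  \<comment> \<open>\<open>1 / (l + x) - 1 / l = - x / (l * (l + x))\<close>, which lowers the
    exponent of \<open>l\<close> by one.\<close>
  have "((\<lambda>l. of_real l powr (z - 1) / of_real (l + x) * (- of_real x)) has_integral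
     (of_real pi / sin (of_real pi * z) * of_real x powr (z - 1) * (- of_real x))) {0<..}"
    using Stieltjes_integral[of z x] True assms by (intro has_integral_mult_left) auto
  hence "((\<lambda>l. of_real l powr z * (1 / complex_of_real (l + x) - (if Re z > 0 then 1 / of_real l else 0))) has_integral
     (of_real pi / sin (of_real pi * z) * of_real x powr (z - 1) * (- of_real x))) {0<..}"
  proof (rule has_integral_eq[rotated])
    fix l :: real assume l: "l \<in> {0<..}"
    have "l + x \<noteq> 0" "l \<noteq> 0" using l assms by auto
    hence "complex_of_real l + of_real x \<noteq> 0" by (metis of_real_add of_real_eq_0_iff)
    thus "of_real l powr (z - 1) / of_real (l + x) * (- of_real x) = of_real l powr z * (1 / complex_of_real (l + x) - (if Re z > 0 then 1 / of_real l else 0))"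
      using l True by (simp add: powr_diff divide_simps)
  qed
  thus ?thesis using assms by (simp add: powr_diff)
next
  case False
  \<comment> \<open>The Stieltjes integral is used at exponent \<open>z + 1\<close>; the shift by a
    half period supplies the minus sign.\<close>
  have "sin (of_real pi * (z + 1)) = - sin (of_real pi * z)"
    by (simp add: distrib_left sin_add flip: sin_of_real cos_of_real)
  thus ?thesis
    using Stieltjes_integral[of "z + 1" x] False assms by simp
qed

section \<open>Cut-off estimates and their optimization\<close>

text \<open>With the next two integrals this evaluates the pieces of the majorant in
  \<open>sqrt_weighted_majorant\<close>: the a priori bounds \<open>2 / l\<close> and
  \<open>2 * k / l\<^sup>2\<close>, weighted by \<open>sqrt l\<close>, and the constant left by
  Young's inequality.\<close>

lemma has_integral_sqrt_inverse_left:
  assumes "e \<ge> 0"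
  shows "((\<lambda>l::real. if l \<le> e then 2 * l powr (-1/2) else 0) has_integral 4 * sqrt e) {0<..}"
proof -
  have "((\<lambda>l. l powr (-1/2)) has_integral (e powr (-1/2 + 1) / (-1/2 + 1))) {0..e}"
    using assms by (intro has_integral_powr_from_0) auto
  hence "((\<lambda>l. 2 * l powr (-1/2)) has_integral 2 * (e powr (-1/2 + 1) / (-1/2 + 1))) {0..e}"
    by (rule has_integral_mult_right)
  hence "((\<lambda>l. 2 * l powr (-1/2)) has_integral 4 * sqrt e) {0..e}"
    using assms by (simp add: powr_half_sqrt)
  hence "((\<lambda>l. 2 * l powr (-1/2)) has_integral 4 * sqrt e) {0<..e}"
    by (subst has_integral_spike_set_eq[of _ "{0..e}"]) (auto intro: negligible_subset[OF negligible_sing[of 0]])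
  hence "((\<lambda>l. if l \<in> {0<..e} then 2 * l powr (-1/2) else 0) has_integral 4 * sqrt e) {0<..}"
    by (subst has_integral_restrict) auto
  thus ?thesis by (rule has_integral_eq[rotated]) auto
qed

lemma has_integral_powr_tail:
  assumes "T > 0"
  shows "((\<lambda>l::real. if T \<le> l then 2 * k * l powr (-3/2) else 0) has_integral 4 * k / sqrt T) {0<..}"
proof -
  have "((\<lambda>l. l powr (-3/2)) has_integral (- (T powr (-3/2 + 1)) / (-3/2 + 1))) {T..}"
    using assms by (intro has_integral_powr_to_inf) auto
  hence "((\<lambda>l. 2 * k * l powr (-3/2)) has_integral 2 * k * (- (T powr (-3/2 + 1)) / (-3/2 + 1))) {T..}"
    by (rule has_integral_mult_right)
  moreover have "T powr (-1/2) = 1 / sqrt T"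
    using assms powr_minus_divide[of T "1/2"] by (simp add: powr_half_sqrt)
  ultimately have "((\<lambda>l. 2 * k * l powr (-3/2)) has_integral 4 * k / sqrt T) {T..}"
    by simp
  hence "((\<lambda>l. if l \<in> {T..} then 2 * k * l powr (-3/2) else 0) has_integral 4 * k / sqrt T) {0<..}"
    using assms by (subst has_integral_restrict) auto
  thus ?thesis by (rule has_integral_eq[rotated]) auto
qed

lemma has_integral_const_initial:
  assumes "T > 0"
  shows "((\<lambda>l::real. if l \<le> T then c else 0) has_integral c * T) {0<..}"
proof -
  have "((\<lambda>l. c) has_integral (T - 0) *\<^sub>R c) {0..T}"
    using assms has_integral_const_real[of c 0 T] by simp
  hence "((\<lambda>l. c) has_integral c * T) {0..T}" by (simp add: mult.commute)
  hence "((\<lambda>l. c) has_integral c * T) {0<..T}"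
    by (subst has_integral_spike_set_eq[of _ "{0..T}"]) (auto intro: negligible_subset[OF negligible_sing[of 0]])
  hence "((\<lambda>l. if l \<in> {0<..T} then c else 0) has_integral c * T) {0<..}"
    by (subst has_integral_restrict) auto
  thus ?thesis by (rule has_integral_eq[rotated]) auto
qed

text \<open>Near \<open>0\<close> and \<open>\<infinity>\<close> the a priori bounds on \<open>n\<close> are used; in between, Young's inequality with
  parameter \<open>\<theta>\<close> trades \<open>n\<close> for \<open>g\<close>.\<close>

lemma sqrt_weighted_majorant:
  fixes n g :: "real \<Rightarrow> real"
  assumes n0: "\<And>l. l > 0 \<Longrightarrow> 0 \<le> n l" and n1: "\<And>l. l > 0 \<Longrightarrow> n l \<le> 2 / l"
    and n2: "\<And>l. l > 0 \<Longrightarrow> n l \<le> 2 * k / l\<^sup>2" and ng: "\<And>l. l > 0 \<Longrightarrow> l * (n l)\<^sup>2 \<le> g l"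
    and I: "((\<lambda>l. l powr x * g l) has_integral I) {0<..}"
    and par: "e \<ge> 0" "T > 0" "\<theta> > 0" "c \<ge> 0" "k \<ge> 0" and c: "\<And>l. e < l \<Longrightarrow> l \<le> T \<Longrightarrow> l powr (-x) \<le> c"
  obtains h where "(h has_integral (4 * sqrt e + 4 * k / sqrt T + I / (2 * \<theta>) + \<theta> / 2 * c * T)) {0<..}"
    "\<And>l. l > 0 \<Longrightarrow> sqrt l * n l \<le> h l"
proof
  \<comment> \<open>All four terms are nonnegative, so on each range it suffices to keep the
    relevant ones. The constant is integrated over the whole interval up to \<open>T\<close>, which
    only enlarges the majorant.\<close>
  let ?h = "\<lambda>l. (if l \<le> e then 2 * l powr (-1/2) else 0) + (if T \<le> l then 2 * k * l powr (-3/2) else 0)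
     + l powr x * g l / (2 * \<theta>) + (if l \<le> T then \<theta> / 2 * c else 0)"
  show "(?h has_integral (4 * sqrt e + 4 * k / sqrt T + I / (2 * \<theta>) + \<theta> / 2 * c * T)) {0<..}"
    by (intro has_integral_add has_integral_divide I has_integral_sqrt_inverse_left has_integral_powr_tail has_integral_const_initial par)
  fix l :: real assume l: "l > 0"
  have g: "0 \<le> l powr x * g l / (2 * \<theta>)"
    using ng[OF l] l par order_trans[of 0 "l * (n l)\<^sup>2" "g l"] by simp
  have c0: "0 \<le> (if l \<le> T then \<theta> / 2 * c else 0)" using par by simp
  have sl: "sqrt l = l powr (1/2)" using l by (simp add: powr_half_sqrt)
  have l1: "l powr 1 = l" using l by simp
  have l2: "l powr 2 = l\<^sup>2" using l by (simp add: powr_numeral)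
  consider "l \<le> e" | "T \<le> l" | "e < l" "l < T" by linarith
  thus "sqrt l * n l \<le> ?h l"
  proof cases
    case 1
    have "sqrt l * n l \<le> l powr (1/2) * (2 / l powr 1)"
      unfolding l1 sl by (intro mult_left_mono n1 l) simp
    also have "\<dots> = 2 * (l powr (1/2) / l powr 1)" by simp
    also have "\<dots> = 2 * l powr (-1/2)" unfolding powr_diff[symmetric] by simp
    moreover have "0 \<le> (if T \<le> l then 2 * k * l powr (-3/2) else 0)" using par by simp
    ultimately show ?thesis using 1 g c0 by simp
  next
    case 2
    have "sqrt l * n l \<le> l powr (1/2) * (2 * k / l powr 2)"
      unfolding l2 sl by (intro mult_left_mono n2 l) simp
    also have "\<dots> = 2 * k * (l powr (1/2) / l powr 2)" by simp
    also have "\<dots> = 2 * k * l powr (-3/2)" unfolding powr_diff[symmetric] by simp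
    moreover have "0 \<le> (if l \<le> e then 2 * l powr (-1/2) else 0)" by simp
    ultimately show ?thesis using 2 g c0 by simp
  next
    case 3
    \<comment> \<open>\<open>sqrt l * n l\<close> is split so that the square of \<open>A\<close> is
      controlled by the integrand of \<open>I\<close> and the square of \<open>B\<close> by
      \<open>c\<close>; then \<open>(A - \<theta> * B)\<^sup>2\<close> is expanded.\<close>
    define A where "A = l powr (x/2) * sqrt l * n l"
    define B where "B = l powr (- x/2)"
    have "l powr (x/2) * l powr (- x/2) = 1" using l by (simp flip: powr_add)
    hence AB: "A * B = sqrt l * n l" by (simp add: A_def B_def mult_ac)
    have A2: "A\<^sup>2 = l powr x * (l * (n l)\<^sup>2)"
      using l by (simp add: A_def power_mult_distrib power2_eq_square[of "l powr _"] flip: powr_add)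
    have B2: "B\<^sup>2 = l powr (-x)"
      by (simp add: B_def power2_eq_square flip: powr_add)
    have "0 \<le> (A - \<theta> * B)\<^sup>2" by simp
    hence "2 * \<theta> * (A * B) \<le> A\<^sup>2 + \<theta>\<^sup>2 * B\<^sup>2" by (simp add: power2_diff power_mult_distrib mult_ac)
    hence "A * B \<le> (A\<^sup>2 + \<theta>\<^sup>2 * B\<^sup>2) / (2 * \<theta>)" using par by (simp add: pos_le_divide_eq mult_ac)
    also have "\<dots> = A\<^sup>2 / (2 * \<theta>) + \<theta> / 2 * B\<^sup>2" using par by (simp add: add_divide_distrib power2_eq_square)
    also have "A\<^sup>2 / (2 * \<theta>) \<le> l powr x * g l / (2 * \<theta>)"
      unfolding A2 using ng[OF l] par by (intro divide_right_mono mult_left_mono) auto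
    also have "\<theta> / 2 * B\<^sup>2 \<le> \<theta> / 2 * c"
      unfolding B2 using c[of l] 3 par by (intro mult_left_mono) auto
    finally show ?thesis using 3 AB by simp
  qed
qed

text \<open>For \<open>x > 0\<close> the weight \<open>l powr (-x)\<close> blows up at 0, so both
  cut-offs are needed and \<open>c\<close> is its value at the lower one. For \<open>x < 0\<close>
  it is increasing, so \<open>e = 0\<close> and \<open>c\<close> is its value at \<open>T\<close>.
  In both cases the optimal parameters make all terms multiples of one quantity.\<close>

lemma Kconst_optimization:
  assumes x: "-1 < x" "x < 1" "x \<noteq> 0" and q: "q > 0" and D: "D > 0" and X: "X \<ge> 0"
    and bound: "\<And>e T \<theta> c. e \<ge> 0 \<Longrightarrow> T > 0 \<Longrightarrow> \<theta> > 0 \<Longrightarrow> c \<ge> 0 \<Longrightarrow>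
      (\<And>l. e < l \<Longrightarrow> l \<le> T \<Longrightarrow> l powr (-x) \<le> c) \<Longrightarrow>
      X \<le> 4 * sqrt e + 4 * sqrt q / sqrt T + D / (2 * \<theta>) + \<theta> / 2 * c * T"
  shows "Kconst x q * (X / (2 + \<bar>x\<bar>)) powr (4 + 2 * \<bar>x\<bar>) \<le> sin (pi * \<bar>x\<bar>) / pi * D"
proof -
  have sin_pos: "sin (pi * \<bar>x\<bar>) > 0" using x by (intro sin_gt_zero) auto
  define k where "k = sqrt q"
  define d where "d = sqrt D"
  have kd: "k > 0" "d > 0" "k\<^sup>2 = q" "d\<^sup>2 = D" using q D by (auto simp: k_def d_def)
  show ?thesis
  proof (cases "x > 0")
    case True
    \<comment> \<open>Put \<open>e = a\<^sup>2\<close> and \<open>T = b\<^sup>2\<close>. The best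
      \<open>\<theta>\<close> makes the last two terms equal, with sum
      \<open>d * b * a powr (-x)\<close>. Stationarity of
      \<open>4 * a + 4 * k / b + d * b * a powr (-x)\<close> in \<open>a\<close> and
      \<open>b\<close> then forces \<open>a * b = k * x\<close> and
      \<open>a powr (2 + x) = k * d * x\<^sup>2 / 4\<close>.\<close>
    define a where "a = (k * d * x\<^sup>2 / 4) powr (1 / (2 + x))"
    have a: "a > 0" using kd True by (simp add: a_def)
    have apow: "a powr (2 + x) = k * d * x\<^sup>2 / 4"
      using kd True by (simp add: a_def powr_powr)
    define b where "b = k * x / a"
    have b: "b > 0" using a kd True by (simp add: b_def)
    define \<theta> where "\<theta> = d * a powr x / b"
    have \<theta>: "\<theta> > 0" using a b kd by (simp add: \<theta>_def)
    have "X \<le> 4 * sqrt (a\<^sup>2) + 4 * sqrt q / sqrt (b\<^sup>2) + D / (2 * \<theta>) + \<theta> / 2 * a powr (-2 * x) * b\<^sup>2"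
    proof (rule bound)
      fix l assume l: "a\<^sup>2 < l" "l \<le> b\<^sup>2"
      have "l powr (-x) \<le> (a\<^sup>2) powr (-x)"
        using l a True by (intro powr_mono2') auto
      also have "\<dots> = a powr (-2 * x)"
        using a by (simp add: powr_powr flip: powr_numeral)
      finally show "l powr (-x) \<le> a powr (-2 * x)" .
    qed (use a b \<theta> in auto)
    also have "sqrt (a\<^sup>2) = a" using a by simp
    also have "sqrt (b\<^sup>2) = b" using b by simp
    also have "4 * sqrt q / b = 4 * a / x" using kd a True by (simp add: b_def k_def[symmetric])
    also have "D / (2 * \<theta>) = 2 * a / x"
    proof -
      have "a powr x * a\<^sup>2 = k * d * x\<^sup>2 / 4" using apow a by (simp add: powr_add powr_numeral mult.commute)
      hence e: "a powr x = k * d * x\<^sup>2 / (4 * a\<^sup>2)" using a by (simp add: field_simps)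
      show ?thesis unfolding kd(4)[symmetric] \<theta>_def b_def e
        using a kd(1,2) True by (simp add: field_simps power2_eq_square)
    qed
    also have "\<theta> / 2 * a powr (-2 * x) * b\<^sup>2 = 2 * a / x"
    proof -
      have "a powr x * a\<^sup>2 = k * d * x\<^sup>2 / 4" using apow a by (simp add: powr_add powr_numeral mult.commute)
      hence e: "a powr x = k * d * x\<^sup>2 / (4 * a\<^sup>2)" using a by (simp add: field_simps)
      have "a powr x * a powr (-2 * x) = 1 / a powr x"
        unfolding powr_add[symmetric] powr_minus_divide[symmetric] by simp
      hence "d * b / 2 * (a powr x * a powr (-2 * x)) = d * b / (2 * a powr x)" by simp
      moreover have "\<theta> / 2 * a powr (-2 * x) * b\<^sup>2 = d * b / 2 * (a powr x * a powr (-2 * x))"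
        using b by (simp add: \<theta>_def power2_eq_square)
      ultimately have "\<theta> / 2 * a powr (-2 * x) * b\<^sup>2 = d * b / (2 * a powr x)" by simp
      also have "\<dots> = 2 * a / x"
        unfolding b_def e using a kd(1,2) True by (simp add: field_simps power2_eq_square)
      finally show ?thesis .
    qed
    finally have "X \<le> (2 + x) * (4 * a / x)" using True by (simp add: field_simps)
    hence "X / (2 + x) \<le> 4 / x * a" using True by (simp add: pos_divide_le_eq mult.commute)
    hence "(X / (2 + x)) powr (4 + 2 * x) \<le> (4 / x * a) powr (4 + 2 * x)"
      using X True by (intro powr_mono2) auto
    \<comment> \<open>The exponent is twice \<open>2 + x\<close>, so the defining equation of
      \<open>a\<close> enters squared and turns \<open>k\<close>, \<open>d\<close> into
      \<open>q\<close>, \<open>D\<close>.\<close>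
    also have "\<dots> = (4 / x) powr (4 + 2 * x) * a powr ((2 + x) + (2 + x))"
      unfolding powr_mult by (simp add: add.assoc)
    also have "\<dots> = (4 / x) powr (4 + 2 * x) * a powr (2 + x) * a powr (2 + x)"
      by (simp only: powr_add[of a "2 + x" "2 + x"] mult.assoc)
    also have "\<dots> = (4 / x) powr (4 + 2 * x) * (q * D * x ^ 4 / 16)"
      unfolding apow kd(3,4)[symmetric] by (simp add: power2_eq_square power4_eq_xxxx)
    also have "(4 / x) powr (4 + 2 * x) = 16 * 16 powr (x + 1) / (x ^ 4 * x powr (2 * x))"
    proof -
      have "(4::real) powr (4 + 2 * x) = (4 powr 2) powr (2 + x)" by (simp only: powr_powr) (simp add: algebra_simps)
      also have "\<dots> = 16 * 16 powr (x + 1)" using powr_add[of 16 1 "x + 1"] by (simp add: add_ac)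
      finally show ?thesis using True by (simp add: powr_divide powr_add)
    qed
    also have "16 * 16 powr (x + 1) / (x ^ 4 * x powr (2 * x)) * (q * D * x ^ 4 / 16) = 16 powr (x + 1) / x powr (2 * x) * q * D"
      using True by simp
    finally have main: "(X / (2 + x)) powr (4 + 2 * x) \<le> 16 powr (x + 1) / x powr (2 * x) * q * D" .
    have K: "Kconst x q = sin (pi * x) / (pi * q) * (x powr (2 * x) / 16 powr (x + 1))"
      using True by (simp add: Kconst_def)
    have "Kconst x q * (X / (2 + x)) powr (4 + 2 * x) \<le> Kconst x q * (16 powr (x + 1) / x powr (2 * x) * q * D)"
      using main sin_pos q True by (intro mult_left_mono) (auto simp: K)
    also have "\<dots> = sin (pi * x) / pi * D" unfolding K using q True by (simp add: field_simps)
    finally show ?thesis using True by simp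
  next
    case False
    define y where "y = - x"
    have y: "0 < y" "y < 1" "\<bar>x\<bar> = y" using False x by (auto simp: y_def)
    define g where "g = y + 1"
    have g: "g > 0" using y by (simp add: g_def)
    \<comment> \<open>With \<open>e = 0\<close>, \<open>T = b\<^sup>2\<close> and the best
      \<open>\<theta>\<close>, what remains is \<open>4 * k / b + d * b powr (y + 1)\<close>; this
      \<open>b\<close> is its stationary point.\<close>
    define b where "b = (4 * k / (g * d)) powr (1 / (y + 2))"
    have b: "b > 0" using kd g by (simp add: b_def)
    have bpow: "b powr (y + 2) = 4 * k / (g * d)"
      using kd g y by (simp add: b_def powr_powr)
    have bb: "b powr (y + 1) = 4 * k / (g * d * b)"
    proof -
      have "b powr (y + 2) = b powr (y + 1) * b"
        using b powr_add[of b "y + 1" 1] by (simp add: add_ac)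
      hence "b powr (y + 1) = b powr (y + 2) / b" using b by simp
      thus ?thesis unfolding bpow by simp
    qed
    define \<theta> where "\<theta> = d / b powr (y + 1)"
    have \<theta>: "\<theta> > 0" using b kd by (simp add: \<theta>_def)
    have "X \<le> 4 * sqrt 0 + 4 * sqrt q / sqrt (b\<^sup>2) + D / (2 * \<theta>) + \<theta> / 2 * b powr (2 * y) * b\<^sup>2"
    proof (rule bound)
      fix l :: real assume l: "0 < l" "l \<le> b\<^sup>2"
      have "l powr y \<le> (b\<^sup>2) powr y"
        using l b y by (intro powr_mono2) auto
      also have "\<dots> = b powr (2 * y)"
        using b by (simp add: powr_powr flip: powr_numeral)
      finally show "l powr (-x) \<le> b powr (2 * y)" by (simp add: y_def)
    qed (use b \<theta> in auto)
    also have "sqrt (b\<^sup>2) = b" using b by simp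
    also have "D / (2 * \<theta>) = 2 * k / (g * b)"
      unfolding \<theta>_def bb kd(4)[symmetric] using b kd(1,2) g by (simp add: field_simps power2_eq_square)
    also have "\<theta> / 2 * b powr (2 * y) * b\<^sup>2 = 2 * k / (g * b)"
    proof -
      have "b powr (2 * y) * b\<^sup>2 = b powr (y + 1) * b powr (y + 1)"
        using b by (simp flip: powr_add powr_numeral)
      hence "\<theta> / 2 * b powr (2 * y) * b\<^sup>2 = \<theta> / 2 * (b powr (y + 1) * b powr (y + 1))" by (simp add: mult.assoc)
      also have "\<dots> = d * b powr (y + 1) / 2" using b by (simp add: \<theta>_def)
      also have "\<dots> = 2 * k / (g * b)" unfolding bb using b kd g by (simp add: field_simps)
      finally show ?thesis .
    qed
    also have "4 * sqrt 0 + 4 * sqrt q / b + 2 * k / (g * b) + 2 * k / (g * b) = (g + 1) * (4 * k / (g * b))"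
      using b g unfolding k_def[symmetric] by (simp add: field_simps)
    also have "g + 1 = y + 2" by (simp add: g_def)
    finally have "X \<le> (y + 2) * (4 * k / (g * b))" .
    hence "X / (2 + y) \<le> 4 * k / g / b" using y by (simp add: pos_divide_le_eq mult_ac add.commute)
    hence "(X / (2 + y)) powr (4 + 2 * y) \<le> (4 * k / g / b) powr (4 + 2 * y)"
      using X y by (intro powr_mono2) auto
    also have "\<dots> = (4 * k / g) powr (4 + 2 * y) / (b powr (y + 2) * b powr (y + 2))"
    proof -
      have "4 + 2 * y = (y + 2) + (y + 2)" by simp
      hence "b powr (4 + 2 * y) = b powr (y + 2) * b powr (y + 2)" by (metis powr_add)
      thus ?thesis by (simp only: powr_divide)
    qed
    also have "\<dots> = (4 * k / g) powr (2 * (y + 1)) * D"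
    proof -
      have "(4 * k / g) powr (4 + 2 * y) = (4 * k / g) powr (2 * (y + 1)) * (4 * k / g) powr 2"
        by (simp flip: powr_add)
      also have "(4 * k / g) powr 2 = (4 * k / g)\<^sup>2" using kd g by (intro powr_numeral) auto
      finally show ?thesis unfolding bpow kd(4)[symmetric] using kd(1,2) g by (simp add: field_simps power2_eq_square)
    qed
    also have "(4 * k / g) powr (2 * (y + 1)) = (16 * q / g\<^sup>2) powr (y + 1)"
    proof -
      have "(4 * k / g) powr (2 * (y + 1)) = ((4 * k / g) powr 2) powr (y + 1)" by (simp only: powr_powr)
      also have "(4 * k / g) powr 2 = (4 * k / g)\<^sup>2" using kd g by (intro powr_numeral) auto
      also have "\<dots> = 16 * q / g\<^sup>2" by (simp add: power_divide power_mult_distrib kd)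
      finally show ?thesis .
    qed
    finally have main: "(X / (2 + y)) powr (4 + 2 * y) \<le> (16 * q / g\<^sup>2) powr (y + 1) * D" .
    have K: "Kconst x q = sin (pi * y) / pi * (g\<^sup>2 / (16 * q)) powr (y + 1)"
      using False x y by (simp add: Kconst_def g_def)
    have "Kconst x q * (X / (2 + y)) powr (4 + 2 * y) \<le> Kconst x q * ((16 * q / g\<^sup>2) powr (y + 1) * D)"
      using main sin_pos y by (intro mult_left_mono) (auto simp: K)
    also have "\<dots> = sin (pi * y) / pi * (((g\<^sup>2 / (16 * q)) * (16 * q / g\<^sup>2)) powr (y + 1) * D)"
      unfolding K powr_mult by simp
    also have "(g\<^sup>2 / (16 * q)) * (16 * q / g\<^sup>2) = 1" using q g by simp
    finally show ?thesis by (simp add: y(3))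
  qed
qed

section \<open>Spectral theorem and functional calculus\<close>

lemma cadj_mult: "cadj (A ** B) = cadj B ** cadj A"
  by (simp add: vec_eq_iff cadj_def matrix_matrix_mult_def mult.commute)

lemma cadj_cadj [simp]: "cadj (cadj A) = A"
  by (simp add: vec_eq_iff cadj_def)

lemma cadj_add: "cadj (A + B) = cadj A + cadj B"
  by (simp add: vec_eq_iff cadj_def)

lemma cadj_diff: "cadj (A - B) = cadj A - cadj B"
  by (simp add: vec_eq_iff cadj_def)

lemma cadj_smul: "cadj (smul c A) = smul (cnj c) (cadj A)"
  by (simp add: vec_eq_iff cadj_def smul_def)

lemma cadj_mat1 [simp]: "cadj (mat 1) = mat 1"
  by (auto simp: vec_eq_iff cadj_def mat_def)

lemma cadj_0 [simp]: "cadj 0 = 0"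
  by (simp add: vec_eq_iff cadj_def)

lemma smul_mult_left: "smul c A ** B = smul c (A ** B)"
  by (simp add: vec_eq_iff smul_def matrix_matrix_mult_def sum_distrib_left mult.assoc)

lemma smul_mult_right: "A ** smul c B = smul c (A ** B)"
  by (simp add: vec_eq_iff smul_def matrix_matrix_mult_def sum_distrib_left mult_ac)

lemma smul_smul: "smul c (smul d A) = smul (c * d) A"
  by (simp add: vec_eq_iff smul_def mult.assoc)

lemma smul_1 [simp]: "smul 1 A = A"
  by (simp add: vec_eq_iff smul_def)

lemma smul_0 [simp]: "smul 0 A = 0"
  by (simp add: vec_eq_iff smul_def)

lemma smul_0_right [simp]: "smul c 0 = 0"
  by (simp add: vec_eq_iff smul_def)

lemma smul_add_left: "smul (c + d) A = smul c A + smul d A"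
  by (simp add: vec_eq_iff smul_def distrib_right)

lemma smul_add: "smul c (A + B) = smul c A + smul c B"
  by (simp add: vec_eq_iff smul_def distrib_left)

lemma smul_minus1: "smul (-1) A = - A"
  by (simp add: vec_eq_iff smul_def)

lemma scaleR_smul: "r *\<^sub>R A = smul (of_real r) A"
  by (simp add: vec_eq_iff smul_def) (simp add: scaleR_conv_of_real)

lemma smul_sum: "smul c (\<Sum>i\<in>S. f i) = (\<Sum>i\<in>S. smul c (f i))"
  by (induction S rule: infinite_finite_induct) (simp_all add: smul_add)

lemma matrix_mult_0 [simp]: "(A::'n::finite cmat) ** 0 = 0" "0 ** (A::'n cmat) = 0"
  by (simp_all add: vec_eq_iff matrix_matrix_mult_def)

lemma matrix_add_rdistrib: "((A::'n::finite cmat) + B) ** C = A ** C + B ** C"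
  by (simp add: vec_eq_iff matrix_matrix_mult_def sum.distrib distrib_right)

lemma matrix_diff_rdistrib: "((A::'n::finite cmat) - B) ** C = A ** C - B ** C"
  by (simp add: vec_eq_iff matrix_matrix_mult_def sum_subtractf left_diff_distrib)

lemma matrix_diff_ldistrib: "(C::'n::finite cmat) ** (A - B) = C ** A - C ** B"
  by (simp add: vec_eq_iff matrix_matrix_mult_def sum_subtractf right_diff_distrib)

lemma matrix_sum_left: "(\<Sum>i\<in>S. (f i :: 'n cmat)) ** (B::'n::finite cmat) = (\<Sum>i\<in>S. f i ** B)"
  by (induction S rule: infinite_finite_induct) (simp_all add: matrix_add_rdistrib)

lemma matrix_sum_right: "(B::'n::finite cmat) ** (\<Sum>i\<in>S. (f i :: 'n cmat)) = (\<Sum>i\<in>S. B ** f i)"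
  by (induction S rule: infinite_finite_induct) (simp_all add: matrix_add_ldistrib)

section \<open>The Hermitian inner product and diagonalization\<close>

definition cinner :: "complex^'n::finite \<Rightarrow> complex^'n \<Rightarrow> complex" where
  "cinner v w = (\<Sum>i\<in>UNIV. cnj (v $ i) * w $ i)"

lemma Re_cinner: "Re (cinner v w) = v \<bullet> w"
  by (simp add: cinner_def inner_vec_def inner_complex_def)

lemma cinner_add_right: "cinner v (w + x) = cinner v w + cinner v x"
  and cinner_add_left: "cinner (w + x) v = cinner w v + cinner x v"
  and cinner_scale_right: "cinner v (c *s w) = c * cinner v w"
  and cinner_scale_left: "cinner (c *s v) w = cnj c * cinner v w"
  by (simp_all add: cinner_def sum.distrib algebra_simps sum_distrib_left)

lemma cinner_cnj: "cinner v w = cnj (cinner w v)"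
  by (simp add: cinner_def mult.commute)

lemma cinner_cadj: "cinner v (A *v w) = cinner (cadj A *v v) w"
proof -
  have "cinner v (A *v w) = (\<Sum>i\<in>UNIV. \<Sum>j\<in>UNIV. cnj (v $ i) * A $ i $ j * w $ j)"
    by (simp add: cinner_def matrix_vector_mult_def sum_distrib_left mult.assoc)
  also have "\<dots> = (\<Sum>j\<in>UNIV. \<Sum>i\<in>UNIV. cnj (v $ i) * A $ i $ j * w $ j)"
    by (rule sum.swap)
  also have "\<dots> = cinner (cadj A *v v) w"
    by (simp add: cinner_def matrix_vector_mult_def cadj_def sum_distrib_left mult_ac)
  finally show ?thesis .
qed

lemma cinner_self: "cinner v v = of_real ((norm v)\<^sup>2)"
proof (rule complex_eqI)
  show "Re (cinner v v) = Re (of_real ((norm v)\<^sup>2))"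
    by (simp add: Re_cinner power2_norm_eq_inner)
  show "Im (cinner v v) = Im (of_real ((norm v)\<^sup>2))"
    using cinner_cnj[of v v] by (metis Im_complex_of_real Reals_cnj_iff complex_is_Real_iff)
qed

text \<open>First-order condition at a minimum: a nonzero linear term would dominate for small
  \<open>r\<close> of the opposite sign.\<close>

lemma quadratic_nonneg_linear_coeff:
  fixes c q :: real
  assumes "\<And>r. 0 \<le> 2 * r * c + r\<^sup>2 * q"
  shows "c = 0"
proof (rule ccontr)
  assume "c \<noteq> 0"
  define k where "k = \<bar>q\<bar> + 1"
  have k: "k > 0" by (simp add: k_def)
  have "0 \<le> 2 * (- c / k) * c + (- c / k)\<^sup>2 * q" by (rule assms)
  hence "0 \<le> (2 * (- c / k) * c + (- c / k)\<^sup>2 * q) * k\<^sup>2" by simp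
  also have "\<dots> = c\<^sup>2 * (q - 2 * k)"
    using k by (simp add: field_simps power2_eq_square)
  finally have "0 \<le> q - 2 * k" using \<open>c \<noteq> 0\<close> by (simp add: zero_le_mult_iff)
  hence "0 \<le> q - 2 * (\<bar>q\<bar> + 1)" by (simp only: k_def)
  thus False by simp
qed

text \<open>The new eigenvector maximizes the quadratic form on the unit sphere of the orthogonal complement.\<close>

lemma hermitian_eigenvector_extend:
  fixes A :: "'n::finite cmat" and v :: "'n \<Rightarrow> complex^'n"
  assumes A: "hermitian_mat A" and S: "S \<noteq> UNIV"
    and eig: "\<And>i. i \<in> S \<Longrightarrow> A *v v i = of_real (d i) *s v i"
  obtains u m where "norm u = 1" "\<And>i. i \<in> S \<Longrightarrow> cinner (v i) u = 0" "A *v u = complex_of_real m *s u"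
proof -
  define W where "W = {x. \<forall>i\<in>S. cinner (v i) x = 0}"
  \<comment> \<open>The coordinates of \<open>L x\<close> outside \<open>S\<close> vanish, so
    \<open>L\<close> is not surjective; by dimension it has a nonzero kernel vector, which lies in
    \<open>W\<close>.\<close>
  define L where "L = (\<lambda>x::complex^'n. \<chi> i. if i \<in> S then cinner (v i) x else 0)"
  have linL: "linear L"
    by (rule linearI) (simp_all add: L_def vec_eq_iff cinner_add_right cinner_def sum_distrib_left scaleR_sum_right sum.distrib distrib_left)
  obtain i0 where i0: "i0 \<notin> S" using S by blast
  have "\<not> surj L"
  proof
    assume "surj L"
    then obtain x where "L x = axis i0 1" by (metis surjD)
    hence "L x $ i0 = 1" by simp
    thus False using i0 by (simp add: L_def)
  qed
  hence "\<not> inj L" using linL linear_injective_imp_surjective by blast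
  then obtain x0 where x0: "x0 \<noteq> 0" "L x0 = 0"
    using linL linear_injective_0 by blast
  have x0W: "x0 \<in> W" using x0 by (auto simp: W_def L_def vec_eq_iff split: if_splits)
  have W_lin: "a *\<^sub>R x + b *\<^sub>R y \<in> W" if "x \<in> W" "y \<in> W" for a b x y
  proof -
    have "a *\<^sub>R x + b *\<^sub>R y = of_real a *s x + of_real b *s y"
      by (simp add: vec_eq_iff) (simp add: scaleR_conv_of_real)
    thus ?thesis using that by (simp add: W_def cinner_add_right cinner_scale_right)
  qed
  have adj: "(A *v x) \<bullet> y = x \<bullet> (A *v y)" for x y
    using cinner_cadj[of x A y] A by (simp add: hermitian_mat_def flip: Re_cinner)
  have W_A: "A *v x \<in> W" if "x \<in> W" for x
  proof -
    have "cinner (v i) (A *v x) = 0" if "i \<in> S" for i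
      using cinner_cadj[of "v i" A x] A eig[OF that] \<open>x \<in> W\<close> that
      by (simp add: hermitian_mat_def cinner_scale_left W_def)
    thus ?thesis by (simp add: W_def)
  qed
  have cont_cinner: "continuous_on UNIV (\<lambda>x. cinner w x)" for w :: "complex^'n"
    unfolding cinner_def by (intro continuous_intros)
  have "closed W"
  proof -
    have "W = (\<Inter>i\<in>S. {x. cinner (v i) x = 0})" by (auto simp: W_def)
    thus ?thesis by (auto intro!: closed_INT closed_Collect_eq cont_cinner continuous_intros)
  qed
  hence cpt: "compact (W \<inter> sphere 0 1)" by (simp add: closed_Int_compact)
  have "x0 /\<^sub>R norm x0 \<in> W \<inter> sphere 0 1"
    using W_lin[OF x0W x0W, of "1 / norm x0" 0] x0 by (simp add: divide_inverse)
  hence ne: "W \<inter> sphere 0 1 \<noteq> {}" by blast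
  have linA: "linear (\<lambda>x. A *v x)"
    by (rule linearI) (simp_all add: vec_eq_iff matrix_vector_mult_def scaleR_sum_right sum.distrib distrib_left)
  have contA: "continuous_on X (\<lambda>x. A *v x)" for X
    using linear_continuous_on linA linear_conv_bounded_linear by blast
  have "continuous_on (W \<inter> sphere 0 1) (\<lambda>x. x \<bullet> (A *v x))"
    by (intro continuous_intros contA)
  from continuous_attains_sup[OF cpt ne this] obtain u where u: "u \<in> W" "norm u = 1" 
    and max: "\<And>x. x \<in> W \<Longrightarrow> norm x = 1 \<Longrightarrow> x \<bullet> (A *v x) \<le> u \<bullet> (A *v u)"
    by auto
  define m where "m = u \<bullet> (A *v u)"
  \<comment> \<open>By maximality of \<open>u\<close> the form of \<open>B\<close> is nonnegative on
    \<open>W\<close> and vanishes at \<open>u\<close>. Perturbing \<open>u\<close> in the direction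
    \<open>B u\<close>, which stays in \<open>W\<close>, makes \<open>B u \<bullet> B u\<close> the
    linear coefficient, so \<open>B u = 0\<close>.\<close>
  define B where "B = (\<lambda>x. m *\<^sub>R x - A *v x)"
  have A_scaleR: "A *v (r *\<^sub>R x) = r *\<^sub>R (A *v x)" for r x
    using linA by (rule linear_cmul)
  have pos: "0 \<le> x \<bullet> B x" if "x \<in> W" for x
  proof (cases "x = 0")
    case False
    let ?y = "x /\<^sub>R norm x"
    have "?y \<in> W" "norm ?y = 1" using W_lin[OF that that, of "1 / norm x" 0] False by (simp_all add: divide_inverse)
    hence "?y \<bullet> (A *v ?y) \<le> m" unfolding m_def by (rule max)
    hence "(x \<bullet> (A *v x)) / (norm x)\<^sup>2 \<le> m"
      by (simp add: A_scaleR power2_eq_square divide_inverse mult_ac)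
    hence "x \<bullet> (A *v x) \<le> m * (norm x)\<^sup>2" using False by (simp add: pos_divide_le_eq)
    thus ?thesis by (simp add: B_def inner_diff_right power2_norm_eq_inner)
  qed simp
  have BW: "B u \<in> W"
    using W_lin[OF u(1) W_A[OF u(1)], of m "-1"] by (simp add: B_def)
  have uBu: "u \<bullet> B u = 0" using u(2) by (simp add: B_def inner_diff_right m_def norm_eq_1)
  have Blin: "B (u + r *\<^sub>R x) = B u + r *\<^sub>R B x" for r x
    by (simp add: B_def A_scaleR matrix_vector_right_distrib algebra_simps)
  have Badj: "u \<bullet> B x = x \<bullet> B u" for x
    using adj[of u x] by (simp add: B_def inner_diff_right inner_commute)
  have "B u \<bullet> B u = 0"
  proof (rule quadratic_nonneg_linear_coeff)
    fix r :: real
    let ?x = "B u"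
    have "0 \<le> (u + r *\<^sub>R ?x) \<bullet> B (u + r *\<^sub>R ?x)"
      using pos W_lin[OF u(1) BW, of 1 r] by simp
    also have "\<dots> = 2 * r * (?x \<bullet> B u) + r\<^sup>2 * (?x \<bullet> B ?x)"
      using uBu Badj[of ?x] by (simp add: Blin inner_add_left inner_add_right power2_eq_square algebra_simps)
    finally show "0 \<le> 2 * r * (?x \<bullet> B u) + r\<^sup>2 * (?x \<bullet> B ?x)" .
  qed
  hence "A *v u = m *\<^sub>R u" by (simp add: B_def)
  also have "\<dots> = complex_of_real m *s u"
    by (simp add: vec_eq_iff) (simp add: scaleR_conv_of_real)
  finally show ?thesis using that u by (auto simp: W_def)
qed

text \<open>Orthonormal eigenvectors are collected by induction over subsets of the index type; the
  full family forms the columns of \<open>U\<close>.\<close>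

theorem hermitian_diagonalization:
  fixes A :: "'n::finite cmat"
  assumes A: "hermitian_mat A"
  obtains U d where "unitary_mat U" "A = U ** cdiag (\<lambda>i. complex_of_real (d i)) ** cadj U"
proof -
  have "\<exists>v d. \<forall>i\<in>S. A *v v i = complex_of_real (d i) *s v i \<and> (\<forall>j\<in>S. cinner (v i) (v j) = (if i = j then 1 else 0))"
    for S :: "'n set"
  proof (induction S rule: finite_induct[OF finite])
    case 1
    show ?case by simp
  next
    case (2 k S)
    then obtain v d where vd: "\<And>i. i \<in> S \<Longrightarrow> A *v v i = complex_of_real (d i) *s v i"
      "\<And>i j. i \<in> S \<Longrightarrow> j \<in> S \<Longrightarrow> cinner (v i) (v j) = (if i = j then 1 else 0)" by auto
    have "S \<noteq> UNIV" using 2 by auto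
    then obtain u m where
      u: "norm u = 1" "\<And>i. i \<in> S \<Longrightarrow> cinner (v i) u = 0" "A *v u = complex_of_real m *s u"
      using hermitian_eigenvector_extend[OF A, of S v d] vd(1) by blast
    have u': "cinner u (v i) = 0" if "i \<in> S" for i
      using u(2)[OF that] by (subst cinner_cnj) simp
    have "cinner u u = 1" using u(1) by (simp add: cinner_self)
    thus ?case
      using vd u u' \<open>k \<notin> S\<close> by (intro exI[of _ "v(k := u)"] exI[of _ "d(k := m)"]) auto
  qed
  from this[of UNIV] obtain v d where vd: "\<forall>i::'n. A *v v i = complex_of_real (d i) *s v i \<and> (\<forall>j. cinner (v i) (v j) = (if i = j then 1 else 0))"
    by auto
  hence v: "A *v v i = complex_of_real (d i) *s v i" "cinner (v i) (v j) = (if i = j then 1 else 0)" for i j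
    by blast+
  define U :: "'n cmat" where "U = (\<chi> i j. v j $ i)"
  have 1: "cadj U ** U = mat 1"
    using v(2) by (simp add: vec_eq_iff matrix_matrix_mult_def cadj_def U_def mat_def cinner_def)
  hence 2: "U ** cadj U = mat 1" by (rule matrix_left_right_inverse1)
  have "A ** U = U ** cdiag (\<lambda>i. complex_of_real (d i))"
  proof -
    have "(\<Sum>k\<in>UNIV. A $ i $ k * v j $ k) = v j $ i * of_real (d j)" for i j
      using arg_cong[OF v(1)[of j], of "\<lambda>w. w $ i"] by (simp add: matrix_vector_mult_def mult.commute)
    thus ?thesis
      by (simp add: vec_eq_iff matrix_matrix_mult_def U_def cdiag_def if_distrib cong: if_cong)
  qed
  hence "A ** (U ** cadj U) = U ** cdiag (\<lambda>i. complex_of_real (d i)) ** cadj U"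
    by (simp add: matrix_mul_assoc)
  thus ?thesis using that 1 2 by (simp add: unitary_mat_def)
qed

section \<open>Functional calculus\<close>

lemma cdiag_mult_left: "(cdiag d ** X) $ i $ j = d i * X $ i $ j"
  by (simp add: matrix_matrix_mult_def cdiag_def if_distrib[of "\<lambda>x. x * _"] cong: if_cong)

lemma cdiag_mult_right: "(X ** cdiag d) $ i $ j = X $ i $ j * d j"
  by (simp add: matrix_matrix_mult_def cdiag_def if_distrib cong: if_cong)

text \<open>This makes the choice operator in \<^const>\<open>matfun\<close> harmless.\<close>

lemma matfun_diag:
  fixes U :: "'n::finite cmat"
  assumes U: "unitary_mat U" and A: "A = U ** cdiag (\<lambda>i. complex_of_real (d i)) ** cadj U"
  shows "matfun f A = U ** cdiag (\<lambda>i. f (d i)) ** cadj U"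
proof -
  have "B = U ** cdiag (\<lambda>i. f (d i)) ** cadj U"
    if V: "unitary_mat V" and e: "A = V ** cdiag (\<lambda>i. complex_of_real (e i)) ** cadj V"
      and B: "B = V ** cdiag (\<lambda>i. f (e i)) ** cadj V" for B V e
  proof -
    let ?X = "cadj V ** U"
    have VV: "cadj V ** (V ** Y) = Y" "V ** (cadj V ** Y) = Y" for Y
      using V by (simp_all add: unitary_mat_def matrix_mul_assoc)
    have UU: "cadj U ** (U ** Y) = Y" "U ** (cadj U ** Y) = Y" "cadj U ** U = mat 1" for Y
      using U by (simp_all add: unitary_mat_def matrix_mul_assoc)
    have "cadj V ** (A ** U) = cadj V ** (A ** U)" ..
    hence eq: "?X ** cdiag (\<lambda>i. complex_of_real (d i)) = cdiag (\<lambda>i. complex_of_real (e i)) ** ?X"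
      by (subst (asm) A, subst (asm) (2) e) (simp add: VV UU flip: matrix_mul_assoc)
    \<comment> \<open>Two diagonalizations are intertwined by \<open>?X\<close>, whose entry at
      \<open>i\<close>, \<open>j\<close> vanishes unless \<open>d j = e i\<close>; hence it also
      intertwines the images under \<open>f\<close>.\<close>
    have "?X ** cdiag (\<lambda>i. f (d i)) = cdiag (\<lambda>i. f (e i)) ** ?X"
    proof -
      have "?X $ i $ j * f (d j) = f (e i) * ?X $ i $ j" for i j
      proof -
        have "?X $ i $ j * of_real (d j) = of_real (e i) * ?X $ i $ j"
          using arg_cong[OF eq, of "\<lambda>Y. Y $ i $ j"] by (simp only: cdiag_mult_left cdiag_mult_right)
        thus ?thesis by (cases "?X $ i $ j = 0") auto
      qed
      thus ?thesis by (simp add: vec_eq_iff cdiag_mult_left cdiag_mult_right)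
    qed
    hence "V ** (?X ** cdiag (\<lambda>i. f (d i))) ** cadj U = V ** (cdiag (\<lambda>i. f (e i)) ** ?X) ** cadj U" by simp
    thus ?thesis using U by (simp add: B VV UU unitary_mat_def flip: matrix_mul_assoc)
  qed
  thus ?thesis unfolding matfun_def by (intro some_equality) (use assms in blast)+
qed

context
  fixes A :: "'n::finite cmat"
  assumes A: "hermitian_mat A"
begin

lemma matfun_mult: "matfun f A ** matfun g A = matfun (\<lambda>x. f x * g x) A"
proof -
  obtain U d where U: "unitary_mat U" "A = U ** cdiag (\<lambda>i. complex_of_real (d i)) ** cadj U"
    using hermitian_diagonalization[OF A] .
  have UU: "cadj U ** (U ** Y) = Y" for Y using U by (simp add: unitary_mat_def matrix_mul_assoc)
  have "cdiag (\<lambda>i. f (d i)) ** cdiag (\<lambda>i. g (d i)) = cdiag (\<lambda>i. f (d i) * g (d i))"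
    by (simp add: vec_eq_iff cdiag_mult_left) (simp add: cdiag_def)
  hence "cdiag (\<lambda>i. f (d i)) ** (cdiag (\<lambda>i. g (d i)) ** Y) = cdiag (\<lambda>i. f (d i) * g (d i)) ** Y" for Y :: "'n cmat"
    by (simp add: matrix_mul_assoc)
  thus ?thesis by (simp add: matfun_diag[OF U] UU flip: matrix_mul_assoc)
qed

lemma matfun_add: "matfun f A + matfun g A = matfun (\<lambda>x. f x + g x) A"
proof -
  obtain U d where U: "unitary_mat U" "A = U ** cdiag (\<lambda>i. complex_of_real (d i)) ** cadj U"
    using hermitian_diagonalization[OF A] .
  have "cdiag (\<lambda>i. f (d i) + g (d i)) = cdiag (\<lambda>i. f (d i)) + cdiag (\<lambda>i. g (d i))"
    by (simp add: vec_eq_iff cdiag_def)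
  thus ?thesis by (simp add: matfun_diag[OF U] matrix_add_ldistrib matrix_add_rdistrib)
qed

lemma matfun_smul: "smul c (matfun f A) = matfun (\<lambda>x. c * f x) A"
proof -
  obtain U d where U: "unitary_mat U" "A = U ** cdiag (\<lambda>i. complex_of_real (d i)) ** cadj U"
    using hermitian_diagonalization[OF A] .
  have "cdiag (\<lambda>i. c * f (d i)) = smul c (cdiag (\<lambda>i. f (d i)))"
    by (simp add: vec_eq_iff cdiag_def smul_def)
  thus ?thesis by (simp add: matfun_diag[OF U] smul_mult_left smul_mult_right)
qed

lemma matfun_cadj: "cadj (matfun f A) = matfun (\<lambda>x. cnj (f x)) A"
proof -
  obtain U d where U: "unitary_mat U" "A = U ** cdiag (\<lambda>i. complex_of_real (d i)) ** cadj U"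
    using hermitian_diagonalization[OF A] .
  have "cadj (cdiag (\<lambda>i. f (d i))) = cdiag (\<lambda>i. cnj (f (d i)))"
    by (auto simp add: vec_eq_iff cdiag_def cadj_def)
  thus ?thesis by (simp add: matfun_diag[OF U] cadj_mult matrix_mul_assoc)
qed

lemma matfun_1: "matfun (\<lambda>x. 1) A = mat 1"
proof -
  obtain U d where U: "unitary_mat U" "A = U ** cdiag (\<lambda>i. complex_of_real (d i)) ** cadj U"
    using hermitian_diagonalization[OF A] .
  have "cdiag (\<lambda>i. 1) = (mat 1 :: 'n cmat)" by (simp add: vec_eq_iff cdiag_def mat_def)
  thus ?thesis using U(1) by (simp add: matfun_diag[OF U] unitary_mat_def)
qed

lemma matfun_const: "matfun (\<lambda>x. c) A = smul c (mat 1)"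
  using matfun_smul[of c "\<lambda>_. 1"] by (simp add: matfun_1)

lemma matfun_id: "matfun complex_of_real A = A"
  using hermitian_diagonalization[OF A] matfun_diag by metis

end

section \<open>Spectral projections\<close>

definition specproj :: "'n::finite cmat \<Rightarrow> real \<Rightarrow> 'n cmat" where
  "specproj A a = matfun (indicator {a}) A"

text \<open>For a Hermitian matrix, the set of its eigenvalues, encoded without reference to a
  diagonalizing basis.\<close>

definition spec :: "'n::finite cmat \<Rightarrow> real set" where
  "spec A = {a. specproj A a \<noteq> 0}"

lemma spec_nonzero: "a \<in> spec A \<Longrightarrow> specproj A a \<noteq> 0"
  by (simp add: spec_def)

context
  fixes A :: "'n::finite cmat"
  assumes A: "hermitian_mat A"
begin

text \<open>The spectral decomposition, obtained by grouping equal diagonal entries of a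
  diagonalization.\<close>

lemma finite_spec: "finite (spec A)"
  and matfun_spec: "matfun f A = (\<Sum>a\<in>spec A. smul (f a) (specproj A a))"
proof -
  obtain U d where U: "unitary_mat U" "A = U ** cdiag (\<lambda>i. complex_of_real (d i)) ** cadj U"
    using hermitian_diagonalization[OF A] .
  have sub: "spec A \<subseteq> range d"
  proof
    fix a assume a: "a \<in> spec A"
    show "a \<in> range d"
    proof (rule ccontr)
      assume "a \<notin> range d"
      hence "indicator {a} (d i) = (0::complex)" for i by (auto simp: indicator_def)
      hence "cdiag (\<lambda>i. indicator {a} (d i)) = (0 :: 'n cmat)" by (simp add: cdiag_def vec_eq_iff)
      hence "specproj A a = 0" by (simp add: specproj_def matfun_diag[OF U])
      thus False using a by (simp add: spec_def)
    qed
  qed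
  thus "finite (spec A)" by (rule finite_subset) simp
  have "cdiag (\<lambda>i. f (d i)) = (\<Sum>a\<in>range d. smul (f a) (cdiag (\<lambda>i. indicator {a} (d i))))"
  proof -
    have "(\<Sum>a\<in>range d. f a * (if i = j then indicator {a} (d i) else 0)) = (if i = j then f (d i) else 0)" for i j
    proof (cases "i = j")
      case True
      have "(\<Sum>a\<in>range d. f a * indicator {a} (d i)) = (\<Sum>a\<in>range d. if a = d i then f a else 0)"
        by (rule sum.cong) (auto simp: indicator_def)
      thus ?thesis using True by (simp add: sum.delta')
    qed simp
    thus ?thesis by (simp add: vec_eq_iff cdiag_def smul_def)
  qed
  hence "matfun f A = (\<Sum>a\<in>range d. smul (f a) (specproj A a))"
    by (simp add: matfun_diag[OF U] specproj_def matrix_sum_left matrix_sum_right smul_mult_left smul_mult_right)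
  also have "\<dots> = (\<Sum>a\<in>spec A. smul (f a) (specproj A a))"
    by (rule sum.mono_neutral_right) (use sub in \<open>auto simp: spec_def\<close>)
  finally show "matfun f A = (\<Sum>a\<in>spec A. smul (f a) (specproj A a))" .
qed

lemma matfun_cong: "(\<And>a. a \<in> spec A \<Longrightarrow> f a = g a) \<Longrightarrow> matfun f A = matfun g A"
  by (simp add: matfun_spec)

lemma specproj_hermitian: "cadj (specproj A a) = specproj A a"
proof -
  have "(\<lambda>x. cnj (indicator {a} x)) = indicator {a}" by (auto simp: indicator_def fun_eq_iff)
  thus ?thesis by (simp add: specproj_def matfun_cadj[OF A])
qed

lemma specproj_mult: "specproj A a ** specproj A b = (if a = b then specproj A a else 0)"
proof (cases "a = b")
  case True
  have "(\<lambda>x. indicator {a} x * indicator {a} x) = (indicator {a} :: real \<Rightarrow> complex)"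
    by (auto simp: indicator_def fun_eq_iff)
  thus ?thesis using True by (simp add: specproj_def matfun_mult[OF A])
next
  case False
  have "(\<lambda>x. indicator {a} x * indicator {b} x) = (\<lambda>x. 0 :: complex)"
    using False by (auto simp: indicator_def fun_eq_iff)
  thus ?thesis using False by (simp add: specproj_def matfun_mult[OF A] matfun_const[OF A])
qed

lemma matfun_specproj: "matfun f A ** specproj A a = smul (f a) (specproj A a)"
  and specproj_matfun: "specproj A a ** matfun f A = smul (f a) (specproj A a)"
proof -
  have *: "(\<lambda>x. f x * indicator {a} x) = (\<lambda>x. f a * indicator {a} x)"
    by (auto simp: indicator_def fun_eq_iff)
  show "matfun f A ** specproj A a = smul (f a) (specproj A a)"
    by (simp add: specproj_def matfun_mult[OF A] matfun_smul[OF A] *)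
  thus "specproj A a ** matfun f A = smul (f a) (specproj A a)"
    by (simp add: specproj_def matfun_mult[OF A] mult.commute)
qed

end

lemma matfun_compose:
  assumes "hermitian_mat A"
  shows "matfun f (matfun (\<lambda>x. complex_of_real (g x)) A) = matfun (\<lambda>x. f (g x)) A"
proof -
  obtain U d where U: "unitary_mat U" "A = U ** cdiag (\<lambda>i. complex_of_real (d i)) ** cadj U"
    using hermitian_diagonalization[OF assms] .
  have "matfun (\<lambda>x. complex_of_real (g x)) A = U ** cdiag (\<lambda>i. complex_of_real (g (d i))) ** cadj U"
    by (rule matfun_diag[OF U])
  thus ?thesis
    by (simp only: matfun_diag[OF U(1), where d = "\<lambda>i. g (d i)"] matfun_diag[OF U])
qed

lemma mabs_hermitian:
  assumes "hermitian_mat A" shows "mabs A = matfun (\<lambda>x. complex_of_real \<bar>x\<bar>) A"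
proof -
  have "cadj A ** A = matfun (\<lambda>x. complex_of_real (x * x)) A"
    using matfun_mult[OF assms, of complex_of_real complex_of_real] assms
    by (simp add: matfun_id hermitian_mat_def)
  thus ?thesis
    unfolding mabs_def by (simp only: matfun_compose[OF assms]) simp
qed

text \<open>Polarization: reality of the form at \<open>v + w\<close> fixes the imaginary part of
  the sesquilinear form, and reality at \<open>v + \<i> *s w\<close> its real part.\<close>

lemma psd_hermitian:
  fixes A :: "'n::finite cmat"
  assumes "psd A" shows "hermitian_mat A"
proof -
  have re: "Im (cinner v (A *v v)) = 0" for v
    using assms by (simp add: psd_def cinner_def)
  let ?f = "\<lambda>v w. cinner v (A *v w)"
  have exp: "?f (v + w) (v + w) = ?f v v + ?f v w + ?f w v + ?f w w" for v w
    by (simp add: cinner_add_left cinner_add_right matrix_vector_right_distrib)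
  have lin: "A *v (c *s w) = c *s (A *v w)" for c w
    by (simp add: vec_eq_iff matrix_vector_mult_def sum_distrib_left mult_ac)
  have sym: "?f v w = cnj (?f w v)" for v w
  proof (rule complex_eqI)
    show "Im (?f v w) = Im (cnj (?f w v))"
      using re[of "v + w"] re[of v] re[of w] by (simp add: exp)
    have "Im (?f (v + \<i> *s w) (v + \<i> *s w)) = 0" by (rule re)
    thus "Re (?f v w) = Re (cnj (?f w v))"
      using re[of v] re[of w] by (simp add: exp lin cinner_scale_right cinner_scale_left)
  qed
  have adj: "A $ i $ j = cnj (A $ j $ i)" for i j
  proof -
    have entry: "?f (axis i 1) (axis j 1) = A $ i $ j" for i j
    proof -
      have "(\<Sum>k\<in>UNIV. A $ l $ k * axis j 1 $ k) = (\<Sum>k\<in>UNIV. if k = j then A $ l $ k else 0)" for l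
        by (rule sum.cong) (auto simp: axis_def)
      hence "(\<Sum>k\<in>UNIV. A $ l $ k * axis j 1 $ k) = A $ l $ j" for l
        by simp
      moreover have "cinner (axis i 1) w = w $ i" for w :: "complex^'n"
      proof -
        have "cinner (axis i 1) w = (\<Sum>l\<in>UNIV. if l = i then w $ l else 0)"
          unfolding cinner_def by (rule sum.cong) (auto simp: axis_def)
        thus ?thesis by simp
      qed
      ultimately show ?thesis by (simp add: matrix_vector_mult_def)
    qed
    show ?thesis using sym[of "axis i 1" "axis j 1"] unfolding entry .
  qed
  have "cadj A $ i $ j = A $ i $ j" for i j by (subst adj) (simp add: cadj_def)
  thus ?thesis unfolding hermitian_mat_def vec_eq_iff by blast
qed

text \<open>The spectral form of positivity with invertibility: on positive eigenvalues complex
  powers are exponentials of multiples of the real logarithm, as \<open>mpow_0\<close> and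
  \<open>mpow_cadj\<close> require.\<close>

definition posdef :: "'n::finite cmat \<Rightarrow> bool" where
  "posdef A \<longleftrightarrow> hermitian_mat A \<and> (\<forall>a\<in>spec A. a > 0)"

text \<open>A nonzero vector in the range of \<open>specproj A a\<close> is an eigenvector; testing
  the form on it gives \<open>0 \<le> a\<close>, and invertibility excludes 0.\<close>

lemma psd_invertible_posdef:
  assumes "psd A" "invertible A" shows "posdef A"
  unfolding posdef_def
proof (intro conjI ballI)
  show A: "hermitian_mat A" using psd_hermitian assms by blast
  fix a assume a: "a \<in> spec A"
  have "\<exists>v. specproj A a *v v \<noteq> 0"
    using spec_nonzero[OF a] matrix_eq[of "specproj A a" 0] by auto
  then obtain v where v: "specproj A a *v v \<noteq> 0" by blast
  let ?w = "specproj A a *v v"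
  have "A ** specproj A a = smul (of_real a) (specproj A a)"
    using matfun_specproj[OF A, of complex_of_real a] by (simp add: matfun_id[OF A])
  hence "A *v ?w = smul (of_real a) (specproj A a) *v v" by (simp add: matrix_vector_mul_assoc)
  also have "\<dots> = of_real a *s ?w"
    by (simp add: vec_eq_iff matrix_vector_mult_def smul_def sum_distrib_left mult.assoc)
  finally have eig: "A *v ?w = complex_of_real a *s ?w" .
  have "0 \<le> Re (cinner ?w (A *v ?w))" using assms(1) by (simp add: psd_def cinner_def)
  hence "0 \<le> a * (norm ?w)\<^sup>2" by (simp add: eig cinner_scale_right cinner_self)
  hence "0 \<le> a" using v by (simp add: zero_le_mult_iff)
  moreover have "a \<noteq> 0"
  proof
    assume "a = 0"
    hence "A *v ?w = 0" using eig by simp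
    thus False using assms(2) v by (metis invertible_def matrix_vector_mul_assoc matrix_vector_mul_lid matrix_vector_mult_0_right)
  qed
  ultimately show "a > 0" by simp
qed

section \<open>Modular operators in a tracial algebra\<close>

text \<open>The spectrum is finite, so the indicator of an eigenvalue agrees on it with a Lagrange
  interpolation polynomial \<open>?p\<close>. Spectral projections are thus polynomials in
  \<open>A\<close>, and every function of \<open>A\<close> is a combination of them.\<close>

lemma matfun_mem_star_subalg:
  assumes M: "star_subalg M" and AM: "A \<in> M" and A: "hermitian_mat A"
  shows "matfun f A \<in> M"
proof -
  have sum_mem: "(\<Sum>i\<in>S. g i) \<in> M" if "\<And>i. i \<in> S \<Longrightarrow> g i \<in> M" for S :: "real set" and g
  proof -
    have "smul 0 A \<in> M" using M AM unfolding star_subalg_def by blast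
    thus ?thesis using that
      by (induction S rule: infinite_finite_induct) (use M in \<open>auto simp: star_subalg_def\<close>)
  qed
  have sp: "specproj A a \<in> M" if a: "a \<in> spec A" for a
  proof -
    let ?p = "\<lambda>S x. \<Prod>c\<in>S. (complex_of_real x - of_real c) * inverse (of_real a - of_real c)"
    have "matfun (?p S) A \<in> M" if "finite S" for S
      using that
    proof (induction S)
      case empty
      show ?case using M by (simp add: matfun_1[OF A] star_subalg_def)
    next
      case (insert c S)
      let ?k = "inverse (complex_of_real a - of_real c)"
      have "smul ?k (A + smul (- of_real c) (mat 1)) ** matfun (?p S) A \<in> M"
        using M AM insert.IH unfolding star_subalg_def by blast
      moreover have "smul ?k (A + smul (- of_real c) (mat 1)) = matfun (\<lambda>x. ?k * (of_real x + - of_real c)) A"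
        using matfun_add[OF A, of complex_of_real "\<lambda>_. - of_real c"]
        by (simp add: matfun_id[OF A] matfun_const[OF A] matfun_smul[OF A, symmetric])
      ultimately show ?case
        using insert.hyps by (simp add: matfun_mult[OF A] mult.commute)
    qed
    from this[of "spec A - {a}"] have "matfun (?p (spec A - {a})) A \<in> M"
      using finite_spec[OF A] by simp
    also have "matfun (?p (spec A - {a})) A = specproj A a"
      unfolding specproj_def
    proof (rule matfun_cong[OF A])
      fix x assume x: "x \<in> spec A"
      show "?p (spec A - {a}) x = indicator {a} x"
      proof (cases "x = a")
        case True
        thus ?thesis by (auto intro!: prod.neutral)
      next
        case False
        thus ?thesis using x finite_spec[OF A] by (auto intro!: prod_zero)
      qed
    qed
    finally show ?thesis .
  qed
  show ?thesis
    unfolding matfun_spec[OF A] by (rule sum_mem) (use sp M in \<open>auto simp: star_subalg_def\<close>)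
qed

section \<open>Complex powers of positive definite matrices\<close>

lemma posdef_hermitian: "posdef A \<Longrightarrow> hermitian_mat A"
  by (simp add: posdef_def)

lemma mpow_mult:
  assumes "posdef A" shows "mpow A z ** mpow A w = mpow A (z + w)"
  unfolding mpow_def matfun_mult[OF posdef_hermitian[OF assms]] by (simp add: powr_add)

lemma mpow_mult_assoc:
  assumes "posdef A" shows "mpow A z ** (mpow A w ** X) = mpow A (z + w) ** X"
  by (simp add: mpow_mult[OF assms] matrix_mul_assoc)

lemma mpow_0: 
  assumes "posdef A" shows "mpow A 0 = mat 1"
proof -
  have A: "hermitian_mat A" using assms posdef_hermitian by blast
  have "mpow A 0 = matfun (\<lambda>x. 1) A"
    unfolding mpow_def by (rule matfun_cong[OF A]) (use assms in \<open>auto simp: posdef_def powr_def\<close>)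
  thus ?thesis by (simp add: matfun_1[OF A])
qed

lemma mpow_1:
  assumes "posdef A" shows "mpow A 1 = A"
proof -
  have A: "hermitian_mat A" using assms posdef_hermitian by blast
  have "mpow A 1 = matfun complex_of_real A"
    unfolding mpow_def by (rule matfun_cong[OF A]) simp
  thus ?thesis by (simp add: matfun_id[OF A])
qed

lemma mpow_cadj:
  assumes "posdef A" shows "cadj (mpow A z) = mpow A (cnj z)"
proof -
  have A: "hermitian_mat A" using assms posdef_hermitian by blast
  show ?thesis
    unfolding mpow_def matfun_cadj[OF A]
    by (rule matfun_cong[OF A]) (use assms in \<open>auto simp: posdef_def cpowr_pos exp_cnj\<close>)
qed

lemma mpow_inverse:
  assumes "posdef A" shows "matrix_inv A = mpow A (-1)"
proof -
  have 1: "A ** mpow A (-1) = mat 1" "mpow A (-1) ** A = mat 1"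
    using mpow_mult[OF assms, of 1 "-1"] mpow_mult[OF assms, of "-1" 1] by (simp_all add: mpow_0 mpow_1 assms)
  hence "A ** matrix_inv A = mat 1"
    unfolding matrix_inv_def by (rule someI2[where P = "\<lambda>B. A ** B = mat 1 \<and> B ** A = mat 1", OF conjI]) simp
  hence "mpow A (-1) ** (A ** matrix_inv A) = mpow A (-1)" by simp
  thus ?thesis by (simp add: matrix_mul_assoc 1)
qed

text \<open>Joint functional calculus of two commuting operators, left multiplication by
  \<open>A\<close> and right multiplication by \<open>B\<close>: the block of \<open>x\<close> at
  eigenvalues \<open>a\<close>, \<open>b\<close> is scaled by \<open>f a b\<close>.\<close>

definition dblspec :: "'n::finite cmat \<Rightarrow> 'n cmat \<Rightarrow> (real \<Rightarrow> real \<Rightarrow> complex) \<Rightarrow> 'n cmat \<Rightarrow> 'n cmat" where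
  "dblspec A B f x = (\<Sum>a\<in>spec A. \<Sum>b\<in>spec B. smul (f a b) (specproj A a ** x ** specproj B b))"

lemma matfun_dblspec:
  assumes "hermitian_mat A" "hermitian_mat B"
  shows "matfun f A ** x ** matfun g B = dblspec A B (\<lambda>a b. f a * g b) x"
  by (simp add: dblspec_def matfun_spec assms matrix_sum_left matrix_sum_right smul_mult_left smul_mult_right smul_smul smul_sum)
    (subst sum.swap, simp add: mult.commute)

lemma dblspec_add: "dblspec A B f x + dblspec A B g x = dblspec A B (\<lambda>a b. f a b + g a b) x"
  by (simp add: dblspec_def smul_add_left sum.distrib)

lemma dblspec_smul: "smul c (dblspec A B f x) = dblspec A B (\<lambda>a b. c * f a b) x"
  by (simp add: dblspec_def smul_sum smul_smul)

lemma matfun_dblspec_mult: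
  assumes A: "hermitian_mat A" and B: "hermitian_mat B"
  shows "matfun f A ** dblspec A B h x ** matfun g B = dblspec A B (\<lambda>a b. f a * g b * h a b) x"
proof -
  have "matfun f A ** (specproj A a ** x ** specproj B b) ** matfun g B
      = smul (f a * g b) (specproj A a ** x ** specproj B b)" for a b
  proof -
    have "matfun f A ** (specproj A a ** x ** specproj B b) ** matfun g B
      = (matfun f A ** specproj A a) ** x ** (specproj B b ** matfun g B)"
      by (simp add: matrix_mul_assoc)
    thus ?thesis by (simp add: matfun_specproj[OF A] specproj_matfun[OF B] smul_mult_left smul_mult_right smul_smul mult.commute)
  qed
  thus ?thesis
    by (simp add: dblspec_def matrix_sum_left matrix_sum_right smul_mult_left smul_mult_right smul_smul mult_ac)
qed

lemma dblspec_cong: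
  "(\<And>a b. a \<in> spec A \<Longrightarrow> b \<in> spec B \<Longrightarrow> f a b = g a b) \<Longrightarrow> dblspec A B f x = dblspec A B g x"
  by (simp add: dblspec_def)

text \<open>\<open>resolv A B l x\<close> is \<open>(l + \<Delta>)\<^sup>-\<^sup>1 x\<close> for the relative modular operator \<open>\<Delta> x = A x B\<^sup>-\<^sup>1\<close>.\<close>

definition resolv :: "'n::finite cmat \<Rightarrow> 'n cmat \<Rightarrow> real \<Rightarrow> 'n cmat \<Rightarrow> 'n cmat" where
  "resolv A B l x = dblspec A B (\<lambda>a b. 1 / of_real (l + a / b)) x"

lemma dblspec_1:
  assumes "posdef A" "posdef B" shows "dblspec A B (\<lambda>a b. 1) x = x"
  using matfun_dblspec[OF posdef_hermitian[OF assms(1)] posdef_hermitian[OF assms(2)], of "\<lambda>_. 1" x "\<lambda>_. 1"]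
  by (simp add: matfun_1 posdef_hermitian assms)

text \<open>On the block at \<open>a\<close>, \<open>b\<close> the operator
  \<open>l + \<Delta>\<close> is multiplication by \<open>l + a / b\<close>, the reciprocal of the
  scalar in \<open>resolv\<close>.\<close>

lemma resolv_eq:
  assumes A: "posdef A" and B: "posdef B" and l: "l > 0"
  shows "smul (of_real l) (resolv A B l x) + A ** resolv A B l x ** mpow B (-1) = x"
proof -
  have h: "hermitian_mat A" "hermitian_mat B" using A B posdef_hermitian by auto
  have "A ** resolv A B l x ** mpow B (-1)
     = dblspec A B (\<lambda>a b. of_real a * of_real b powr (-1) * (1 / of_real (l + a / b))) x"
    using matfun_dblspec_mult[OF h, of complex_of_real _ x "\<lambda>b. of_real b powr (-1)"]
    by (simp add: resolv_def mpow_def matfun_id[OF h(1)])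
  hence "smul (of_real l) (resolv A B l x) + A ** resolv A B l x ** mpow B (-1)
    = dblspec A B (\<lambda>a b. of_real l * (1 / of_real (l + a / b)) + of_real a * of_real b powr (-1) * (1 / of_real (l + a / b))) x"
    by (simp add: resolv_def dblspec_smul dblspec_add)
  also have "\<dots> = dblspec A B (\<lambda>a b. 1) x"
  proof (rule dblspec_cong)
    fix a b assume "a \<in> spec A" "b \<in> spec B"
    hence ab: "a > 0" "b > 0" using A B by (auto simp: posdef_def)
    hence "complex_of_real b powr (-1) = 1 / of_real b"
      using powr_minus_divide[of "complex_of_real b" 1] by simp
    moreover have "l + a / b \<noteq> 0" using ab l by (metis add_pos_pos divide_pos_pos less_irrefl)
    hence "complex_of_real (l + a / b) \<noteq> 0" using of_real_eq_0_iff by blast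
    hence "(complex_of_real l + of_real a * (1 / of_real b)) * (1 / of_real (l + a / b)) = 1" by simp
    ultimately show "of_real l * (1 / of_real (l + a / b)) + of_real a * of_real b powr (-1) * (1 / of_real (l + a / b)) = (1::complex)"
      by (simp only: distrib_right)
  qed
  finally show ?thesis by (simp add: dblspec_1[OF A B])
qed

text \<open>The scalar formula of \<open>Stieltjes_powr\<close> is applied at \<open>a / b\<close>
  on each block and summed; the result is \<open>\<phi>\<close> of \<open>\<Delta>\<close> to the
  power \<open>z\<close> applied to \<open>x\<close>. Keeping \<open>\<phi>\<close> abstract allows
  inner products taken before or after a further linear map.\<close>

lemma resolv_functional_integral:
  assumes A: "posdef A" and B: "posdef B"
    and z: "-1 < Re z" "Re z < 1" "Re z \<noteq> 0"
    and \<phi>: "\<And>f. \<phi> (dblspec A B f x) = (\<Sum>a\<in>spec A. \<Sum>b\<in>spec B. f a b * \<phi> (specproj A a ** x ** specproj B b))"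
  shows "((\<lambda>l. of_real l powr z * (\<phi> (resolv A B l x) - (if Re z > 0 then \<phi> x / of_real l else 0)))
     has_integral (- of_real pi / sin (of_real pi * z) * \<phi> (mpow A z ** x ** mpow B (- z)))) {0<..}"
proof -
  define C where "C a b = \<phi> (specproj A a ** x ** specproj B b)" for a b
  have h: "hermitian_mat A" "hermitian_mat B" using A B posdef_hermitian by auto
  have "((\<lambda>l. \<Sum>a\<in>spec A. \<Sum>b\<in>spec B. of_real l powr z * (1 / of_real (l + a / b) - (if Re z > 0 then 1 / of_real l else 0)) * C a b)
     has_integral (\<Sum>a\<in>spec A. \<Sum>b\<in>spec B. - of_real pi / sin (of_real pi * z) * of_real (a / b) powr z * C a b)) {0<..}"
    by (intro has_integral_sum has_integral_mult_left Stieltjes_powr finite_spec h z)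
      (use A B in \<open>auto simp: posdef_def\<close>)
  moreover have "(\<Sum>a\<in>spec A. \<Sum>b\<in>spec B. - of_real pi / sin (of_real pi * z) * of_real (a / b) powr z * C a b)
     = - of_real pi / sin (of_real pi * z) * \<phi> (mpow A z ** x ** mpow B (- z))"
  proof -
    have "complex_of_real (a / b) powr z = of_real a powr z * of_real b powr (- z)" if "a \<in> spec A" "b \<in> spec B" for a b
    proof -
      have ab: "a > 0" "b > 0" "a / b > 0" using A B that by (auto simp: posdef_def)
      show ?thesis
        unfolding ab[THEN cpowr_pos] using ab
        by (simp add: ln_div right_diff_distrib exp_diff exp_minus field_simps)
    qed
    thus ?thesis
      unfolding mpow_def matfun_dblspec[OF h] \<phi> C_def[symmetric] sum_distrib_left
      by (intro sum.cong refl) (simp add: mult.assoc)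
  qed
  moreover have "(\<Sum>a\<in>spec A. \<Sum>b\<in>spec B. of_real l powr z * (1 / of_real (l + a / b) - (if Re z > 0 then 1 / of_real l else 0)) * C a b)
     = of_real l powr z * (\<phi> (resolv A B l x) - (if Re z > 0 then \<phi> x / of_real l else 0))" for l
  proof -
    have "\<phi> x = (\<Sum>a\<in>spec A. \<Sum>b\<in>spec B. C a b)"
      using \<phi>[of "\<lambda>_ _. 1"] by (simp add: dblspec_1[OF A B] C_def)
    thus ?thesis
      unfolding resolv_def \<phi> C_def[symmetric]
      by (simp add: sum_distrib_left sum_divide_distrib right_diff_distrib left_diff_distrib sum_subtractf mult.assoc)
  qed
  ultimately show ?thesis by simp
qed

section \<open>The trace inner product and its norm\<close>

locale trace_alg =
  fixes M :: "'n::finite cmat set" and \<tau> :: "'n cmat \<Rightarrow> complex"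
  assumes subalg: "star_subalg M" and trace: "faithful_trace M \<tau>"
begin

lemma one_mem [simp]: "mat 1 \<in> M"
  and add_mem [simp]: "x \<in> M \<Longrightarrow> y \<in> M \<Longrightarrow> x + y \<in> M"
  and mult_mem [simp]: "x \<in> M \<Longrightarrow> y \<in> M \<Longrightarrow> x ** y \<in> M"
  and smul_mem [simp]: "x \<in> M \<Longrightarrow> smul c x \<in> M"
  and cadj_mem [simp]: "x \<in> M \<Longrightarrow> cadj x \<in> M"
  using subalg by (auto simp: star_subalg_def)

lemma zero_mem [simp]: "0 \<in> M"
  using smul_mem[OF one_mem, of 0] by simp

lemma minus_mem [simp]: "x \<in> M \<Longrightarrow> - x \<in> M"
  using smul_mem[of x "-1"] by (simp add: smul_minus1)

lemma diff_mem [simp]: "x \<in> M \<Longrightarrow> y \<in> M \<Longrightarrow> x - y \<in> M"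
  using add_mem[of x "- y"] by simp

lemma sum_mem: "(\<And>i. i \<in> S \<Longrightarrow> f i \<in> M) \<Longrightarrow> (\<Sum>i\<in>S. f i) \<in> M"
  by (induction S rule: infinite_finite_induct) auto

lemma matfun_mem: "A \<in> M \<Longrightarrow> hermitian_mat A \<Longrightarrow> matfun f A \<in> M"
  using matfun_mem_star_subalg subalg by blast

lemma mpow_mem [simp]: "A \<in> M \<Longrightarrow> posdef A \<Longrightarrow> mpow A z \<in> M"
  by (simp add: mpow_def matfun_mem posdef_hermitian)

lemma specproj_mem [simp]: "A \<in> M \<Longrightarrow> hermitian_mat A \<Longrightarrow> specproj A a \<in> M"
  by (simp add: specproj_def matfun_mem)

lemma dblspec_mem: "A \<in> M \<Longrightarrow> B \<in> M \<Longrightarrow> posdef A \<Longrightarrow> posdef B \<Longrightarrow> x \<in> M \<Longrightarrow> dblspec A B f x \<in> M"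
  by (simp add: dblspec_def sum_mem posdef_hermitian)

lemma resolv_mem [simp]: "A \<in> M \<Longrightarrow> B \<in> M \<Longrightarrow> posdef A \<Longrightarrow> posdef B \<Longrightarrow> x \<in> M \<Longrightarrow> resolv A B l x \<in> M"
  by (simp add: resolv_def dblspec_mem)

lemma tr_add: "x \<in> M \<Longrightarrow> y \<in> M \<Longrightarrow> \<tau> (x + y) = \<tau> x + \<tau> y"
  and tr_comm: "x \<in> M \<Longrightarrow> y \<in> M \<Longrightarrow> \<tau> (x ** y) = \<tau> (y ** x)"
  and tr_smul: "x \<in> M \<Longrightarrow> \<tau> (smul c x) = c * \<tau> x"
  using trace by (auto simp: faithful_trace_def)

lemma tr_0: "\<tau> 0 = 0"
  using tr_smul[of "mat 1" 0] by simp

lemma tr_diff: "x \<in> M \<Longrightarrow> y \<in> M \<Longrightarrow> \<tau> (x - y) = \<tau> x - \<tau> y"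
  using tr_add[of x "smul (-1) y"] tr_smul[of y "-1"] by (simp add: smul_minus1)

lemma tr_sum: "(\<And>i. i \<in> S \<Longrightarrow> f i \<in> M) \<Longrightarrow> \<tau> (\<Sum>i\<in>S. f i) = (\<Sum>i\<in>S. \<tau> (f i))"
  by (induction S rule: infinite_finite_induct) (auto simp: tr_0 tr_add sum_mem)

lemma tr_pos: "x \<in> M \<Longrightarrow> x \<noteq> 0 \<Longrightarrow> 0 < Re (\<tau> (cadj x ** x))"
  using trace by (auto simp: faithful_trace_def)

lemma tr_nonneg: "x \<in> M \<Longrightarrow> 0 \<le> Re (\<tau> (cadj x ** x))"
  using tr_pos[of x] by (cases "x = 0") (auto simp: tr_0)

lemma tr_square_real: "x \<in> M \<Longrightarrow> Im (\<tau> (cadj x ** x)) = 0"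
  using trace by (cases "x = 0") (auto simp: faithful_trace_def tr_0)

text \<open>Reality of the trace is given only on elements \<open>cadj x ** x\<close>; expanding
  these at \<open>x + mat 1\<close> and \<open>x + smul \<i> (mat 1)\<close> yields the imaginary
  and the real part.\<close>

lemma tr_cadj: 
  assumes "x \<in> M" shows "\<tau> (cadj x) = cnj (\<tau> x)"
proof (rule complex_eqI)
  have 1: "cadj (x + mat 1) ** (x + mat 1) = cadj x ** x + cadj x + x + mat 1"
    by (simp add: cadj_add matrix_add_ldistrib matrix_add_rdistrib)
  have 2: "cadj (x + smul \<i> (mat 1)) ** (x + smul \<i> (mat 1)) = cadj x ** x + smul \<i> (cadj x) + smul (-\<i>) x + mat 1"
    by (simp add: cadj_add cadj_smul matrix_add_ldistrib matrix_add_rdistrib smul_mult_left smul_mult_right smul_smul smul_add)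
  show "Im (\<tau> (cadj x)) = Im (cnj (\<tau> x))"
    using tr_square_real[of "x + mat 1"] tr_square_real[of x] tr_square_real[of "mat 1"] assms
    unfolding 1 by (simp add: tr_add)
  show "Re (\<tau> (cadj x)) = Re (cnj (\<tau> x))"
    using tr_square_real[of "x + smul \<i> (mat 1)"] tr_square_real[of x] tr_square_real[of "mat 1"] assms
    unfolding 2 by (simp add: tr_add tr_smul)
qed

definition ip :: "'n cmat \<Rightarrow> 'n cmat \<Rightarrow> complex" where "ip x y = \<tau> (cadj x ** y)"

definition nrm :: "'n cmat \<Rightarrow> real" where "nrm x = sqrt (Re (ip x x))"

lemma ip_add_right: "x \<in> M \<Longrightarrow> y \<in> M \<Longrightarrow> z \<in> M \<Longrightarrow> ip x (y + z) = ip x y + ip x z"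
  and ip_add_left: "x \<in> M \<Longrightarrow> y \<in> M \<Longrightarrow> z \<in> M \<Longrightarrow> ip (y + z) x = ip y x + ip z x"
  and ip_diff_right: "x \<in> M \<Longrightarrow> y \<in> M \<Longrightarrow> z \<in> M \<Longrightarrow> ip x (y - z) = ip x y - ip x z"
  and ip_diff_left: "x \<in> M \<Longrightarrow> y \<in> M \<Longrightarrow> z \<in> M \<Longrightarrow> ip (y - z) x = ip y x - ip z x"
  and ip_smul_right: "x \<in> M \<Longrightarrow> y \<in> M \<Longrightarrow> ip x (smul c y) = c * ip x y"
  and ip_smul_left: "x \<in> M \<Longrightarrow> y \<in> M \<Longrightarrow> ip (smul c x) y = cnj c * ip x y"
  by (simp_all add: ip_def cadj_add cadj_diff cadj_smul matrix_add_ldistrib matrix_add_rdistrib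
      matrix_diff_ldistrib matrix_diff_rdistrib smul_mult_left smul_mult_right tr_add tr_diff tr_smul)

lemma ip_sum_right: "x \<in> M \<Longrightarrow> (\<And>i. i \<in> S \<Longrightarrow> f i \<in> M) \<Longrightarrow> ip x (\<Sum>i\<in>S. f i) = (\<Sum>i\<in>S. ip x (f i))"
  by (simp add: ip_def matrix_sum_right tr_sum)

lemma ip_cnj: "x \<in> M \<Longrightarrow> y \<in> M \<Longrightarrow> ip x y = cnj (ip y x)"
  using tr_cadj[of "cadj y ** x"] by (simp add: ip_def cadj_mult)

lemma nrm_nonneg [simp]: "x \<in> M \<Longrightarrow> 0 \<le> nrm x"
  by (simp add: nrm_def ip_def tr_nonneg)

lemma nrm_square: "x \<in> M \<Longrightarrow> (nrm x)\<^sup>2 = Re (ip x x)"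
  by (simp add: nrm_def ip_def tr_nonneg)

lemma ip_self: "x \<in> M \<Longrightarrow> ip x x = of_real ((nrm x)\<^sup>2)"
  using tr_square_real[of x] by (simp add: complex_eq_iff nrm_square) (simp add: ip_def)

lemma nrm_eq_0: "x \<in> M \<Longrightarrow> nrm x = 0 \<longleftrightarrow> x = 0"
  using tr_pos[of x] by (cases "x = 0") (auto simp: nrm_def ip_def tr_0)

lemma Cauchy_Schwarz:
  assumes "x \<in> M" "y \<in> M" shows "cmod (ip x y) \<le> nrm x * nrm y"
proof (cases "y = 0")
  case True
  thus ?thesis using assms by (simp add: ip_def tr_0 nrm_def)
next
  case False
  define p where "p = ip x y"
  define b where "b = (nrm y)\<^sup>2"
  have b: "b > 0" using False assms by (simp add: b_def nrm_eq_0)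
  \<comment> \<open>\<open>b\<close> times the component of \<open>x\<close> orthogonal to
    \<open>y\<close>; the scaling avoids a division.\<close>
  define z where "z = smul (of_real b) x - smul (cnj p) y"
  have z: "z \<in> M" using assms by (simp add: z_def)
  have "ip z z = of_real b * of_real b * ip x x - of_real b * cnj p * ip x y - p * of_real b * ip y x + p * cnj p * ip y y"
    unfolding z_def using assms by (simp add: ip_diff_left ip_diff_right ip_smul_left ip_smul_right algebra_simps)
  also have "ip y x = cnj p" using assms by (simp add: p_def ip_cnj[of y x])
  also have "ip x y = p" by (simp add: p_def)
  also have "ip y y = of_real b" using assms by (simp add: b_def ip_self)
  also have "of_real b * of_real b * ip x x - of_real b * cnj p * p - p * of_real b * cnj p + p * cnj p * of_real b
     = of_real b * (of_real b * ip x x - p * cnj p)"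
    by (simp add: algebra_simps)
  also have "\<dots> = of_real (b * (b * (nrm x)\<^sup>2 - (cmod p)\<^sup>2))"
    using assms by (simp add: ip_self complex_norm_square[of p, symmetric])
  finally have "Re (ip z z) = b * (b * (nrm x)\<^sup>2 - (cmod p)\<^sup>2)" by simp
  hence "0 \<le> b * (b * (nrm x)\<^sup>2 - (cmod p)\<^sup>2)" using nrm_square[OF z] by (metis zero_le_power2)
  hence "(cmod p)\<^sup>2 \<le> b * (nrm x)\<^sup>2" using b by (simp add: zero_le_mult_iff)
  also have "\<dots> = (nrm x * nrm y)\<^sup>2" by (simp add: b_def power_mult_distrib)
  finally show ?thesis unfolding p_def by (rule power2_le_imp_le) (simp add: assms)
qed

lemma nrm_triangle: 
  assumes "x \<in> M" "y \<in> M" shows "nrm (x - y) \<le> nrm x + nrm y"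
proof (rule power2_le_imp_le)
  have "(nrm (x - y))\<^sup>2 = (nrm x)\<^sup>2 + (nrm y)\<^sup>2 - 2 * Re (ip x y)"
    using assms ip_cnj[of y x] by (simp add: nrm_square ip_diff_left ip_diff_right)
  moreover have "\<bar>Re (ip x y)\<bar> \<le> nrm x * nrm y"
    using Cauchy_Schwarz[OF assms] abs_Re_le_cmod[of "ip x y"] by linarith
  ultimately show "(nrm (x - y))\<^sup>2 \<le> (nrm x + nrm y)\<^sup>2"
    by (simp add: power2_sum abs_le_iff)
  show "0 \<le> nrm x + nrm y" using assms by simp
qed

lemma nrm_smul: "x \<in> M \<Longrightarrow> nrm (smul c x) = cmod c * nrm x"
proof (rule power2_eq_imp_eq)
  assume x: "x \<in> M"
  have "ip (smul c x) (smul c x) = cnj c * c * of_real ((nrm x)\<^sup>2)"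
    using x by (simp add: ip_smul_left ip_smul_right ip_self[OF x])
  also have "\<dots> = of_real ((cmod c * nrm x)\<^sup>2)"
    using complex_norm_square[of c] by (simp add: power_mult_distrib mult.commute)
  finally show "(nrm (smul c x))\<^sup>2 = (cmod c * nrm x)\<^sup>2"
    using x by (simp only: nrm_square smul_mem Re_complex_of_real)
qed auto

section \<open>Positivity and resolvent bounds for the relative modular operator\<close>

lemma modular_selfadjoint:
  assumes "A \<in> M" "B \<in> M" "posdef A" "posdef B" "x \<in> M" "y \<in> M"
  shows "ip x (A ** y ** mpow B (-1)) = ip (A ** x ** mpow B (-1)) y"
proof -
  have "ip (A ** x ** mpow B (-1)) y = \<tau> (mpow B (-1) ** (cadj x ** A ** y))"
    using assms posdef_hermitian[of A] by (simp add: ip_def cadj_mult mpow_cadj hermitian_mat_def matrix_mul_assoc)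
  also have "\<dots> = \<tau> ((cadj x ** A ** y) ** mpow B (-1))"
    using assms by (intro tr_comm) auto
  finally show ?thesis by (simp add: ip_def matrix_mul_assoc)
qed

lemma modular_nonneg:
  assumes "A \<in> M" "B \<in> M" "posdef A" "posdef B" "x \<in> M"
  shows "0 \<le> Re (ip x (A ** x ** mpow B (-1)))"
proof -
  \<comment> \<open>\<open>?y\<close> is the square root of the modular operator applied to
    \<open>x\<close>, so its squared norm is the quadratic form in question.\<close>
  let ?y = "mpow A (1/2) ** x ** mpow B (-1/2)"
  have "\<tau> (cadj ?y ** ?y) = \<tau> (mpow B (-1/2) ** (cadj x ** mpow A (1/2) ** mpow A (1/2) ** x ** mpow B (-1/2)))"
    using assms by (simp add: cadj_mult mpow_cadj matrix_mul_assoc)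
  also have "\<dots> = \<tau> ((cadj x ** mpow A (1/2) ** mpow A (1/2) ** x ** mpow B (-1/2)) ** mpow B (-1/2))"
    using assms by (intro tr_comm) auto
  also have "\<dots> = ip x (A ** x ** mpow B (-1))"
    using assms by (simp add: ip_def mpow_mult mpow_mult_assoc mpow_1 flip: matrix_mul_assoc)
  finally show ?thesis using tr_nonneg[of ?y] assms by simp
qed

text \<open>Pair the equation with \<open>x\<close>, drop the nonnegative modular term, and apply
  the Cauchy-Schwarz inequality. Stated for any solution of the equation, it also covers vectors not
  defined as resolvents.\<close>

lemma modular_resolvent_bound:
  assumes A: "A \<in> M" "B \<in> M" "posdef A" "posdef B" and x: "x \<in> M" "h \<in> M" and l: "l > 0"
    and eq: "smul (of_real l) x + A ** x ** mpow B (-1) = h"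
  shows "l * (nrm x)\<^sup>2 \<le> Re (ip x h)" "nrm x \<le> nrm h / l"
proof -
  have "ip x h = of_real l * ip x x + ip x (A ** x ** mpow B (-1))"
    using A x by (simp add: eq[symmetric] ip_add_right ip_smul_right)
  thus 1: "l * (nrm x)\<^sup>2 \<le> Re (ip x h)"
    using modular_nonneg[OF A x(1)] x by (simp add: nrm_square)
  have "l * (nrm x)\<^sup>2 \<le> nrm x * nrm h"
    using 1 Cauchy_Schwarz[OF x] complex_Re_le_cmod[of "ip x h"] by linarith
  hence "nrm x * (l * nrm x) \<le> nrm x * nrm h"
    by (simp add: power2_eq_square mult.left_commute)
  moreover have "0 \<le> nrm x" "0 \<le> nrm h" using x by auto
  ultimately have "l * nrm x \<le> nrm h"
    by (cases "nrm x = 0") (auto dest: mult_left_le_imp_le)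
  thus "nrm x \<le> nrm h / l" using l by (simp add: pos_le_divide_eq mult.commute)
qed

end

section \<open>Compression to a subalgebra\<close>

text \<open>\<open>r\<close> and \<open>s\<close> play the parts of the restricted densities of
  \<open>\<rho>\<close> and \<open>\<sigma>\<close>; the relation between the algebras enters
  through the two trace dualities.\<close>

locale trace_alg_pair = M: trace_alg M \<tau> + N: trace_alg N \<tau>
  for M N :: "'n::finite cmat set" and \<tau> +
  fixes \<rho> \<sigma> r s :: "'n cmat"
  assumes sub: "N \<subseteq> M"
    and mem: "\<rho> \<in> M" "\<sigma> \<in> M" "r \<in> N" "s \<in> N"
    and pd: "posdef \<rho>" "posdef \<sigma>" "posdef r" "posdef s"
    and tr_\<rho>: "\<And>x. x \<in> N \<Longrightarrow> \<tau> (x ** \<rho>) = \<tau> (x ** r)"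
    and tr_\<sigma>: "\<And>x. x \<in> N \<Longrightarrow> \<tau> (x ** \<sigma>) = \<tau> (x ** s)"
    and tr_1: "\<tau> \<rho> = 1" "\<tau> \<sigma> = 1"
begin

lemmas mpow_simps = mpow_mult[OF pd(1)] mpow_mult[OF pd(2)] mpow_mult[OF pd(3)] mpow_mult[OF pd(4)]
  mpow_mult_assoc[OF pd(1)] mpow_mult_assoc[OF pd(2)] mpow_mult_assoc[OF pd(3)] mpow_mult_assoc[OF pd(4)]
  pd[THEN mpow_0] pd[THEN mpow_1] pd[THEN mpow_cadj]

lemma subalg_mem [simp]: "x \<in> N \<Longrightarrow> x \<in> M"
  using sub by blast

declare mem [simp] pd [simp]

section \<open>The isometry and the compression of the modular operator\<close>

definition V :: "'n cmat \<Rightarrow> 'n cmat" where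
  "V x = x ** mpow r (-1/2) ** mpow \<rho> (1/2)"

lemma V_mem [simp]: "x \<in> N \<Longrightarrow> V x \<in> M"
  by (simp add: V_def)

lemma V_smul: "V (smul c x) = smul c (V x)"
  by (simp add: V_def smul_mult_left)

lemma V_add: "V (x + y) = V x + V y"
  by (simp add: V_def matrix_add_rdistrib)

lemma V_sum: "V (\<Sum>i\<in>S. f i) = (\<Sum>i\<in>S. V (f i))"
  by (simp add: V_def matrix_sum_left)

lemma V_sqrt: "V (mpow r (1/2)) = mpow \<rho> (1/2)"
  by (simp add: V_def mpow_simps)

text \<open>By cyclicity the outer square roots combine to \<open>\<rho>\<close> paired with
  \<open>?k\<close> in \<open>N\<close>; there \<open>\<rho>\<close> may be replaced by
  \<open>r\<close>, which cancels the inverse square roots.\<close>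

lemma V_isometry:
  assumes [simp]: "x \<in> N" "y \<in> N" shows "M.ip (V x) (V y) = M.ip x y"
proof -
  let ?k = "mpow r (-1/2) ** (cadj x ** y) ** mpow r (-1/2)"
  have k: "?k \<in> N" by simp
  have "M.ip (V x) (V y) = \<tau> (mpow \<rho> (1/2) ** (?k ** mpow \<rho> (1/2)))"
    by (simp add: M.ip_def V_def cadj_mult mpow_simps matrix_mul_assoc)
  also have "\<dots> = \<tau> (?k ** mpow \<rho> (1/2) ** mpow \<rho> (1/2))"
    using k by (intro M.tr_comm) (auto intro: subalg_mem)
  also have "\<dots> = \<tau> (?k ** \<rho>)"
    by (simp add: mpow_simps flip: matrix_mul_assoc)
  also have "\<dots> = \<tau> (?k ** r)" by (rule tr_\<rho>[OF k])
  also have "\<dots> = \<tau> (mpow r (-1/2) ** (cadj x ** y ** (mpow r (-1/2) ** mpow r 1)))"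
    by (simp add: mpow_simps(15) matrix_mul_assoc)
  also have "\<dots> = \<tau> (cadj x ** y ** (mpow r (-1/2) ** mpow r 1) ** mpow r (-1/2))"
    by (intro N.tr_comm) auto
  also have "\<dots> = M.ip x y"
    by (simp add: M.ip_def mpow_simps(3,7,11) flip: matrix_mul_assoc)
  finally show ?thesis .
qed

text \<open>The powers of \<open>\<rho>\<close> cancel cyclically, leaving \<open>\<sigma>\<close>
  paired with an element of \<open>N\<close>, where it may be replaced by \<open>s\<close>.\<close>

lemma V_modular:
  assumes [simp]: "x \<in> N" "y \<in> N"
  shows "M.ip (V x) (\<sigma> ** V y ** mpow \<rho> (-1)) = M.ip x (s ** y ** mpow r (-1))"
proof -
  let ?k = "cadj x ** \<sigma> ** y ** mpow r (-1/2)"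
  have "M.ip (V x) (\<sigma> ** V y ** mpow \<rho> (-1)) = \<tau> (mpow \<rho> (1/2) ** (mpow r (-1/2) ** ?k ** mpow \<rho> (-1/2)))"
    by (simp add: M.ip_def V_def cadj_mult mpow_simps flip: matrix_mul_assoc)
  also have "\<dots> = \<tau> ((mpow r (-1/2) ** ?k ** mpow \<rho> (-1/2)) ** mpow \<rho> (1/2))"
    by (intro M.tr_comm) auto
  also have "\<dots> = \<tau> ((mpow r (-1/2) ** cadj x) ** (\<sigma> ** (y ** mpow r (-1/2))))"
    by (simp add: mpow_simps flip: matrix_mul_assoc)
  also have "\<dots> = \<tau> ((\<sigma> ** (y ** mpow r (-1/2))) ** (mpow r (-1/2) ** cadj x))"
    by (intro M.tr_comm) auto
  also have "\<dots> = \<tau> (\<sigma> ** (y ** mpow r (-1) ** cadj x))"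
    by (simp add: mpow_simps flip: matrix_mul_assoc)
  also have "\<dots> = \<tau> ((y ** mpow r (-1) ** cadj x) ** \<sigma>)"
    by (intro M.tr_comm) auto
  also have "\<dots> = \<tau> ((y ** mpow r (-1) ** cadj x) ** s)"
    by (intro tr_\<sigma>) auto
  also have "\<dots> = \<tau> ((y ** mpow r (-1)) ** (cadj x ** s))"
    by (simp flip: matrix_mul_assoc)
  also have "\<dots> = \<tau> ((cadj x ** s) ** (y ** mpow r (-1)))"
    by (intro N.tr_comm) auto
  finally show ?thesis by (simp add: M.ip_def matrix_mul_assoc)
qed

section \<open>Resolvent vectors and their a priori bounds\<close>

definition \<xi> where "\<xi> l = resolv \<sigma> \<rho> l (mpow \<rho> (1/2))"
definition \<eta> where "\<eta> l = resolv s r l (mpow r (1/2))"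
definition w where "w l = \<xi> l - V (\<eta> l)"
text \<open>The defect of the diagonal resolvent coefficients; integrating it against
  \<open>l powr x\<close> reproduces the defect of \<open>Qs\<close> up to a constant.\<close>

definition G where "G l = M.ip (mpow \<rho> (1/2)) (\<xi> l) - M.ip (mpow r (1/2)) (\<eta> l)"
definition q where "q = Re (\<tau> (mpow \<rho> (-1) ** (\<sigma> ** \<sigma>)))"

lemma \<xi>_mem [simp]: "\<xi> l \<in> M"
  and \<eta>_mem [simp]: "\<eta> l \<in> N"
  by (simp_all add: \<xi>_def \<eta>_def)

lemma w_mem [simp]: "w l \<in> M"
  by (simp add: w_def)

lemma \<xi>_eq: "l > 0 \<Longrightarrow> smul (of_real l) (\<xi> l) + \<sigma> ** \<xi> l ** mpow \<rho> (-1) = mpow \<rho> (1/2)"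
  by (simp add: \<xi>_def resolv_eq)

lemma \<eta>_eq: "l > 0 \<Longrightarrow> smul (of_real l) (\<eta> l) + s ** \<eta> l ** mpow r (-1) = mpow r (1/2)"
  by (simp add: \<eta>_def resolv_eq)

text \<open>The defect of the resolvents is the quadratic form of \<open>l + \<Delta>\<close> at \<open>w l\<close>, because compressing \<open>\<Delta>\<close> by the isometry \<open>V\<close>
  gives the modular operator of the subalgebra.\<close>

lemma w_G:
  assumes l: "l > 0" shows "l * (M.nrm (w l))\<^sup>2 \<le> Re (G l)"
proof -
  let ?A = "\<lambda>x. smul (of_real l) x + \<sigma> ** x ** mpow \<rho> (-1)"
  let ?u = "mpow r (1/2)"
  have A_mem: "?A x \<in> M" if "x \<in> M" for x using that by simp
  have A_adj: "M.ip x (?A y) = M.ip (?A x) y" if "x \<in> M" "y \<in> M" for x y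
    using that by (simp add: M.ip_add_left M.ip_add_right M.ip_smul_left M.ip_smul_right M.modular_selfadjoint)
  have V_A: "M.ip (V x) (?A (V y)) = M.ip x (smul (of_real l) y + s ** y ** mpow r (-1))"
    if "x \<in> N" "y \<in> N" for x y
    using that by (simp add: M.ip_add_right M.ip_smul_right V_isometry V_modular)
  have A\<xi>: "?A (\<xi> l) = V ?u" using \<xi>_eq[OF l] by (simp add: V_sqrt)
  have Aw: "?A (w l) = V ?u - ?A (V (\<eta> l))"
    unfolding A\<xi>[symmetric] w_def
    by (simp add: matrix_diff_ldistrib matrix_diff_rdistrib vec_eq_iff smul_def right_diff_distrib)
  have "l * (M.nrm (w l))\<^sup>2 \<le> Re (M.ip (w l) (?A (w l)))"
    using M.modular_resolvent_bound(1)[of \<sigma> \<rho> "w l" "?A (w l)" l] l by simp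
  also have "M.ip (w l) (?A (w l)) = M.ip (\<xi> l) (V ?u) - M.ip (\<xi> l) (?A (V (\<eta> l))) - M.ip (V (\<eta> l)) (V ?u) + M.ip (V (\<eta> l)) (?A (V (\<eta> l)))"
    unfolding Aw unfolding w_def by (simp add: M.ip_diff_left M.ip_diff_right)
  \<comment> \<open>\<open>\<eta> l\<close> solves the compressed equation, so this term cancels the
    preceding one; by self-adjointness the mixed term becomes the coefficient of
    \<open>\<eta> l\<close>.\<close>
  also have "M.ip (V (\<eta> l)) (?A (V (\<eta> l))) = M.ip (V (\<eta> l)) (V ?u)"
    by (simp add: V_A V_isometry \<eta>_eq[OF l])
  also have "M.ip (\<xi> l) (?A (V (\<eta> l))) = M.ip ?u (\<eta> l)"
    by (simp only: A_adj \<xi>_mem \<eta>_mem V_mem A\<xi>) (simp add: V_isometry)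
  also have "M.ip (\<xi> l) (V ?u) = cnj (M.ip (mpow \<rho> (1/2)) (\<xi> l))"
    using M.ip_cnj[of "\<xi> l" "mpow \<rho> (1/2)"] by (simp add: V_sqrt)
  finally show ?thesis by (simp add: G_def)
qed

lemma nrm_V: "x \<in> N \<Longrightarrow> M.nrm (V x) = M.nrm x"
  by (simp add: M.nrm_def V_isometry)

lemma nrm_sqrt_\<rho>: "M.nrm (mpow \<rho> (1/2)) = 1"
  using tr_1 by (simp add: M.nrm_def M.ip_def mpow_simps)

lemma nrm_sqrt_r: "M.nrm (mpow r (1/2)) = 1"
  using nrm_V[of "mpow r (1/2)"] by (simp add: V_sqrt nrm_sqrt_\<rho>)

text \<open>Each of the two resolvents acts on a unit vector and contributes
  \<open>1 / l\<close>.\<close>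

lemma w_bound_1:
  assumes l: "l > 0" shows "M.nrm (w l) \<le> 2 / l"
proof -
  have "M.nrm (\<xi> l) \<le> 1 / l"
    using M.modular_resolvent_bound(2)[of \<sigma> \<rho> "\<xi> l" "mpow \<rho> (1/2)" l] \<xi>_eq[OF l] l by (simp add: nrm_sqrt_\<rho>)
  moreover have "M.nrm (V (\<eta> l)) \<le> 1 / l"
    using N.modular_resolvent_bound(2)[of s r "\<eta> l" "mpow r (1/2)" l] \<eta>_eq[OF l] l by (simp add: nrm_sqrt_r nrm_V)
  ultimately show ?thesis
    using M.nrm_triangle[of "\<xi> l" "V (\<eta> l)"] by (simp add: w_def)
qed

text \<open>The source of the constant \<open>q\<close>: applying \<open>\<Delta>\<close> to the
  square root of \<open>\<rho>\<close> gives a vector whose squared norm is the quadratic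
  quasi-entropy.\<close>

lemma nrm_\<Delta>: "M.nrm (\<sigma> ** mpow \<rho> (1/2) ** mpow \<rho> (-1)) = sqrt q"
proof -
  have herm: "cadj \<sigma> = \<sigma>" using posdef_hermitian[OF pd(2)] by (simp add: hermitian_mat_def)
  have "M.ip (\<sigma> ** mpow \<rho> (1/2) ** mpow \<rho> (-1)) (\<sigma> ** mpow \<rho> (1/2) ** mpow \<rho> (-1)) = \<tau> (mpow \<rho> (-1/2) ** (\<sigma> ** \<sigma> ** mpow \<rho> (-1/2)))"
    by (simp add: M.ip_def cadj_mult herm mpow_simps flip: matrix_mul_assoc)
  also have "\<dots> = \<tau> ((\<sigma> ** \<sigma> ** mpow \<rho> (-1/2)) ** mpow \<rho> (-1/2))"
    by (intro M.tr_comm) auto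
  also have "\<dots> = \<tau> ((\<sigma> ** \<sigma>) ** mpow \<rho> (-1))"
    by (simp add: mpow_simps flip: matrix_mul_assoc)
  also have "\<dots> = \<tau> (mpow \<rho> (-1) ** (\<sigma> ** \<sigma>))"
    by (intro M.tr_comm) auto
  finally show ?thesis by (simp add: M.nrm_def q_def)
qed

lemma q_pos: "q > 0"
proof -
  let ?x = "\<sigma> ** mpow \<rho> (1/2) ** mpow \<rho> (-1)"
  have "?x \<noteq> 0"
  proof
    assume "?x = 0"
    hence "?x ** mpow \<rho> (1/2) = 0" by simp
    hence "\<sigma> = 0" by (simp add: mpow_simps flip: matrix_mul_assoc)
    thus False using tr_1 M.tr_0 by simp
  qed
  hence "M.nrm ?x \<noteq> 0" by (subst M.nrm_eq_0) auto
  hence "0 < M.nrm ?x" using M.nrm_nonneg[of ?x] by (simp add: order_less_le)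
  thus ?thesis by (simp add: nrm_\<Delta>)
qed

text \<open>Compression does not increase the norm: by \<open>V_modular\<close>, pairing
  \<open>V ?x\<close> with the vector upstairs returns the squared norm of
  \<open>?x\<close>.\<close>

lemma nrm_\<Delta>_N: "M.nrm (s ** mpow r (1/2) ** mpow r (-1)) \<le> sqrt q"
proof -
  let ?x = "s ** mpow r (1/2) ** mpow r (-1)" and ?y = "\<sigma> ** mpow \<rho> (1/2) ** mpow \<rho> (-1)"
  have "(M.nrm ?x)\<^sup>2 = Re (M.ip (V ?x) ?y)"
    using V_modular[of ?x "mpow r (1/2)"] M.nrm_square[of ?x] by (simp add: V_sqrt)
  also have "\<dots> \<le> M.nrm (V ?x) * M.nrm ?y"
    using M.Cauchy_Schwarz[of "V ?x" ?y] complex_Re_le_cmod[of "M.ip (V ?x) ?y"] by simp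
  also have "\<dots> = M.nrm ?x * sqrt q" by (simp add: nrm_V nrm_\<Delta>)
  finally have "M.nrm ?x * M.nrm ?x \<le> M.nrm ?x * sqrt q" by (simp add: power2_eq_square)
  moreover have "0 \<le> M.nrm ?x" by simp
  ultimately show ?thesis using q_pos by (cases "M.nrm ?x = 0") (auto dest: mult_left_le_imp_le)
qed

text \<open>\<open>l\<close> times the resolvent of \<open>h\<close> is \<open>h\<close> minus the
  resolvent of \<open>\<Delta> h\<close>. The leading terms agree under \<open>V\<close> and cancel
  in \<open>w l\<close>, leaving two resolvents of vectors of norm at most \<open>sqrt q\<close>,
  which gains a second factor \<open>1 / l\<close>.\<close>

lemma w_bound_2:
  assumes l: "l > 0" shows "M.nrm (w l) \<le> 2 * sqrt q / l\<^sup>2"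
proof -
  let ?D = "\<sigma> ** \<xi> l ** mpow \<rho> (-1)" and ?F = "s ** \<eta> l ** mpow r (-1)"
  \<comment> \<open>\<open>?D\<close> is \<open>\<Delta>\<close> applied to \<open>\<xi> l\<close>,
    hence solves the same resolvent equation with \<open>\<Delta>\<close> applied to the right-hand
    side.\<close>
  have "smul (of_real l) ?D + \<sigma> ** ?D ** mpow \<rho> (-1) = \<sigma> ** mpow \<rho> (1/2) ** mpow \<rho> (-1)"
    unfolding \<xi>_eq[OF l, symmetric]
    by (simp add: matrix_add_ldistrib matrix_add_rdistrib smul_mult_left smul_mult_right matrix_mul_assoc)
  from M.modular_resolvent_bound(2)[OF _ _ _ _ _ _ l this]
  have D: "M.nrm ?D \<le> sqrt q / l" by (simp add: nrm_\<Delta>)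
  have "smul (of_real l) ?F + s ** ?F ** mpow r (-1) = s ** mpow r (1/2) ** mpow r (-1)"
    unfolding \<eta>_eq[OF l, symmetric]
    by (simp add: matrix_add_ldistrib matrix_add_rdistrib smul_mult_left smul_mult_right matrix_mul_assoc)
  from N.modular_resolvent_bound(2)[OF _ _ _ _ _ _ l this]
  have "M.nrm ?F \<le> M.nrm (s ** mpow r (1/2) ** mpow r (-1)) / l" by simp
  also have "\<dots> \<le> sqrt q / l" using nrm_\<Delta>_N l by (simp add: divide_right_mono)
  finally have F: "M.nrm (V ?F) \<le> sqrt q / l" by (simp add: nrm_V)
  have \<xi>': "smul (of_real l) (\<xi> l) = mpow \<rho> (1/2) - ?D" using \<xi>_eq[OF l] by (simp add: eq_diff_eq)
  have "smul (of_real l) (V (\<eta> l)) + V ?F = mpow \<rho> (1/2)"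
    unfolding V_smul[symmetric] V_add[symmetric] \<eta>_eq[OF l] by (rule V_sqrt)
  hence \<eta>': "smul (of_real l) (V (\<eta> l)) = mpow \<rho> (1/2) - V ?F" by (simp add: eq_diff_eq)
  have "smul (of_real l) (w l) = smul (of_real l) (\<xi> l) - smul (of_real l) (V (\<eta> l))"
    by (simp add: w_def smul_def vec_eq_iff right_diff_distrib)
  also have "\<dots> = V ?F - ?D" unfolding \<xi>' \<eta>' by simp
  finally have "l * M.nrm (w l) = M.nrm (V ?F - ?D)"
    using M.nrm_smul[of "w l" "of_real l"] l by simp
  also have "\<dots> \<le> 2 * (sqrt q / l)"
    using M.nrm_triangle[of "V ?F" ?D] D F by simp
  finally show ?thesis using l by (simp add: field_simps power2_eq_square)
qed

text \<open>The Stieltjes formula in weak form, upstairs and through \<open>V\<close>. For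
  \<open>Re z > 0\<close> the two subtracted \<open>1 / l\<close> terms cancel because
  \<open>V\<close> matches the square roots of \<open>r\<close> and \<open>\<rho>\<close>.\<close>

lemma w_integral:
  assumes y: "y \<in> M" and z: "-1 < Re z" "Re z < 1" "Re z \<noteq> 0"
  shows "((\<lambda>l. of_real l powr z * M.ip y (w l)) has_integral
    (- of_real pi / sin (of_real pi * z) * M.ip y (mpow \<sigma> z ** mpow \<rho> (1/2) ** mpow \<rho> (- z) - V (mpow s z ** mpow r (1/2) ** mpow r (- z))))) {0<..}"
proof -
  have h: "hermitian_mat \<rho>" "hermitian_mat \<sigma>" "hermitian_mat r" "hermitian_mat s"
    by (simp_all add: posdef_hermitian)
  have 1: "((\<lambda>l. of_real l powr z * (M.ip y (resolv \<sigma> \<rho> l (mpow \<rho> (1/2))) - (if Re z > 0 then M.ip y (mpow \<rho> (1/2)) / of_real l else 0)))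
     has_integral (- of_real pi / sin (of_real pi * z) * M.ip y (mpow \<sigma> z ** mpow \<rho> (1/2) ** mpow \<rho> (- z)))) {0<..}"
    using y h by (intro resolv_functional_integral z)
      (simp_all add: dblspec_def M.ip_sum_right M.ip_smul_right M.sum_mem)
  have 2: "((\<lambda>l. of_real l powr z * (M.ip y (V (resolv s r l (mpow r (1/2)))) - (if Re z > 0 then M.ip y (V (mpow r (1/2))) / of_real l else 0)))
     has_integral (- of_real pi / sin (of_real pi * z) * M.ip y (V (mpow s z ** mpow r (1/2) ** mpow r (- z))))) {0<..}"
    using y h by (intro resolv_functional_integral[where \<phi> = "\<lambda>x. M.ip y (V x)"] z)
      (simp_all add: dblspec_def V_sum V_smul M.ip_sum_right M.ip_smul_right M.sum_mem)
  have "((\<lambda>l. of_real l powr z * (M.ip y (resolv \<sigma> \<rho> l (mpow \<rho> (1/2))) - (if Re z > 0 then M.ip y (mpow \<rho> (1/2)) / of_real l else 0))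
      - of_real l powr z * (M.ip y (V (resolv s r l (mpow r (1/2)))) - (if Re z > 0 then M.ip y (V (mpow r (1/2))) / of_real l else 0)))
     has_integral (- of_real pi / sin (of_real pi * z) * M.ip y (mpow \<sigma> z ** mpow \<rho> (1/2) ** mpow \<rho> (- z))
      - - of_real pi / sin (of_real pi * z) * M.ip y (V (mpow s z ** mpow r (1/2) ** mpow r (- z))))) {0<..}"
    by (rule has_integral_diff[OF 1 2])
  moreover have "of_real l powr z * (M.ip y (resolv \<sigma> \<rho> l (mpow \<rho> (1/2))) - (if Re z > 0 then M.ip y (mpow \<rho> (1/2)) / of_real l else 0))
      - of_real l powr z * (M.ip y (V (resolv s r l (mpow r (1/2)))) - (if Re z > 0 then M.ip y (V (mpow r (1/2))) / of_real l else 0))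
     = of_real l powr z * M.ip y (w l)" for l
    using y by (simp add: w_def \<xi>_def \<eta>_def M.ip_diff_right V_sqrt right_diff_distrib)
  ultimately show ?thesis
    using y by (simp add: M.ip_diff_right right_diff_distrib)
qed

text \<open>The diagonal coefficient of \<open>\<Delta>\<close> to the power \<open>x\<close> at the
  square root of the state is \<open>Qs\<close>. The subtracted \<open>1 / l\<close> terms cancel
  because both square roots have the same norm.\<close>

lemma G_integral:
  assumes z: "-1 < x" "x < 1" "x \<noteq> 0"
  shows "((\<lambda>l. of_real l powr of_real x * G l) has_integral
    (- of_real pi / sin (of_real pi * of_real x) * (Qs \<tau> x \<rho> \<sigma> - Qs \<tau> x r s))) {0<..}"
proof -
  let ?z = "complex_of_real x"
  have z': "-1 < Re ?z" "Re ?z < 1" "Re ?z \<noteq> 0" using z by simp_all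
  have h: "hermitian_mat \<rho>" "hermitian_mat \<sigma>" "hermitian_mat r" "hermitian_mat s"
    by (simp_all add: posdef_hermitian)
  have e: "1/2 - ?z + 1/2 = 1 - ?z" by simp
  have Q: "M.ip (mpow \<rho> (1/2)) (mpow \<sigma> ?z ** mpow \<rho> (1/2) ** mpow \<rho> (- ?z)) = Qs \<tau> x \<rho> \<sigma>"
  proof -
    have "M.ip (mpow \<rho> (1/2)) (mpow \<sigma> ?z ** mpow \<rho> (1/2) ** mpow \<rho> (- ?z)) = \<tau> ((mpow \<rho> (1/2) ** mpow \<sigma> ?z) ** mpow \<rho> (1/2 - ?z))"
      by (simp add: M.ip_def mpow_simps flip: matrix_mul_assoc)
    also have "\<dots> = \<tau> (mpow \<rho> (1/2 - ?z) ** (mpow \<rho> (1/2) ** mpow \<sigma> ?z))"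
      by (intro M.tr_comm) auto
    also have "\<dots> = Qs \<tau> x \<rho> \<sigma>" by (simp add: Qs_def mpow_simps(5) e)
    finally show ?thesis .
  qed
  have QN: "M.ip (mpow r (1/2)) (mpow s ?z ** mpow r (1/2) ** mpow r (- ?z)) = Qs \<tau> x r s"
  proof -
    have "M.ip (mpow r (1/2)) (mpow s ?z ** mpow r (1/2) ** mpow r (- ?z)) = \<tau> ((mpow r (1/2) ** mpow s ?z) ** mpow r (1/2 - ?z))"
      by (simp add: M.ip_def mpow_simps flip: matrix_mul_assoc)
    also have "\<dots> = \<tau> (mpow r (1/2 - ?z) ** (mpow r (1/2) ** mpow s ?z))"
      by (intro N.tr_comm) auto
    also have "\<dots> = Qs \<tau> x r s" by (simp add: Qs_def mpow_simps(7) e)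
    finally show ?thesis .
  qed
  have 1: "((\<lambda>l. of_real l powr ?z * (M.ip (mpow \<rho> (1/2)) (resolv \<sigma> \<rho> l (mpow \<rho> (1/2))) - (if Re ?z > 0 then M.ip (mpow \<rho> (1/2)) (mpow \<rho> (1/2)) / of_real l else 0)))
     has_integral (- of_real pi / sin (of_real pi * ?z) * M.ip (mpow \<rho> (1/2)) (mpow \<sigma> ?z ** mpow \<rho> (1/2) ** mpow \<rho> (- ?z)))) {0<..}"
    using h by (intro resolv_functional_integral z')
      (simp_all add: dblspec_def M.ip_sum_right M.ip_smul_right M.sum_mem)
  have 2: "((\<lambda>l. of_real l powr ?z * (M.ip (mpow r (1/2)) (resolv s r l (mpow r (1/2))) - (if Re ?z > 0 then M.ip (mpow r (1/2)) (mpow r (1/2)) / of_real l else 0)))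
     has_integral (- of_real pi / sin (of_real pi * ?z) * M.ip (mpow r (1/2)) (mpow s ?z ** mpow r (1/2) ** mpow r (- ?z)))) {0<..}"
    using h by (intro resolv_functional_integral z')
      (simp_all add: dblspec_def M.ip_sum_right M.ip_smul_right M.sum_mem)
  have n: "M.ip (mpow \<rho> (1/2)) (mpow \<rho> (1/2)) = M.ip (mpow r (1/2)) (mpow r (1/2))"
    using V_isometry[of "mpow r (1/2)" "mpow r (1/2)"] by (simp add: V_sqrt)
  have "of_real l powr ?z * (M.ip (mpow \<rho> (1/2)) (resolv \<sigma> \<rho> l (mpow \<rho> (1/2))) - (if Re ?z > 0 then M.ip (mpow \<rho> (1/2)) (mpow \<rho> (1/2)) / of_real l else 0))
      - of_real l powr ?z * (M.ip (mpow r (1/2)) (resolv s r l (mpow r (1/2))) - (if Re ?z > 0 then M.ip (mpow r (1/2)) (mpow r (1/2)) / of_real l else 0))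
     = of_real l powr ?z * G l" for l
    unfolding n by (simp add: G_def \<xi>_def \<eta>_def right_diff_distrib)
  thus ?thesis
    using has_integral_diff[OF 1 2] by (simp only: Q QN right_diff_distrib)
qed

text \<open>Passing to the modulus treats both signs of \<open>x\<close> at once, although the
  prefactor of the defect changes sign with \<open>x\<close>.\<close>

lemma Qs_Re_G_integral:
  assumes z: "-1 < x" "x < 1" "x \<noteq> 0"
  obtains I where "((\<lambda>l. l powr x * Re (G l)) has_integral I) {0<..}"
    "I \<le> pi / sin (pi * \<bar>x\<bar>) * cmod (Qs \<tau> x \<rho> \<sigma> - Qs \<tau> x r s)"
proof
  let ?d = "Qs \<tau> x \<rho> \<sigma> - Qs \<tau> x r s"
  have "((\<lambda>l. Re (of_real l powr of_real x * G l)) has_integral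
    Re (- of_real pi / sin (of_real pi * of_real x) * ?d)) {0<..}"
    using has_integral_linear[OF G_integral[OF z] bounded_linear_Re] by (simp add: o_def)
  moreover have "Re (of_real l powr of_real x * G l) = l powr x * Re (G l)" if "l \<in> {0<..}" for l
    using that by (simp add: powr_of_real)
  ultimately show "((\<lambda>l. l powr x * Re (G l)) has_integral Re (- of_real pi / sin (of_real pi * of_real x) * ?d)) {0<..}"
    by (rule has_integral_eq[rotated]) auto
  have sin_pos: "sin (pi * \<bar>x\<bar>) > 0" using z by (intro sin_gt_zero) auto
  have "Re (- of_real pi / sin (of_real pi * of_real x) * ?d) \<le> cmod (- of_real pi / sin (of_real pi * of_real x) * ?d)"
    by (rule complex_Re_le_cmod)
  also have "\<dots> = pi / \<bar>sin (pi * x)\<bar> * cmod ?d"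
    by (simp add: norm_mult norm_divide sin_of_real flip: of_real_mult)
  also have "\<bar>sin (pi * x)\<bar> = sin (pi * \<bar>x\<bar>)"
    using sin_pos by (cases "x \<ge> 0") (auto simp: abs_if)
  finally show "Re (- of_real pi / sin (of_real pi * of_real x) * ?d) \<le> pi / sin (pi * \<bar>x\<bar>) * cmod ?d" .
qed

end

section \<open>Recovery maps\<close>

lemma beta_dens_eq: "beta_dens t = pi / 4 / (cosh (pi * t / 2))\<^sup>2"
proof -
  have "cosh (pi * t) + 1 = 2 * (cosh (pi * t / 2))\<^sup>2"
    using cosh_double_cosh[of "pi * t / 2"] by simp
  thus ?thesis by (simp add: beta_dens_def)
qed

lemma beta_dens_nonneg: "0 \<le> beta_dens t"
  by (simp add: beta_dens_eq)

lemma has_bochner_integral_FTC_real_line: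
  fixes f F :: "real \<Rightarrow> real"
  assumes "\<And>x. (F has_field_derivative f x) (at x)" "\<And>x. isCont f x" "\<And>x. 0 \<le> f x"
    and "(F \<longlongrightarrow> A) at_bot" "(F \<longlongrightarrow> B) at_top"
  shows "has_bochner_integral lborel f (B - A)"
proof -
  have "set_integrable lborel (einterval (-\<infinity>) \<infinity>) f" "(LBINT x=-\<infinity>..\<infinity>. f x) = B - A"
    by (rule interval_integral_FTC_nonneg[where F = F and A = A and B = B];
        use assms in \<open>simp add: ereal_tendsto_simps\<close>)+
  thus ?thesis
    by (simp add: has_bochner_integral_iff set_integrable_def interval_lebesgue_integral_def set_lebesgue_integral_def einterval_eq_UNIV)
qed

lemma filterlim_half_pi: "filterlim (\<lambda>t::real. pi * t / 2) at_top at_top" "filterlim (\<lambda>t::real. pi * t / 2) at_bot at_bot"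
  using filterlim_tendsto_pos_mult_at_top[OF tendsto_const[of "pi/2"] _ filterlim_ident]
    filterlim_tendsto_pos_mult_at_bot[OF tendsto_const[of "pi/2"] _ filterlim_ident]
  by simp_all

lemma beta_dens_integral: "has_bochner_integral lborel beta_dens 1"
proof -
  have "has_bochner_integral lborel beta_dens (1/2 * 1 - 1/2 * (-1))"
  proof (rule has_bochner_integral_FTC_real_line[where F = "\<lambda>t. 1/2 * tanh (pi * t / 2)"])
    fix t :: real
    have "1 - (tanh (pi * t / 2))\<^sup>2 = 1 / (cosh (pi * t / 2))\<^sup>2"
      using hyperbolic_pythagoras[of "pi * t / 2"]
      by (simp add: tanh_def power_divide diff_divide_eq_iff divide_simps)
    thus "((\<lambda>t. 1/2 * tanh (pi * t / 2)) has_field_derivative beta_dens t) (at t)"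
      by (auto intro!: derivative_eq_intros simp: beta_dens_eq)
    show "isCont beta_dens t"
      unfolding beta_dens_def by (intro continuous_intros) (smt (verit) cosh_real_pos)
    show "((\<lambda>t. 1/2 * tanh (pi * t / 2)) \<longlongrightarrow> 1/2 * 1) at_top"
      by (intro tendsto_intros filterlim_compose[OF tanh_real_at_top] filterlim_half_pi)
    show "((\<lambda>t. 1/2 * tanh (pi * t / 2)) \<longlongrightarrow> 1/2 * (-1)) at_bot"
      by (intro tendsto_intros filterlim_compose[OF tanh_real_at_bot] filterlim_half_pi)
  qed (rule beta_dens_nonneg)
  thus ?thesis by simp
qed

text \<open>One factor \<open>cosh\<close> cancels, leaving a hyperbolic secant, whose
  antiderivative is the Gudermannian function.\<close>

lemma beta_dens_cosh_integral: "has_bochner_integral lborel (\<lambda>t. beta_dens t * cosh (pi * (t / 2))) (pi / 2)"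
proof -
  have eq: "beta_dens t * cosh (pi * (t / 2)) = pi / 4 / cosh (pi * t / 2)" for t
    by (simp add: beta_dens_eq power2_eq_square)
  have "has_bochner_integral lborel (\<lambda>t. pi / 4 / cosh (pi * t / 2)) (1/2 * (pi/2) - 1/2 * (- (pi/2)))"
  proof (rule has_bochner_integral_FTC_real_line[where F = "\<lambda>t. 1/2 * arctan (sinh (pi * t / 2))"])
    fix t :: real
    have "1 + (sinh (pi * t / 2))\<^sup>2 = (cosh (pi * t / 2))\<^sup>2"
      using cosh_square_eq[of "pi * t / 2"] by simp
    thus "((\<lambda>t. 1/2 * arctan (sinh (pi * t / 2))) has_field_derivative pi / 4 / cosh (pi * t / 2)) (at t)"
      by (auto intro!: derivative_eq_intros simp: power2_eq_square field_simps)
    show "isCont (\<lambda>t. pi / 4 / cosh (pi * t / 2)) t"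
      by (intro continuous_intros) simp_all
    show "0 \<le> pi / 4 / cosh (pi * t / 2)" by simp
    show "((\<lambda>t. 1/2 * arctan (sinh (pi * t / 2))) \<longlongrightarrow> 1/2 * (pi/2)) at_top"
      by (intro tendsto_intros filterlim_compose[OF tendsto_arctan_at_top] filterlim_compose[OF sinh_real_at_top] filterlim_half_pi)
    show "((\<lambda>t. 1/2 * arctan (sinh (pi * t / 2))) \<longlongrightarrow> 1/2 * (- (pi/2))) at_bot"
      by (intro tendsto_intros filterlim_compose[OF tendsto_arctan_at_bot] filterlim_compose[OF sinh_real_at_bot] filterlim_half_pi)
  qed
  thus ?thesis unfolding eq by simp
qed

section \<open>Integrability of matrix-valued functions against the density\<close>

lemma bounded_bilinear_matrix_mult: "bounded_bilinear ((**) :: 'n::finite cmat \<Rightarrow> 'n cmat \<Rightarrow> 'n cmat)"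
  unfolding bilinear_conv_bounded_bilinear[symmetric] bilinear_def
  by (auto intro!: linearI simp: matrix_add_ldistrib matrix_add_rdistrib scaleR_smul smul_mult_left smul_mult_right)

lemma bounded_linear_smul: "bounded_linear (\<lambda>c. smul c A)"
  unfolding linear_conv_bounded_linear[symmetric]
  by (auto intro!: linearI simp: smul_add_left scaleR_smul smul_smul scaleR_conv_of_real)

lemma bounded_linear_cadj: "bounded_linear (cadj :: 'n::finite cmat \<Rightarrow> 'n cmat)"
  unfolding linear_conv_bounded_linear[symmetric]
  by (auto intro!: linearI simp: cadj_add scaleR_smul cadj_smul)

text \<open>A class closed under sums and matrix products that guarantees integrability against
  \<open>beta_dens\<close>.\<close>

definition bounded_cont :: "(real \<Rightarrow> 'a::real_normed_vector) \<Rightarrow> bool" where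
  "bounded_cont f \<longleftrightarrow> continuous_on UNIV f \<and> bounded (range f)"

lemma bounded_cont_const: "bounded_cont (\<lambda>_. c)"
  by (simp add: bounded_cont_def)

lemma bounded_cont_sum: "(\<And>i. i \<in> S \<Longrightarrow> bounded_cont (f i)) \<Longrightarrow> bounded_cont (\<lambda>t. \<Sum>i\<in>S. f i t)"
  by (induction S rule: infinite_finite_induct) 
    (auto simp: bounded_cont_def intro!: continuous_on_add bounded_plus_comp)

lemma bounded_cont_mult:
  fixes f g :: "real \<Rightarrow> 'n::finite cmat"
  assumes "bounded_cont f" "bounded_cont g" shows "bounded_cont (\<lambda>t. f t ** g t)"
proof -
  interpret bounded_bilinear "(**) :: 'n cmat \<Rightarrow> 'n cmat \<Rightarrow> 'n cmat" by (rule bounded_bilinear_matrix_mult)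
  obtain K where K: "\<And>(a :: 'n cmat) (b :: 'n cmat). norm (a ** b) \<le> norm a * norm b * K" "K \<ge> 0" using nonneg_bounded by blast
  obtain B C where B: "\<And>t. norm (f t) \<le> B" and C: "\<And>t. norm (g t) \<le> C"
    using assms by (auto simp: bounded_cont_def bounded_iff)
  have "norm (f t ** g t) \<le> B * C * K" for t
  proof -
    have "norm (f t) * norm (g t) \<le> B * C"
      by (intro mult_mono B C norm_ge_zero order_trans[OF norm_ge_zero B])
    thus ?thesis using K(1)[of "f t" "g t"] mult_right_mono[OF _ K(2)] by (meson order_trans)
  qed
  thus ?thesis using assms continuous_on
    by (auto simp: bounded_cont_def bounded_iff)
qed

text \<open>Along a vertical line the modulus of each eigenvalue power is constant, so the finitely
  many spectral terms stay bounded.\<close>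

lemma bounded_cont_mpow:
  assumes A: "posdef A" shows "bounded_cont (\<lambda>t. mpow A (of_real a + \<i> * of_real (b * t)))"
  unfolding mpow_def matfun_spec[OF posdef_hermitian[OF A]]
proof (rule bounded_cont_sum)
  fix c assume "c \<in> spec A"
  hence c: "c > 0" using A by (simp add: posdef_def)
  obtain K where K: "\<And>x. norm (smul x (specproj A c)) \<le> norm x * K"
    using bounded_linear.bounded[OF bounded_linear_smul] by blast
  have "continuous_on UNIV (\<lambda>t. complex_of_real c powr (of_real a + \<i> * of_real (b * t)))"
    unfolding cpowr_pos[OF c] by (intro continuous_intros)
  hence "continuous_on UNIV (\<lambda>t. smul (complex_of_real c powr (of_real a + \<i> * of_real (b * t))) (specproj A c))"
    by (rule bounded_linear.continuous_on[OF bounded_linear_smul])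
  moreover have "norm (smul (complex_of_real c powr (of_real a + \<i> * of_real (b * t))) (specproj A c)) \<le> c powr a * K" for t
    using K[of "complex_of_real c powr (of_real a + \<i> * of_real (b * t))"] by (simp add: norm_cpowr_pos[OF c])
  ultimately show "bounded_cont (\<lambda>t. smul (complex_of_real c powr (of_real a + \<i> * of_real (b * t))) (specproj A c))"
    by (auto simp: bounded_cont_def bounded_iff)
qed

lemma integrable_beta_dens_scaleR:
  fixes f :: "real \<Rightarrow> 'a::euclidean_space"
  assumes "bounded_cont f" shows "integrable lborel (\<lambda>t. beta_dens t *\<^sub>R f t)"
proof -
  obtain B where B: "\<And>t. norm (f t) \<le> B" using assms by (auto simp: bounded_cont_def bounded_iff)
  have int: "integrable lborel beta_dens" using beta_dens_integral by (simp add: has_bochner_integral_iff)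
  show ?thesis
  proof (rule Bochner_Integration.integrable_bound)
    show "integrable lborel (\<lambda>t. B * beta_dens t)" using int by simp
    have "f \<in> borel_measurable lborel"
      using assms by (auto simp: bounded_cont_def intro: borel_measurable_continuous_onI)
    thus "(\<lambda>t. beta_dens t *\<^sub>R f t) \<in> borel_measurable lborel"
      using borel_measurable_integrable[OF int] by (rule borel_measurable_scaleR[rotated])
    have "norm (beta_dens t *\<^sub>R f t) \<le> norm (B * beta_dens t)" for t
    proof -
      have "norm (beta_dens t *\<^sub>R f t) \<le> beta_dens t * B"
        using B[of t] beta_dens_nonneg[of t] by (simp add: mult_left_mono)
      thus ?thesis by (simp add: mult.commute)
    qed
    thus "AE t in lborel. norm (beta_dens t *\<^sub>R f t) \<le> norm (B * beta_dens t)" by simp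
  qed
qed

section \<open>Trace norm of Hermitian elements\<close>

context trace_alg
begin

lemma subspace: "subspace M"
  unfolding subspace_def by (simp add: scaleR_smul)

text \<open>\<open>\<tau>\<close> is linear on \<open>M\<close> only, while Bochner integrals live
  in the full matrix space; composing with \<open>P\<close> turns expressions in
  \<open>\<tau>\<close> into linear functionals there.\<close>

lemma projection:
  obtains P where "bounded_linear P" "\<And>x. P x \<in> M" "\<And>x. x \<in> M \<Longrightarrow> P x = x"
proof -
  have "\<exists>g. range g \<subseteq> M \<and> linear g \<and> (\<forall>v\<in>M. g (id v) = v)"
    by (rule linear_exists_left_inverse_on[OF linear_id subspace]) simp
  thus ?thesis using that unfolding linear_conv_bounded_linear by auto
qed

lemma norm1_hermitian:
  assumes z: "z \<in> M" "hermitian_mat z"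
  obtains u where "u \<in> M" "cadj u ** u = mat 1" "u ** cadj u = mat 1" "norm1 \<tau> z = Re (\<tau> (u ** z))"
proof
  \<comment> \<open>The sign function with value 1 at 0, so that its value at \<open>z\<close> is
    unitary even when \<open>z\<close> is singular.\<close>
  define g where "g = (\<lambda>x::real. if x < 0 then -1 else 1 :: real)"
  let ?u = "matfun (\<lambda>x. complex_of_real (g x)) z"
  show "?u \<in> M" using z by (simp add: matfun_mem)
  have "(\<lambda>x. complex_of_real (g x) * complex_of_real (g x)) = (\<lambda>x. 1)" by (auto simp: g_def fun_eq_iff)
  thus "cadj ?u ** ?u = mat 1" "?u ** cadj ?u = mat 1"
    using z by (simp_all add: matfun_cadj matfun_mult matfun_1)
  have "mabs z = matfun (\<lambda>x. complex_of_real \<bar>x\<bar>) z" by (rule mabs_hermitian[OF z(2)])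
  also have "(\<lambda>x. complex_of_real \<bar>x\<bar>) = (\<lambda>x. complex_of_real (g x) * complex_of_real x)"
    by (auto simp: g_def fun_eq_iff)
  also have "matfun \<dots> z = ?u ** z"
    using matfun_mult[OF z(2), of "\<lambda>x. complex_of_real (g x)" complex_of_real] z(2) by (simp add: matfun_id)
  finally show "norm1 \<tau> z = Re (\<tau> (?u ** z))" by (simp add: norm1_def)
qed

lemma norm1_nonneg:
  assumes z: "z \<in> M" "hermitian_mat z" shows "0 \<le> norm1 \<tau> z"
proof -
  let ?y = "matfun (\<lambda>x. complex_of_real (sqrt \<bar>x\<bar>)) z"
  have "mabs z = matfun (\<lambda>x. complex_of_real (sqrt \<bar>x\<bar>) * complex_of_real (sqrt \<bar>x\<bar>)) z"
    by (simp add: mabs_hermitian[OF z(2)] flip: of_real_mult)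
  also have "\<dots> = cadj ?y ** ?y"
    using z by (simp add: matfun_cadj matfun_mult)
  finally show ?thesis using tr_nonneg[of ?y] z by (simp add: norm1_def matfun_mem)
qed

lemma nrm_mult_unitary:
  assumes "x \<in> M" "u \<in> M" "u ** cadj u = mat 1" shows "nrm (x ** u) = nrm x"
proof -
  have "ip (x ** u) (x ** u) = \<tau> (cadj u ** (cadj x ** x ** u))"
    by (simp add: ip_def cadj_mult matrix_mul_assoc)
  also have "\<dots> = \<tau> (cadj x ** x ** u ** cadj u)"
    using assms by (intro tr_comm) auto
  also have "\<dots> = ip x x" using assms by (simp add: ip_def flip: matrix_mul_assoc)
  finally show ?thesis by (simp add: nrm_def)
qed

text \<open>Telescoping into \<open>cadj a ** (a - b) + cadj (a - b) ** b\<close>, followed by the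
  Cauchy-Schwarz inequality; the unitary is absorbed because it preserves the norm.\<close>

lemma trace_square_difference:
  assumes [simp]: "a \<in> M" "b \<in> M" "u \<in> M" and u: "cadj u ** u = mat 1" "u ** cadj u = mat 1"
  shows "Re (\<tau> (u ** (cadj a ** a - cadj b ** b))) \<le> (nrm a + nrm b) * nrm (a - b)"
proof -
  have "u ** (cadj a ** a - cadj b ** b) = u ** cadj a ** (a - b) + u ** (cadj (a - b) ** b)"
    by (simp add: matrix_diff_ldistrib matrix_diff_rdistrib cadj_diff matrix_mul_assoc)
  hence "\<tau> (u ** (cadj a ** a - cadj b ** b)) = \<tau> (u ** cadj a ** (a - b)) + \<tau> (u ** (cadj (a - b) ** b))"
    by (simp add: tr_add)
  also have "\<tau> (u ** cadj a ** (a - b)) = ip (a ** cadj u) (a - b)"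
    by (simp add: ip_def cadj_mult)
  also have "\<tau> (u ** (cadj (a - b) ** b)) = \<tau> (cadj (a - b) ** b ** u)"
    by (intro tr_comm) auto
  also have "\<dots> = ip (a - b) (b ** u)" by (simp add: ip_def matrix_mul_assoc)
  finally have "Re (\<tau> (u ** (cadj a ** a - cadj b ** b))) \<le> cmod (ip (a ** cadj u) (a - b)) + cmod (ip (a - b) (b ** u))"
    by (simp add: add_mono complex_Re_le_cmod)
  also have "\<dots> \<le> nrm (a ** cadj u) * nrm (a - b) + nrm (a - b) * nrm (b ** u)"
    by (intro add_mono Cauchy_Schwarz) auto
  also have "\<dots> = (nrm a + nrm b) * nrm (a - b)"
    using u by (simp add: nrm_mult_unitary algebra_simps)
  finally show ?thesis .
qed

end

section \<open>From majorants of the resolvent defect to recovery bounds\<close>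

context trace_alg_pair
begin

text \<open>\<open>majorizes_w H\<close> stands for \<open>\<integral> l\<^sup>1\<^sup>/\<^sup>2 \<parallel>w l\<parallel> dl \<le> H\<close>; a majorant with integral \<open>H\<close> avoids integrability of
  the left-hand side.\<close>

definition majorizes_w :: "real \<Rightarrow> bool" where
  "majorizes_w H \<longleftrightarrow> (\<exists>h. (h has_integral H) {0<..} \<and> (\<forall>l>0. sqrt l * M.nrm (w l) \<le> h l))"

text \<open>The weak formula is tested against the difference vector \<open>y\<close> itself. On the
  line \<open>Re z = 1/2\<close> the modulus of the weight is \<open>sqrt l\<close>, and
  \<open>sin (pi * z)\<close> equals \<open>cosh (pi * t)\<close>.\<close>

lemma modular_power_difference:
  assumes H: "majorizes_w H" and z: "z = 1/2 + \<i> * of_real t"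
  shows "M.nrm (mpow \<sigma> z - mpow s z ** mpow r (- z) ** mpow \<rho> z) \<le> cosh (pi * t) / pi * H"
proof -
  \<comment> \<open>A purely imaginary power of \<open>\<rho>\<close>, hence unitary; right
    multiplication by it carries the difference in the claim to \<open>y\<close>.\<close>
  define k where "k = mpow \<rho> (1/2 - z)"
  define y where "y = mpow \<sigma> z ** mpow \<rho> (1/2) ** mpow \<rho> (- z) - V (mpow s z ** mpow r (1/2) ** mpow r (- z))"
  have k [simp]: "k \<in> M" by (simp add: k_def)
  have "k ** cadj k = mpow \<rho> ((1/2 - z) + cnj (1/2 - z))"
    by (simp only: k_def pd(1)[THEN mpow_cadj] mpow_simps(1))
  also have "(1/2 - z) + cnj (1/2 - z) = 0" by (simp add: z)
  finally have kk: "k ** cadj k = mat 1" by (simp add: mpow_0)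
  have y: "y = (mpow \<sigma> z - mpow s z ** mpow r (- z) ** mpow \<rho> z) ** k"
    by (simp add: y_def k_def V_def matrix_diff_rdistrib mpow_simps flip: matrix_mul_assoc)
  have ym [simp]: "y \<in> M" by (simp add: y_def)
  have "M.nrm y = M.nrm (mpow \<sigma> z - mpow s z ** mpow r (- z) ** mpow \<rho> z)"
    unfolding y using kk by (intro M.nrm_mult_unitary) auto
  moreover have "M.nrm y \<le> cosh (pi * t) / pi * H"
  proof -
    obtain h where h: "(h has_integral H) {0<..}" "\<And>l. l > 0 \<Longrightarrow> sqrt l * M.nrm (w l) \<le> h l"
      using H by (auto simp: majorizes_w_def)
    have sin: "sin (of_real pi * z) = of_real (cosh (pi * t))"
    proof -
      have "of_real pi * z = of_real (pi/2) + \<i> * of_real (pi * t)" by (simp add: z algebra_simps)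
      hence "sin (of_real pi * z) = cos (\<i> * of_real (pi * t))"
        by (simp add: sin_add sin_of_real cos_of_real del: of_real_mult of_real_divide)
      also have "\<dots> = cosh (of_real (pi * t))" by (simp only: cosh_conv_cos)
      finally show ?thesis by (simp add: cosh_def scaleR_conv_of_real flip: exp_of_real)
    qed
    have int: "((\<lambda>l. of_real l powr z * M.ip y (w l)) has_integral (- of_real pi / sin (of_real pi * z) * M.ip y y)) {0<..}"
      using w_integral[OF ym, of z] unfolding y_def[symmetric] by (simp add: z)
    have hint: "((\<lambda>l. M.nrm y * h l) has_integral M.nrm y * H) {0<..}"
      by (rule has_integral_mult_right[OF h(1)])
    have "norm (- of_real pi / sin (of_real pi * z) * M.ip y y) \<le> M.nrm y * H"
      unfolding integral_unique[OF int, symmetric] integral_unique[OF hint, symmetric]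
    proof (rule integral_norm_bound_integral)
      fix l :: real assume "l \<in> {0<..}"
      hence l: "l > 0" by simp
      have "norm (of_real l powr z * M.ip y (w l)) = sqrt l * cmod (M.ip y (w l))"
        using l by (simp add: norm_mult norm_cpowr_pos z powr_half_sqrt)
      also have "\<dots> \<le> sqrt l * (M.nrm y * M.nrm (w l))"
        using l by (intro mult_left_mono M.Cauchy_Schwarz) auto
      also have "\<dots> \<le> M.nrm y * h l"
        using mult_left_mono[OF h(2)[OF l] M.nrm_nonneg[OF ym]] by (simp add: mult_ac)
      finally show "norm (of_real l powr z * M.ip y (w l)) \<le> M.nrm y * h l" .
    qed (use int hint in \<open>auto simp: integrable_on_def\<close>)
    hence "pi / cosh (pi * t) * (M.nrm y)\<^sup>2 \<le> M.nrm y * H"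
      unfolding sin M.ip_self[OF ym] by (simp add: norm_mult norm_divide norm_power)
    hence le: "M.nrm y * (pi / cosh (pi * t) * M.nrm y) \<le> M.nrm y * H" by (simp add: power2_eq_square mult_ac)
    \<comment> \<open>Covers the case \<open>M.nrm y = 0\<close>, where the common factor cannot be
      cancelled.\<close>
    have "0 \<le> H"
      using has_integral_nonneg[OF h(1)] h(2) M.nrm_nonneg[OF w_mem]
      by (metis greaterThan_iff mult_nonneg_nonneg order_trans real_sqrt_ge_zero less_imp_le)
    moreover have "pi / cosh (pi * t) * M.nrm y \<le> H" if "M.nrm y \<noteq> 0"
      by (rule mult_left_le_imp_le[OF le]) (use that M.nrm_nonneg[OF ym] in linarith)
    ultimately have "pi / cosh (pi * t) * M.nrm y \<le> H"
      by (cases "M.nrm y = 0") auto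
    thus ?thesis by (simp add: field_simps)
  qed
  ultimately show ?thesis by simp
qed

lemma Rt_mem [simp]: "Rt (\<lambda>_. r) \<rho> t s \<in> M"
  by (simp add: Rt_def)

text \<open>\<open>cnj z + z = 1\<close> makes the two inner powers of \<open>s\<close> multiply to
  \<open>s\<close>. The norm of \<open>b\<close> is 1 because the recovery map preserves the trace,
  by duality of \<open>\<rho>\<close> with \<open>r\<close>.\<close>

lemma Rt_square:
  assumes z: "z = 1/2 + \<i> * of_real t" and b: "b = mpow s z ** mpow r (- z) ** mpow \<rho> z"
  shows "Rt (\<lambda>_. r) \<rho> t s = cadj b ** b" "M.nrm b = 1"
proof -
  have c: "cnj z = 1/2 - \<i> * of_real t" by (simp add: z)
  have zz: "cnj z + z = 1" by (simp add: c) (simp add: z)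
  have m: "-1/2 + \<i> * complex_of_real t = - cnj z" "-1/2 - \<i> * complex_of_real t = - z" unfolding c by (simp_all add: z)
  have "cadj b ** b = mpow \<rho> (cnj z) ** (mpow r (- cnj z) ** (mpow s (cnj z) ** (mpow s z ** (mpow r (- z) ** mpow \<rho> z))))"
    by (simp add: b cadj_mult mpow_simps flip: matrix_mul_assoc)
  also have "\<dots> = mpow \<rho> (cnj z) ** (mpow r (- cnj z) ** (s ** (mpow r (- z) ** mpow \<rho> z)))"
    by (simp only: mpow_simps(8) zz pd(4)[THEN mpow_1])
  finally have bb: "cadj b ** b = mpow \<rho> (cnj z) ** (mpow r (- cnj z) ** (s ** (mpow r (- z) ** mpow \<rho> z)))" .
  show "Rt (\<lambda>_. r) \<rho> t s = cadj b ** b"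
    unfolding Rt_def bb by (simp only: m c[symmetric] z[symmetric] matrix_mul_assoc)
  have zz': "z + cnj z = 1" using zz by (simp add: add.commute)
  have "\<tau> (cadj b ** b) = \<tau> ((mpow r (- cnj z) ** s ** mpow r (- z) ** mpow \<rho> z) ** mpow \<rho> (cnj z))"
    unfolding bb by (subst M.tr_comm) (auto simp: matrix_mul_assoc)
  also have "\<dots> = \<tau> ((mpow r (- cnj z) ** s ** mpow r (- z)) ** \<rho>)"
    by (simp only: mpow_simps(1) zz' pd(1)[THEN mpow_1] matrix_mul_assoc[symmetric])
  also have "\<dots> = \<tau> ((mpow r (- cnj z) ** s ** mpow r (- z)) ** r)"
    by (intro tr_\<rho>) auto
  also have "\<dots> = \<tau> (mpow r (- cnj z) ** (s ** (mpow r (- z) ** mpow r 1)))"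
    by (simp only: pd(3)[THEN mpow_1] matrix_mul_assoc)
  also have "\<dots> = \<tau> ((s ** (mpow r (- z) ** mpow r 1)) ** mpow r (- cnj z))"
    by (intro N.tr_comm) auto
  also have "\<dots> = \<tau> (s ** mpow r (- z + 1 + - cnj z))"
    by (simp only: mpow_simps(3) matrix_mul_assoc[symmetric])
  also have "- z + 1 + - cnj z = 0" using zz' by (simp add: algebra_simps)
  also have "\<tau> (s ** mpow r 0) = 1" using tr_\<sigma>[of "mat 1"] tr_1 by (simp add: mpow_0)
  finally show "M.nrm b = 1" by (simp add: M.nrm_def M.ip_def)
qed

lemma Rt_hermitian: "hermitian_mat (Rt (\<lambda>_. r) \<rho> t s)"
  unfolding hermitian_mat_def Rt_square(1)[OF refl refl] by (simp add: cadj_mult)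

lemma \<sigma>_hermitian: "hermitian_mat \<sigma>"
  by (simp add: posdef_hermitian)

text \<open>Stated for an arbitrary unitary rather than for the trace norm, so that one unitary can
  be kept fixed while averaging over \<open>t\<close>.\<close>

lemma trace_Rt_bound:
  assumes H: "majorizes_w H" and u: "u \<in> M" "cadj u ** u = mat 1" "u ** cadj u = mat 1"
  shows "Re (\<tau> (u ** (\<sigma> - Rt (\<lambda>_. r) \<rho> t s))) \<le> 2 * cosh (pi * t) / pi * H"
proof -
  define z where "z = 1/2 + \<i> * of_real t"
  let ?a = "mpow \<sigma> z" and ?b = "mpow s z ** mpow r (- z) ** mpow \<rho> z"
  have "cnj z + z = 1" by (simp add: z_def)
  hence a: "cadj ?a ** ?a = \<sigma>" by (simp add: mpow_simps)
  hence na: "M.nrm ?a = 1" by (simp add: M.nrm_def M.ip_def tr_1)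
  have "Re (\<tau> (u ** (\<sigma> - Rt (\<lambda>_. r) \<rho> t s))) \<le> (M.nrm ?a + M.nrm ?b) * M.nrm (?a - ?b)"
    unfolding Rt_square(1)[OF z_def refl] using M.trace_square_difference[of ?a ?b u] u unfolding a by simp
  also have "\<dots> = 2 * M.nrm (?a - ?b)" by (simp add: na Rt_square(2)[OF z_def refl])
  also have "\<dots> \<le> 2 * (cosh (pi * t) / pi * H)"
    using modular_power_difference[OF H z_def] by simp
  finally show ?thesis by simp
qed

lemma norm1_Rt_bound:
  assumes H: "majorizes_w H" shows "pi / (2 * cosh (pi * t)) * norm1 \<tau> (\<sigma> - Rt (\<lambda>_. r) \<rho> t s) \<le> H"
proof -
  have "hermitian_mat (\<sigma> - Rt (\<lambda>_. r) \<rho> t s)"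
    using Rt_hermitian \<sigma>_hermitian by (simp add: hermitian_mat_def cadj_diff)
  then obtain u where "u \<in> M" "cadj u ** u = mat 1" "u ** cadj u = mat 1"
    "norm1 \<tau> (\<sigma> - Rt (\<lambda>_. r) \<rho> t s) = Re (\<tau> (u ** (\<sigma> - Rt (\<lambda>_. r) \<rho> t s)))"
    using M.norm1_hermitian[of "\<sigma> - Rt (\<lambda>_. r) \<rho> t s"] by (metis M.diff_mem Rt_mem mem(2))
  hence "norm1 \<tau> (\<sigma> - Rt (\<lambda>_. r) \<rho> t s) \<le> 2 * cosh (pi * t) / pi * H"
    using trace_Rt_bound[OF H] by simp
  thus ?thesis by (simp add: field_simps)
qed

lemma Rt_half_bounded_cont: "bounded_cont (\<lambda>t. Rt (\<lambda>_. r) \<rho> (t / 2) s)"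
proof -
  have "bounded_cont (\<lambda>t. mpow \<rho> (of_real (1/2) + \<i> * of_real ((-1/2) * t)) ** mpow r (of_real (-1/2) + \<i> * of_real ((1/2) * t)) ** s
    ** mpow r (of_real (-1/2) + \<i> * of_real ((-1/2) * t)) ** mpow \<rho> (of_real (1/2) + \<i> * of_real ((1/2) * t)))"
    by (intro bounded_cont_mult bounded_cont_mpow bounded_cont_const pd)
  thus ?thesis by (simp add: Rt_def)
qed

text \<open>Bounded linear maps commute with the Bochner integral: the projection gives membership,
  the adjoint gives hermiticity, and the functional \<open>?L\<close> gives the trace
  formula.\<close>

lemma Ru_mem: "Ru (\<lambda>_. r) \<rho> s \<in> M"
  and Ru_hermitian: "hermitian_mat (Ru (\<lambda>_. r) \<rho> s)"
  and Ru_trace_integral: "u \<in> M \<Longrightarrow> has_bochner_integral lborel (\<lambda>t. beta_dens t * Re (\<tau> (u ** Rt (\<lambda>_. r) \<rho> (t / 2) s))) (Re (\<tau> (u ** Ru (\<lambda>_. r) \<rho> s)))"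
proof -
  let ?R = "\<lambda>t. Rt (\<lambda>_. r) \<rho> (t / 2) s"
  obtain P where P: "bounded_linear P" "\<And>x. P x \<in> M" "\<And>x. x \<in> M \<Longrightarrow> P x = x"
    using M.projection by metis
  have int: "integrable lborel (\<lambda>t. beta_dens t *\<^sub>R ?R t)"
    by (rule integrable_beta_dens_scaleR[OF Rt_half_bounded_cont])
  have mem: "beta_dens t *\<^sub>R ?R t \<in> M" for t by (simp add: scaleR_smul)
  have "P (Ru (\<lambda>_. r) \<rho> s) = Ru (\<lambda>_. r) \<rho> s"
    unfolding Ru_def using integral_bounded_linear[OF P(1) int] by (simp add: P(3)[OF mem])
  thus Ru: "Ru (\<lambda>_. r) \<rho> s \<in> M" using P(2) by metis
  have "cadj (Ru (\<lambda>_. r) \<rho> s) = Ru (\<lambda>_. r) \<rho> s"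
    unfolding Ru_def using integral_bounded_linear[OF bounded_linear_cadj int] Rt_hermitian
    by (simp add: scaleR_smul cadj_smul hermitian_mat_def)
  thus "hermitian_mat (Ru (\<lambda>_. r) \<rho> s)" by (simp add: hermitian_mat_def)
  assume u: "u \<in> M"
  let ?L = "\<lambda>x. Re (\<tau> (u ** P x))"
  interpret P: bounded_linear P by (rule P(1))
  have L: "bounded_linear ?L"
  proof -
    have "P (r *\<^sub>R x) = smul (of_real r) (P x)" for r x using P.scaleR[of r x] by (simp only: scaleR_smul)
    thus ?thesis
      unfolding linear_conv_bounded_linear[symmetric] using u P(2)
      by (intro linearI) (simp_all add: P.add matrix_add_ldistrib M.tr_add smul_mult_right M.tr_smul)
  qed
  have "has_bochner_integral lborel (\<lambda>t. beta_dens t *\<^sub>R ?R t) (Ru (\<lambda>_. r) \<rho> s)"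
    using int by (simp add: has_bochner_integral_iff Ru_def)
  from has_bochner_integral_bounded_linear[OF L this]
  have "has_bochner_integral lborel (\<lambda>t. ?L (beta_dens t *\<^sub>R ?R t)) (?L (Ru (\<lambda>_. r) \<rho> s))" .
  thus "has_bochner_integral lborel (\<lambda>t. beta_dens t * Re (\<tau> (u ** ?R t))) (Re (\<tau> (u ** Ru (\<lambda>_. r) \<rho> s)))"
    using u by (simp add: P(3) Ru P.scaleR scaleR_smul smul_mult_right M.tr_smul)
qed

lemma norm1_Ru_bound:
  assumes H: "majorizes_w H" shows "norm1 \<tau> (\<sigma> - Ru (\<lambda>_. r) \<rho> s) \<le> H"
proof -
  have "hermitian_mat (\<sigma> - Ru (\<lambda>_. r) \<rho> s)"
    using Ru_hermitian \<sigma>_hermitian by (simp add: hermitian_mat_def cadj_diff)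
  then obtain u where u: "u \<in> M" "cadj u ** u = mat 1" "u ** cadj u = mat 1"
    and n: "norm1 \<tau> (\<sigma> - Ru (\<lambda>_. r) \<rho> s) = Re (\<tau> (u ** (\<sigma> - Ru (\<lambda>_. r) \<rho> s)))"
    using M.norm1_hermitian[of "\<sigma> - Ru (\<lambda>_. r) \<rho> s"] by (metis M.diff_mem Ru_mem mem(2))
  \<comment> \<open>The unitary comes from the averaged difference and does not depend on
    \<open>t\<close>. As the density has total mass 1, the constant \<open>?c\<close> can be moved
    under the integral.\<close>
  let ?c = "Re (\<tau> (u ** \<sigma>))"
  have "has_bochner_integral lborel (\<lambda>t. beta_dens t * ?c - beta_dens t * Re (\<tau> (u ** Rt (\<lambda>_. r) \<rho> (t / 2) s)))
     (1 * ?c - Re (\<tau> (u ** Ru (\<lambda>_. r) \<rho> s)))"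
    by (intro has_bochner_integral_diff has_bochner_integral_mult_left beta_dens_integral Ru_trace_integral u)
  moreover have "1 * ?c - Re (\<tau> (u ** Ru (\<lambda>_. r) \<rho> s)) = norm1 \<tau> (\<sigma> - Ru (\<lambda>_. r) \<rho> s)"
    using u Ru_mem by (simp add: n matrix_diff_ldistrib M.tr_diff)
  ultimately have 1: "has_bochner_integral lborel (\<lambda>t. beta_dens t * ?c - beta_dens t * Re (\<tau> (u ** Rt (\<lambda>_. r) \<rho> (t / 2) s)))
     (norm1 \<tau> (\<sigma> - Ru (\<lambda>_. r) \<rho> s))" by simp
  have 2: "has_bochner_integral lborel (\<lambda>t. beta_dens t * cosh (pi * (t / 2)) * (2 / pi * H)) (pi / 2 * (2 / pi * H))"
    by (intro has_bochner_integral_mult_left beta_dens_cosh_integral)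
  have "norm1 \<tau> (\<sigma> - Ru (\<lambda>_. r) \<rho> s) \<le> pi / 2 * (2 / pi * H)"
    unfolding has_bochner_integral_integral_eq[OF 1, symmetric] has_bochner_integral_integral_eq[OF 2, symmetric]
  proof (rule integral_mono)
    fix t :: real
    have "?c - Re (\<tau> (u ** Rt (\<lambda>_. r) \<rho> (t / 2) s)) \<le> cosh (pi * (t / 2)) * (2 / pi * H)"
      using trace_Rt_bound[OF H u, of "t / 2"] u by (simp add: matrix_diff_ldistrib M.tr_diff mult_ac)
    from mult_left_mono[OF this beta_dens_nonneg[of t]]
    show "beta_dens t * ?c - beta_dens t * Re (\<tau> (u ** Rt (\<lambda>_. r) \<rho> (t / 2) s)) \<le> beta_dens t * cosh (pi * (t / 2)) * (2 / pi * H)"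
      by (simp add: right_diff_distrib mult.assoc)
  qed (use 1 2 in \<open>auto simp: has_bochner_integral_iff\<close>)
  thus ?thesis by simp
qed

text \<open>The recovery errors enter only through \<open>X\<close>, a number below the integral of
  every majorant; this serves the rotated and the averaged map alike.\<close>

lemma Qs_recovery:
  assumes x: "-1 < x" "x < 1" "x \<noteq> 0" and X: "X \<ge> 0" "\<And>H. majorizes_w H \<Longrightarrow> X \<le> H"
  shows "Kconst x q * (X / (2 + \<bar>x\<bar>)) powr (4 + 2 * \<bar>x\<bar>) \<le> cmod (Qs \<tau> x \<rho> \<sigma> - Qs \<tau> x r s)"
proof (rule field_le_epsilon)
  \<comment> \<open>The added \<open>\<epsilon>\<close> keeps \<open>D\<close> positive when the
    defect is zero, since the optimal parameters need \<open>D > 0\<close>.\<close>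
  fix \<epsilon> :: real assume \<epsilon>: "\<epsilon> > 0"
  let ?\<delta> = "cmod (Qs \<tau> x \<rho> \<sigma> - Qs \<tau> x r s)"
  have sin_pos: "sin (pi * \<bar>x\<bar>) > 0" using x by (intro sin_gt_zero) auto
  define D where "D = pi / sin (pi * \<bar>x\<bar>) * (?\<delta> + \<epsilon>)"
  have D: "D > 0" unfolding D_def using sin_pos \<epsilon> by (intro mult_pos_pos divide_pos_pos add_nonneg_pos) auto
  obtain I where I: "((\<lambda>l. l powr x * Re (G l)) has_integral I) {0<..}" "I \<le> pi / sin (pi * \<bar>x\<bar>) * ?\<delta>"
    using Qs_Re_G_integral[OF x] .
  have ID: "I \<le> D"
  proof -
    have "pi / sin (pi * \<bar>x\<bar>) * ?\<delta> \<le> D"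
      unfolding D_def using sin_pos \<epsilon> by (intro mult_left_mono) auto
    thus ?thesis using I(2) by linarith
  qed
  have "Kconst x q * (X / (2 + \<bar>x\<bar>)) powr (4 + 2 * \<bar>x\<bar>) \<le> sin (pi * \<bar>x\<bar>) / pi * D"
  proof (rule Kconst_optimization[OF x q_pos D X(1)])
    fix e T \<theta> c :: real
    assume par: "e \<ge> 0" "T > 0" "\<theta> > 0" "c \<ge> 0" "\<And>l. e < l \<Longrightarrow> l \<le> T \<Longrightarrow> l powr (-x) \<le> c"
    obtain h where h: "(h has_integral (4 * sqrt e + 4 * sqrt q / sqrt T + I / (2 * \<theta>) + \<theta> / 2 * c * T)) {0<..}"
      "\<And>l. l > 0 \<Longrightarrow> sqrt l * M.nrm (w l) \<le> h l"
      by (rule sqrt_weighted_majorant[of "\<lambda>l. M.nrm (w l)" "sqrt q" "\<lambda>l. Re (G l)" x I e T \<theta> c])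
        (use par w_bound_1 w_bound_2 w_G I(1) q_pos in auto)
    hence "X \<le> 4 * sqrt e + 4 * sqrt q / sqrt T + I / (2 * \<theta>) + \<theta> / 2 * c * T"
      by (intro X(2)) (auto simp: majorizes_w_def)
    also have "I / (2 * \<theta>) \<le> D / (2 * \<theta>)" using ID par by (intro divide_right_mono) auto
    finally show "X \<le> 4 * sqrt e + 4 * sqrt q / sqrt T + D / (2 * \<theta>) + \<theta> / 2 * c * T" by simp
  qed
  also have "\<dots> = ?\<delta> + \<epsilon>" using sin_pos by (simp add: D_def)
  finally show "Kconst x q * (X / (2 + \<bar>x\<bar>)) powr (4 + 2 * \<bar>x\<bar>) \<le> ?\<delta> + \<epsilon>" .
qed

end

section \<open>Strict positivity of the conditional expectation\<close>

lemma cond_exp_posdef: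
  assumes M: "star_subalg M" and N: "star_subalg N" and sub: "N \<subseteq> M" and tr: "faithful_trace M \<tau>"
    and E: "cond_exp M N \<tau> E" and \<rho>: "\<rho> \<in> M" "posdef \<rho>"
  shows "E \<rho> \<in> N" "posdef (E \<rho>)" "x \<in> N \<Longrightarrow> \<tau> (x ** \<rho>) = \<tau> (x ** E \<rho>)"
proof -
  interpret M: trace_alg M \<tau> using M tr by unfold_locales
  interpret N: trace_alg N \<tau> using N tr sub by unfold_locales (auto simp: faithful_trace_def subset_iff)
  show r: "E \<rho> \<in> N" using E \<rho> by (simp add: cond_exp_def)
  have dual: "\<tau> (x ** \<rho>) = \<tau> (x ** E \<rho>)" if "x \<in> N" for x using E \<rho> that by (simp add: cond_exp_def)
  show "x \<in> N \<Longrightarrow> \<tau> (x ** \<rho>) = \<tau> (x ** E \<rho>)" by (rule dual)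
  have NM: "x \<in> M" if "x \<in> N" for x using sub that by blast
  have herm: "cadj \<rho> = \<rho>" using posdef_hermitian[OF \<rho>(2)] by (simp add: hermitian_mat_def)
  \<comment> \<open>\<open>cond_exp\<close> supplies duality only, so hermiticity is derived first:
    duality with the Hermitian \<open>\<rho>\<close> makes the trace of \<open>cadj d ** d\<close>
    vanish.\<close>
  define d where "d = E \<rho> - cadj (E \<rho>)"
  have d: "d \<in> N" using r by (simp add: d_def)
  have "\<tau> (cadj d ** d) = \<tau> (cadj d ** E \<rho>) - \<tau> (cadj d ** cadj (E \<rho>))"
    using d r by (simp add: d_def matrix_diff_ldistrib N.tr_diff)
  also have "\<tau> (cadj d ** cadj (E \<rho>)) = cnj (\<tau> (E \<rho> ** d))"
    using N.tr_cadj[of "E \<rho> ** d"] d r by (simp add: cadj_mult)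
  also have "\<tau> (E \<rho> ** d) = \<tau> (d ** \<rho>)"
    using d r by (simp add: N.tr_comm[of "E \<rho>" d] dual)
  also have "cnj (\<tau> (d ** \<rho>)) = \<tau> (\<rho> ** cadj d)"
    using M.tr_cadj[of "d ** \<rho>"] NM[OF d] \<rho> by (simp add: cadj_mult herm)
  also have "\<dots> = \<tau> (cadj d ** E \<rho>)"
    using M.tr_comm[of \<rho> "cadj d"] NM d \<rho> dual[of "cadj d"] by simp
  finally have "d = 0" using N.tr_pos[OF d] by force
  hence h: "hermitian_mat (E \<rho>)" by (simp add: d_def hermitian_mat_def)
  show "posdef (E \<rho>)" unfolding posdef_def
  proof (intro conjI ballI h)
    fix a assume a: "a \<in> spec (E \<rho>)"
    \<comment> \<open>By duality \<open>a\<close> times the trace of \<open>?p\<close> is the trace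
      of \<open>?p ** \<rho>\<close>, which is the squared norm of the nonzero element
      \<open>?y\<close> and hence positive.\<close>
    let ?p = "specproj (E \<rho>) a"
    have p: "?p \<in> N" "?p \<in> M" using h r NM by auto
    have pp: "cadj ?p = ?p" "?p ** ?p = ?p" using h by (simp_all add: specproj_hermitian specproj_mult)
    have "?p ** E \<rho> = smul (of_real a) ?p"
      using specproj_matfun[OF h, of a complex_of_real] by (simp add: matfun_id[OF h])
    hence 1: "\<tau> (?p ** \<rho>) = of_real a * \<tau> ?p" using p by (simp add: dual N.tr_smul)
    have \<tau>p: "Re (\<tau> ?p) > 0" using N.tr_pos[OF p(1) spec_nonzero[OF a]] by (simp add: pp)
    let ?y = "mpow \<rho> (1/2) ** ?p"
    have "?y \<noteq> 0"
    proof
      assume "?y = 0"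
      hence "mpow \<rho> (-1/2) ** ?y = 0" by simp
      thus False using spec_nonzero[OF a] \<rho> by (simp add: mpow_mult_assoc mpow_0)
    qed
    hence "0 < Re (\<tau> (cadj ?y ** ?y))" using \<rho> p by (intro M.tr_pos) auto
    also have "\<tau> (cadj ?y ** ?y) = \<tau> (?p ** (\<rho> ** ?p))"
      using \<rho> by (simp add: cadj_mult pp mpow_cadj mpow_mult_assoc mpow_1 flip: matrix_mul_assoc)
    also have "\<dots> = \<tau> ((\<rho> ** ?p) ** ?p)" using \<rho> p by (intro M.tr_comm) auto
    also have "\<dots> = \<tau> (\<rho> ** ?p)" by (simp add: pp flip: matrix_mul_assoc)
    also have "\<dots> = \<tau> (?p ** \<rho>)" using \<rho> p by (intro M.tr_comm) auto
    finally have "0 < a * Re (\<tau> ?p)" by (simp add: 1)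
    thus "a > 0" using \<tau>p by (simp add: zero_less_mult_iff)
  qed
qed

theorem theorem4p7:
  fixes M N :: "'n::finite cmat set"
    and \<tau> :: "'n cmat \<Rightarrow> complex"
    and E :: "'n cmat \<Rightarrow> 'n cmat"
    and \<rho> \<sigma> :: "'n cmat"
    and s t :: real
  assumes "star_subalg M" and "star_subalg N" and "N \<subseteq> M"
    and "faithful_trace M \<tau>"
    and "cond_exp M N \<tau> E"
    and "faithful_state M \<tau> \<rho>" and "faithful_state M \<tau> \<sigma>"
    and "-1 < s" and "s < 1" and "s \<noteq> 0"
  shows
    "cmod (Qs \<tau> s \<rho> \<sigma> - Qs \<tau> s (E \<rho>) (E \<sigma>))
       \<ge> Kconst s (Re (Qx2 \<tau> \<rho> \<sigma>)) *
         (pi / (4 + 2 * \<bar>s\<bar>) * norm1 \<tau> (\<sigma> - Rt E \<rho> 0 (E \<sigma>))) powr (4 + 2 * \<bar>s\<bar>)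
   \<and> cmod (Qs \<tau> s \<rho> \<sigma> - Qs \<tau> s (E \<rho>) (E \<sigma>))
       \<ge> Kconst s (Re (Qx2 \<tau> \<rho> \<sigma>)) *
         (pi / ((4 + 2 * \<bar>s\<bar>) * cosh (pi * t)) * norm1 \<tau> (\<sigma> - Rt E \<rho> t (E \<sigma>))) powr (4 + 2 * \<bar>s\<bar>)
   \<and> cmod (Qs \<tau> s \<rho> \<sigma> - Qs \<tau> s (E \<rho>) (E \<sigma>))
       \<ge> Kconst s (Re (Qx2 \<tau> \<rho> \<sigma>)) *
         (1 / (2 + \<bar>s\<bar>) * norm1 \<tau> (\<sigma> - Ru E \<rho> (E \<sigma>))) powr (4 + 2 * \<bar>s\<bar>)"
proof -
  have \<rho>: "\<rho> \<in> M" "posdef \<rho>" "\<tau> \<rho> = 1" and \<sigma>: "\<sigma> \<in> M" "posdef \<sigma>" "\<tau> \<sigma> = 1"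
    using assms by (auto simp: faithful_state_def psd_invertible_posdef)
  note E\<rho> = cond_exp_posdef[OF assms(1-5) \<rho>(1,2)]
  note E\<sigma> = cond_exp_posdef[OF assms(1-5) \<sigma>(1,2)]
  interpret trace_alg_pair M N \<tau> \<rho> \<sigma> "E \<rho>" "E \<sigma>"
    using assms(1-4) \<rho> \<sigma> E\<rho> E\<sigma> by unfold_locales (auto simp: faithful_trace_def subset_iff)
  \<comment> \<open>The recovery maps depend on \<open>E\<close> only through
    \<open>E \<rho>\<close>, so a constant map may stand in its place.\<close>
  have Rt: "Rt E \<rho> t' (E \<sigma>) = Rt (\<lambda>_. E \<rho>) \<rho> t' (E \<sigma>)" for t' by (simp add: Rt_def)
  have Ru: "Ru E \<rho> (E \<sigma>) = Ru (\<lambda>_. E \<rho>) \<rho> (E \<sigma>)" unfolding Ru_def Rt ..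
  have q: "Re (Qx2 \<tau> \<rho> \<sigma>) = q" by (simp add: Qx2_def q_def mpow_inverse)
  have Rt_bound: "Kconst s q * (pi / ((4 + 2 * \<bar>s\<bar>) * cosh (pi * t')) * norm1 \<tau> (\<sigma> - Rt E \<rho> t' (E \<sigma>))) powr (4 + 2 * \<bar>s\<bar>)
    \<le> cmod (Qs \<tau> s \<rho> \<sigma> - Qs \<tau> s (E \<rho>) (E \<sigma>))" for t'
  proof -
    have "hermitian_mat (\<sigma> - Rt (\<lambda>_. E \<rho>) \<rho> t' (E \<sigma>))"
      using Rt_hermitian \<sigma>_hermitian by (simp add: hermitian_mat_def cadj_diff)
    hence "0 \<le> norm1 \<tau> (\<sigma> - Rt (\<lambda>_. E \<rho>) \<rho> t' (E \<sigma>))" by (intro M.norm1_nonneg) auto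
    hence "0 \<le> pi / (2 * cosh (pi * t')) * norm1 \<tau> (\<sigma> - Rt (\<lambda>_. E \<rho>) \<rho> t' (E \<sigma>))" by simp
    from Qs_recovery[OF assms(8-10) this norm1_Rt_bound]
    have "Kconst s q * (pi / (2 * cosh (pi * t')) * norm1 \<tau> (\<sigma> - Rt (\<lambda>_. E \<rho>) \<rho> t' (E \<sigma>)) / (2 + \<bar>s\<bar>)) powr (4 + 2 * \<bar>s\<bar>)
      \<le> cmod (Qs \<tau> s \<rho> \<sigma> - Qs \<tau> s (E \<rho>) (E \<sigma>))" .
    moreover have eq: "pi / (2 * cosh (pi * t')) * y / (2 + \<bar>s\<bar>) = pi / ((4 + 2 * \<bar>s\<bar>) * cosh (pi * t')) * y" for y
    proof -
      have "(4 + 2 * \<bar>s\<bar>) * cosh (pi * t') = 2 * cosh (pi * t') * (2 + \<bar>s\<bar>)" by (simp add: algebra_simps)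
      thus ?thesis by simp
    qed
    ultimately show ?thesis by (simp only: Rt eq)
  qed
  have "hermitian_mat (\<sigma> - Ru (\<lambda>_. E \<rho>) \<rho> (E \<sigma>))"
    using Ru_hermitian \<sigma>_hermitian by (simp add: hermitian_mat_def cadj_diff)
  hence "0 \<le> norm1 \<tau> (\<sigma> - Ru (\<lambda>_. E \<rho>) \<rho> (E \<sigma>))" using Ru_mem by (intro M.norm1_nonneg) auto
  from Qs_recovery[OF assms(8-10) this norm1_Ru_bound]
  have "Kconst s q * (norm1 \<tau> (\<sigma> - Ru (\<lambda>_. E \<rho>) \<rho> (E \<sigma>)) / (2 + \<bar>s\<bar>)) powr (4 + 2 * \<bar>s\<bar>)
      \<le> cmod (Qs \<tau> s \<rho> \<sigma> - Qs \<tau> s (E \<rho>) (E \<sigma>))" .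
  \<comment> \<open>The unrotated map is the case \<open>t = 0\<close>, where the hyperbolic cosine
    is 1.\<close>
  thus ?thesis using Rt_bound[of 0] Rt_bound[of t] by (simp add: q Ru)
qed

end
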